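(* Let $A\to M$ be a Lie algebroid with algebroid differential $d_A$, regarded as a degree $1$ vector field on $[-1]A$, and let $\gamma=\exp(\iota_{d_A})$ be the generalized Mathai-Quillen-Kalkman isomorphism, an automorphism of the algebra $C^\infty([-1]T([-1]A))$. Then the de Rham differential $d$ of $[-1]A$ is $\gamma$-related to $d+\mathcal L_{d_A}$, i.e. $$\gamma\circ d=(d+\mathcal L_{d_A})\circ\gamma .$$
   Context: $[-1]A$ is the graded supermanifold with support $M$ and function algebra $\Gamma(\bigwedge A^* )$; local coordinates are $x^i$ (degree $0$, from $M$) and $\lambda^\alpha$ (degree $1$, dual to a local frame of $A$). The Lie algebroid differential $d_A$ is a derivation of degree $1$ of $\Gamma(\bigwedge A^* )$ with $d_A^2=0$, hence a homological vector field on $[-1]A$. $[-1]T([-1]A)$ is the supermanifold whose functions are the differential forms on $[-1]A$; it has coordinates $x^i,\lambda^\alpha$ and $\dot x^i=dx^i$ of degree $1$, $\dot\lambda^\alpha=d\lambda^\alpha$ of degree $2$ (functions are graded-commutative for the total degree). The de Rham differential $d=\dot x^i\partial/\partial x^i+\dot\lambda^\alpha\partial/\partial\lambda^\alpha$ is a degree $1$ derivation of $C^\infty([-1]T([-1]A))$. For a vector field $X=f^i\partial/\partial y^i$ on $[-1]A$ (in coordinates $y=(x,\lambda)$), $\iota_X=f^i\partial/\partial\dot y^i$ is the contraction, a derivation of degree $|X|-1$, and $\mathcal L_X=[\iota_X,d]$ (graded commutator) is the Lie derivative, of degree $|X|$. In particular $\iota_{d_A}$ has degree $0$ and is nilpotent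 (so that $\gamma=\exp(\iota_{d_A})$ makes sense). *)

theory Defs
  imports "HOL-Analysis.Analysis" "HOL-Library.Function_Algebras"
begin

section \<open>Smooth functions on open subsets of \<open>Euclidean_space n\<close>\<close>

definition pd :: "nat \<Rightarrow> ((nat \<Rightarrow> real) \<Rightarrow> real) \<Rightarrow> (nat \<Rightarrow> real) \<Rightarrow> real" where
  "pd i f x = deriv (\<lambda>t. f (x(i := t))) (x i)"

text \<open>
  \<open>C\<^sup>\<infinity>\<close>: all iterated partial derivatives exist and are continuous. This is only used for sets \<open>U\<close>
  that are open in \<open>Euclidean_space n\<close>.
\<close>

definition smooth_on :: "nat \<Rightarrow> (nat \<Rightarrow> real) set \<Rightarrow> ((nat \<Rightarrow> real) \<Rightarrow> real) \<Rightarrow> bool" where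
  "smooth_on n U f \<longleftrightarrow>
    (\<forall>is. set is \<subseteq> {..<n} \<longrightarrow>
      continuous_on U (foldr pd is f) \<and>
      (\<forall>x\<in>U. \<forall>i<n. (\<lambda>t. foldr pd is f (x(i := t))) differentiable at (x i)))"


section \<open>Smooth vector bundles\<close>

text \<open>
  The base manifold \<open>M\<close> is the type \<open>'m\<close>. The fibre over \<open>p\<close> is a subspace of the vector space \<open>'v\<close>
  (an ambient space without further meaning). A chart is a coordinate domain of \<open>M\<close> together
  with a local frame of the bundle over it.
\<close>

record ('m, 'v) bchart =
  cdom :: "'m set"
  ccrd :: "'m \<Rightarrow> nat \<Rightarrow> real"
  cfrm :: "nat \<Rightarrow> 'm \<Rightarrow> 'v"

record ('m, 'v) vbundle =
  bdim :: nat
  brank :: nat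
  fibre :: "'m \<Rightarrow> 'v set"
  atlas :: "('m, 'v) bchart set"

definition cpar :: "('m, 'v) bchart \<Rightarrow> (nat \<Rightarrow> real) \<Rightarrow> 'm" where
  "cpar c = inv_into (cdom c) (ccrd c)"

text \<open>The coordinate partial derivative \<open>\<partial>f/\<partial>x\<^sup>i\<close> at \<open>p\<close>.\<close>

definition cpd :: "('m, 'v) bchart \<Rightarrow> nat \<Rightarrow> ('m \<Rightarrow> real) \<Rightarrow> 'm \<Rightarrow> real" where
  "cpd c i f p = pd i (f \<circ> cpar c) (ccrd c p)"

text \<open>The dual coframe: the \<open>\<alpha>\<close>-th coefficient of \<open>v\<close> with respect to the frame at \<open>p\<close>.\<close>

definition coframe ::
  "('m, 'v::real_vector, 'z) vbundle_scheme \<Rightarrow> ('m, 'v) bchart \<Rightarrow> nat \<Rightarrow> 'm \<Rightarrow> 'v \<Rightarrow> real" where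
  "coframe A c \<alpha> p v = representation ((\<lambda>\<beta>. cfrm c \<beta> p) ` {..<brank A}) v (cfrm c \<alpha> p)"

definition vector_bundle ::
  "('m::{t2_space, second_countable_topology}, 'v::real_vector, 'z) vbundle_scheme \<Rightarrow> bool" where
  "vector_bundle A \<longleftrightarrow>
    (\<forall>p. subspace (fibre A p)) \<and>
    (\<Union>c\<in>atlas A. cdom c) = UNIV \<and>
    (\<forall>c\<in>atlas A.
      open (cdom c) \<and>
      openin (Euclidean_space (bdim A)) (ccrd c ` cdom c) \<and>
      homeomorphism (cdom c) (ccrd c ` cdom c) (ccrd c) (cpar c) \<and>
      (\<forall>p\<in>cdom c.
        inj_on (\<lambda>\<alpha>. cfrm c \<alpha> p) {..<brank A} \<and>
        independent ((\<lambda>\<alpha>. cfrm c \<alpha> p) ` {..<brank A}) \<and>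
        span ((\<lambda>\<alpha>. cfrm c \<alpha> p) ` {..<brank A}) = fibre A p)) \<and>
    (\<forall>c\<in>atlas A. \<forall>c'\<in>atlas A.
      (\<forall>i<bdim A.
        smooth_on (bdim A) (ccrd c ` (cdom c \<inter> cdom c')) ((\<lambda>p. ccrd c' p i) \<circ> cpar c)) \<and>
      (\<forall>\<alpha><brank A. \<forall>\<beta><brank A.
        smooth_on (bdim A) (ccrd c ` (cdom c \<inter> cdom c'))
          ((\<lambda>p. coframe A c' \<beta> p (cfrm c \<alpha> p)) \<circ> cpar c)))"

definition smooth_fun :: "('m::topological_space, 'v, 'z) vbundle_scheme \<Rightarrow> 'm set \<Rightarrow> ('m \<Rightarrow> real) \<Rightarrow> bool"
  where
  "smooth_fun A V f \<longleftrightarrow>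
    open V \<and> (\<forall>c\<in>atlas A. smooth_on (bdim A) (ccrd c ` (V \<inter> cdom c)) (f \<circ> cpar c))"

definition sections ::
  "('m::topological_space, 'v::real_vector, 'z) vbundle_scheme \<Rightarrow> ('m \<Rightarrow> 'v) set" where
  "sections A =
    {s. (\<forall>p. s p \<in> fibre A p) \<and>
        (\<forall>c\<in>atlas A. \<forall>\<alpha><brank A.
          smooth_on (bdim A) (ccrd c ` cdom c) ((\<lambda>p. coframe A c \<alpha> p (s p)) \<circ> cpar c))}"

text \<open>
  Tangent vectors at \<open>p\<close>, acting on functions that are smooth near \<open>p\<close>: linear combinations of the
  coordinate derivations \<open>\<partial>/\<partial>x\<^sup>i\<close> at \<open>p\<close>.
\<close>

definition tangent_vector ::
  "('m::topological_space, 'v, 'z) vbundle_scheme \<Rightarrow> 'm \<Rightarrow> (('m \<Rightarrow> real) \<Rightarrow> real) \<Rightarrow> bool" where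
  "tangent_vector A p X \<longleftrightarrow>
    (\<forall>c\<in>atlas A. p \<in> cdom c \<longrightarrow>
      (\<exists>a. \<forall>V f. p \<in> V \<and> smooth_fun A V f \<longrightarrow> X f = (\<Sum>i<bdim A. a i * cpd c i f p)))"


section \<open>Lie algebroids\<close>

record ('m, 'v) algebroid = "('m, 'v) vbundle" +
  bracket :: "('m \<Rightarrow> 'v) \<Rightarrow> ('m \<Rightarrow> 'v) \<Rightarrow> 'm \<Rightarrow> 'v"
  anchor :: "'m \<Rightarrow> 'v \<Rightarrow> ('m \<Rightarrow> real) \<Rightarrow> real"

text \<open>The anchor as a smooth vector bundle map \<open>A \<rightarrow> TM\<close>.\<close>

definition smooth_anchor ::
  "('m::topological_space, 'v::real_vector) algebroid \<Rightarrow> bool" where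
  "smooth_anchor A \<longleftrightarrow>
    (\<forall>p. \<forall>v\<in>fibre A p. tangent_vector A p (anchor A p v)) \<and>
    (\<forall>p. \<forall>v\<in>fibre A p. \<forall>w\<in>fibre A p. \<forall>a b V f. p \<in> V \<and> smooth_fun A V f \<longrightarrow>
      anchor A p (a *\<^sub>R v + b *\<^sub>R w) f = a * anchor A p v f + b * anchor A p w f) \<and>
    (\<forall>s\<in>sections A. \<forall>f. smooth_fun A UNIV f \<longrightarrow>
      smooth_fun A UNIV (\<lambda>p. anchor A p (s p) f))"

definition lie_algebroid ::
  "('m::{t2_space, second_countable_topology}, 'v::real_vector) algebroid \<Rightarrow> bool" where
  "lie_algebroid A \<longleftrightarrow>
    vector_bundle A \<and> smooth_anchor A \<and>
    (\<forall>s\<in>sections A. \<forall>t\<in>sections A. bracket A s t \<in> sections A) \<and>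
    (\<forall>s\<in>sections A. \<forall>t\<in>sections A. \<forall>u\<in>sections A. \<forall>a b.
      bracket A (\<lambda>p. a *\<^sub>R s p + b *\<^sub>R t p) u
        = (\<lambda>p. a *\<^sub>R bracket A s u p + b *\<^sub>R bracket A t u p)) \<and>
    (\<forall>s\<in>sections A. \<forall>t\<in>sections A. bracket A s t = (\<lambda>p. - bracket A t s p)) \<and>
    (\<forall>s\<in>sections A. \<forall>t\<in>sections A. \<forall>u\<in>sections A. \<forall>p.
      bracket A s (bracket A t u) p + bracket A t (bracket A u s) p
        + bracket A u (bracket A s t) p = 0) \<and>
    (\<forall>s\<in>sections A. \<forall>t\<in>sections A. \<forall>f. smooth_fun A UNIV f \<longrightarrow>
      bracket A s (\<lambda>p. f p *\<^sub>R t p)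
        = (\<lambda>p. f p *\<^sub>R bracket A s t p + anchor A p (s p) f *\<^sub>R t p)) \<and>
    (\<forall>s\<in>sections A. \<forall>t\<in>sections A. \<forall>f p. smooth_fun A UNIV f \<longrightarrow>
      anchor A p (bracket A s t p) f
        = anchor A p (s p) (\<lambda>q. anchor A q (t q) f)
          - anchor A p (t p) (\<lambda>q. anchor A q (s q) f))"

text \<open>
  The bracket of sections given only near \<open>p\<close> (such as the elements of a local frame). The bracket is
  a local operator, so its value at \<open>p\<close> is that of any global sections with the same germs at \<open>p\<close>.
\<close>

definition local_bracket ::
  "('m::topological_space, 'v::real_vector) algebroid \<Rightarrow> ('m \<Rightarrow> 'v) \<Rightarrow> ('m \<Rightarrow> 'v) \<Rightarrow> 'm \<Rightarrow> 'v" where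
  "local_bracket A s t p =
    (THE v. \<exists>s'\<in>sections A. \<exists>t'\<in>sections A.
      (\<forall>\<^sub>F q in nhds p. s' q = s q \<and> t' q = t q) \<and> v = bracket A s' t' p)"

text \<open>
  The Lie algebroid differential on \<open>A\<close>-forms, given by the Koszul formula. A \<open>k\<close>-form is represented
  as a function of a list of \<open>k\<close> (local) sections.
\<close>

type_synonym ('m, 'v) aform = "('m \<Rightarrow> 'v) list \<Rightarrow> 'm \<Rightarrow> real"

definition remove_nth :: "nat \<Rightarrow> 'a list \<Rightarrow> 'a list" where
  "remove_nth i xs = take i xs @ drop (Suc i) xs"

definition algebroid_diff ::
  "('m::topological_space, 'v::real_vector) algebroid \<Rightarrow> ('m, 'v) aform \<Rightarrow> ('m, 'v) aform" where
  "algebroid_diff A \<omega> ss p =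
    (\<Sum>i<length ss. (-1) ^ i * anchor A p ((ss ! i) p) (\<omega> (remove_nth i ss))) +
    (\<Sum>j<length ss. \<Sum>i<j. (-1) ^ (i + j) *
      \<omega> (local_bracket A (ss ! i) (ss ! j) # remove_nth i (remove_nth j ss)) p)"


section \<open>Polynomials in odd and even generators\<close>

text \<open>
  \<open>G S m\<close> is the coefficient of \<open>\<theta>\<^sub>S \<mu>\<^sub>m\<close>, where \<open>\<theta>\<^sub>S\<close> is the product of the (anticommuting) odd
  generators with indices in \<open>S\<close>, in increasing order, and \<open>\<mu>\<^sub>m\<close> the monomial in the (commuting) even
  generators with exponents \<open>m\<close>.
\<close>

type_synonym spoly = "nat set \<Rightarrow> nat multiset \<Rightarrow> real"

definition smul :: "spoly \<Rightarrow> spoly \<Rightarrow> spoly" where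
  "smul F G = (\<lambda>S m. \<Sum>T\<in>Pow S. \<Sum>k\<in>{k. k \<subseteq># m}.
    (-1) ^ card {(a, b). a \<in> T \<and> b \<in> S - T \<and> b < a} * F T k * G (S - T) (m - k))"

definition sconst :: "real \<Rightarrow> spoly" where
  "sconst a = (\<lambda>S m. if S = {} \<and> m = {#} then a else 0)"

definition odd_gen :: "nat \<Rightarrow> spoly" where
  "odd_gen k = (\<lambda>S m. if S = {k} \<and> m = {#} then 1 else 0)"

definition even_gen :: "nat \<Rightarrow> spoly" where
  "even_gen \<alpha> = (\<lambda>S m. if S = {} \<and> m = {#\<alpha>#} then 1 else 0)"

text \<open>\<open>odd_pd\<close> is the left derivative.\<close>

definition odd_pd :: "nat \<Rightarrow> spoly \<Rightarrow> spoly" where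
  "odd_pd k G = (\<lambda>S m. if k \<in> S then 0 else (-1) ^ card {j\<in>S. j < k} * G (insert k S) m)"

definition even_pd :: "nat \<Rightarrow> spoly \<Rightarrow> spoly" where
  "even_pd \<alpha> G = (\<lambda>S m. real (count m \<alpha> + 1) * G S (add_mset \<alpha> m))"

text \<open>Substitution of \<open>th k\<close> and \<open>mu \<alpha>\<close> for the \<open>k\<close>-th odd and the \<open>\<alpha>\<close>-th even generator.\<close>

definition ssubst :: "(nat \<Rightarrow> spoly) \<Rightarrow> (nat \<Rightarrow> spoly) \<Rightarrow> spoly \<Rightarrow> spoly" where
  "ssubst th mu G =
    (\<Sum>(S, m)\<in>{(S, m). G S m \<noteq> 0}.
      foldr smul (sconst (G S m) # map th (sorted_list_of_set S) @
        map mu (sorted_list_of_multiset m)) (sconst 1))"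


section \<open>The supermanifold \<open>[-1]T([-1]A)\<close>\<close>

text \<open>
  Over a chart with coordinates \<open>x\<^sup>i\<close> (\<open>i < n\<close>) and frame of rank \<open>r\<close>, the fibre coordinates are
  encoded as: \<open>\<lambda>\<^sup>\<alpha>\<close> is the odd generator \<open>\<alpha>\<close>, the differential of \<open>x\<^sup>i\<close> is the odd generator \<open>r + i\<close>,
  and the differential of \<open>\<lambda>\<^sup>\<alpha>\<close>, of degree 2, is the even generator \<open>\<alpha>\<close>. All generators of total
  degree 1 anticommute. Functions on \<open>[-1]A\<close> are those involving only \<open>x\<close> and \<open>\<lambda>\<close>.
\<close>

abbreviation gen_lam :: "nat \<Rightarrow> spoly" where
  "gen_lam \<alpha> \<equiv> odd_gen \<alpha>"

abbreviation gen_xdot :: "('m, 'v, 'z) vbundle_scheme \<Rightarrow> nat \<Rightarrow> spoly" where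
  "gen_xdot A i \<equiv> odd_gen (brank A + i)"

abbreviation gen_lamdot :: "nat \<Rightarrow> spoly" where
  "gen_lamdot \<alpha> \<equiv> even_gen \<alpha>"

text \<open>
  In a chart, \<open>d\<close> is the sum of \<open>dx\<^sup>i \<partial>/\<partial>x\<^sup>i\<close> and \<open>d\<lambda>\<^sup>\<alpha> \<partial>/\<partial>\<lambda>\<^sup>\<alpha>\<close>.
\<close>

definition local_d ::
  "('m, 'v, 'z) vbundle_scheme \<Rightarrow> ('m, 'v) bchart \<Rightarrow> ('m \<Rightarrow> spoly) \<Rightarrow> 'm \<Rightarrow> spoly" where
  "local_d A c f p =
    (\<Sum>i<bdim A. smul (gen_xdot A i) (\<lambda>S m. cpd c i (\<lambda>q. f q S m) p)) +
    (\<Sum>\<alpha><brank A. smul (gen_lamdot \<alpha>) (odd_pd \<alpha> (f p)))"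

text \<open>
  A function on \<open>[-1]T([-1]A)\<close> is given by its local expressions in all charts. By convention it
  vanishes outside the domain of the chart. The coordinates of another chart \<open>c'\<close> are substituted by
  \<open>\<lambda>'\<^sup>\<beta> = B\<^sup>\<beta>\<^sub>\<alpha>(x) \<lambda>\<^sup>\<alpha>\<close> and, for the dotted coordinates, by the differentials \<open>d(x'\<^sup>i)\<close> and \<open>d(\<lambda>'\<^sup>\<beta>)\<close>.
  The bound \<open>N\<close> says that functions have bounded form degree, that is, the algebra is the direct sum
  of its homogeneous components.
\<close>

type_synonym ('m, 'v) sfun = "('m, 'v) bchart \<Rightarrow> 'm \<Rightarrow> spoly"

definition lam_image ::
  "('m, 'v::real_vector, 'z) vbundle_scheme \<Rightarrow> ('m, 'v) bchart \<Rightarrow> ('m, 'v) bchart \<Rightarrow> nat \<Rightarrow> 'm \<Rightarrow> spoly"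
  where
  "lam_image A c c' \<beta> p =
    (\<Sum>\<alpha><brank A. smul (sconst (coframe A c' \<beta> p (cfrm c \<alpha> p))) (gen_lam \<alpha>))"

definition change_chart ::
  "('m, 'v::real_vector, 'z) vbundle_scheme \<Rightarrow> ('m, 'v) bchart \<Rightarrow> ('m, 'v) bchart \<Rightarrow> 'm \<Rightarrow> spoly \<Rightarrow> spoly"
  where
  "change_chart A c c' p =
    ssubst
      (\<lambda>k. if k < brank A then lam_image A c c' k p
           else local_d A c (\<lambda>q. sconst (ccrd c' q (k - brank A))) p)
      (\<lambda>\<beta>. local_d A c (lam_image A c c' \<beta>) p)"

definition super_functions ::
  "('m::topological_space, 'v::real_vector, 'z) vbundle_scheme \<Rightarrow> ('m, 'v) sfun set" where
  "super_functions A =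
    {F. (\<forall>c p S m. F c p S m \<noteq> 0 \<longrightarrow>
           c \<in> atlas A \<and> p \<in> cdom c \<and> S \<subseteq> {..<brank A + bdim A} \<and> set_mset m \<subseteq> {..<brank A}) \<and>
        (\<forall>c\<in>atlas A. \<forall>S m.
           smooth_on (bdim A) (ccrd c ` cdom c) ((\<lambda>p. F c p S m) \<circ> cpar c)) \<and>
        (\<exists>N. \<forall>c p S m. F c p S m \<noteq> 0 \<longrightarrow> size m \<le> N) \<and>
        (\<forall>c\<in>atlas A. \<forall>c'\<in>atlas A. \<forall>p\<in>cdom c \<inter> cdom c'.
           F c p = change_chart A c c' p (F c' p))}"

definition on_charts :: "('m, 'v, 'z) vbundle_scheme \<Rightarrow> ('m, 'v) sfun \<Rightarrow> ('m, 'v) sfun" where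
  "on_charts A F = (\<lambda>c p. if c \<in> atlas A \<and> p \<in> cdom c then F c p else 0)"

definition de_rham :: "('m, 'v, 'z) vbundle_scheme \<Rightarrow> ('m, 'v) sfun \<Rightarrow> ('m, 'v) sfun" where
  "de_rham A F = on_charts A (\<lambda>c. local_d A c (F c))"

text \<open>
  A vector field on \<open>[-1]A\<close> is given by its components with respect to \<open>\<partial>/\<partial>x\<^sup>i\<close> and \<open>\<partial>/\<partial>\<lambda>\<^sup>\<alpha>\<close> in all
  charts.
\<close>

record ('m, 'v) vfield =
  x_comp :: "nat \<Rightarrow> ('m, 'v) sfun"
  lam_comp :: "nat \<Rightarrow> ('m, 'v) sfun"

definition contraction ::
  "('m, 'v, 'z) vbundle_scheme \<Rightarrow> ('m, 'v) vfield \<Rightarrow> ('m, 'v) sfun \<Rightarrow> ('m, 'v) sfun" where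
  "contraction A X F = on_charts A (\<lambda>c p.
    (\<Sum>i<bdim A. smul (x_comp X i c p) (odd_pd (brank A + i) (F c p))) +
    (\<Sum>\<alpha><brank A. smul (lam_comp X \<alpha> c p) (even_pd \<alpha> (F c p))))"

text \<open>Graded commutator of operators \<open>D\<close>, \<open>E\<close> of degrees \<open>k\<close>, \<open>l\<close>.\<close>

definition graded_commutator ::
  "int \<Rightarrow> int \<Rightarrow> (('m, 'v) sfun \<Rightarrow> ('m, 'v) sfun) \<Rightarrow> (('m, 'v) sfun \<Rightarrow> ('m, 'v) sfun) \<Rightarrow>
    ('m, 'v) sfun \<Rightarrow> ('m, 'v) sfun" where
  "graded_commutator k l D E F =
    (\<lambda>c p S m. D (E F) c p S m - (-1) powi (k * l) * E (D F) c p S m)"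

text \<open>The Lie derivative along a vector field \<open>X\<close> of degree \<open>q\<close>.\<close>

definition lie_derivative ::
  "('m, 'v, 'z) vbundle_scheme \<Rightarrow> int \<Rightarrow> ('m, 'v) vfield \<Rightarrow> ('m, 'v) sfun \<Rightarrow> ('m, 'v) sfun" where
  "lie_derivative A q X = graded_commutator (q - 1) 1 (contraction A X) (de_rham A)"

definition operator_exp :: "(('m, 'v) sfun \<Rightarrow> ('m, 'v) sfun) \<Rightarrow> ('m, 'v) sfun \<Rightarrow> ('m, 'v) sfun" where
  "operator_exp D F = (\<lambda>c p S m. \<Sum>k. (D ^^ k) F c p S m / fact k)"

text \<open>
  An \<open>A\<close>-form of degree \<open>k\<close> as a function on \<open>[-1]A\<close>: the coefficient of \<open>\<lambda>\<^sub>S\<close> is the value on the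
  frame elements with indices in \<open>S\<close>, in increasing order.
\<close>

definition form_sfun ::
  "('m, 'v, 'z) vbundle_scheme \<Rightarrow> nat \<Rightarrow> ('m, 'v) aform \<Rightarrow> ('m, 'v) sfun" where
  "form_sfun A k \<omega> = on_charts A (\<lambda>c p S m.
    if m = {#} \<and> S \<subseteq> {..<brank A} \<and> card S = k
    then \<omega> (map (cfrm c) (sorted_list_of_set S)) p else 0)"

text \<open>
  The differential \<open>d\<^sub>A\<close> as a vector field on \<open>[-1]A\<close>: like any derivation of the functions on
  \<open>[-1]A\<close>, it has the components \<open>d\<^sub>A(x\<^sup>i)\<close> (a 1-form) and \<open>d\<^sub>A(\<lambda>\<^sup>\<alpha>)\<close> (a 2-form).
\<close>

definition algebroid_vfield :: "('m::topological_space, 'v::real_vector) algebroid \<Rightarrow> ('m, 'v) vfield"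
  where
  "algebroid_vfield A =
    \<lparr> x_comp = (\<lambda>i c. form_sfun A 1 (algebroid_diff A (\<lambda>_ p. ccrd c p i)) c),
      lam_comp = (\<lambda>\<alpha> c. form_sfun A 2 (algebroid_diff A (\<lambda>ss p. coframe A c \<alpha> p (hd ss p))) c) \<rparr>"

text \<open>The generalized Mathai-Quillen-Kalkman isomorphism \<open>\<gamma>\<close>.\<close>

definition mqk ::
  "('m::topological_space, 'v::real_vector) algebroid \<Rightarrow> ('m, 'v) sfun \<Rightarrow> ('m, 'v) sfun" where
  "mqk A = operator_exp (contraction A (algebroid_vfield A))"

end

theory Submission
  imports Defs
begin

text \<open>
  Put \<open>L = [\<iota>, d]\<close> with \<open>\<iota> = \<iota>\<^bsub>d\<^sub>A\<^esub>\<close>. If \<open>[\<iota>, L] = 0\<close>, then \<open>\<iota>\<^sup>k d = d \<iota>\<^sup>k + k L \<iota>\<^bsup>k-1\<^esup>\<close>, and summing over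
  \<open>k\<close> with weights \<open>1/k!\<close> gives \<open>exp \<iota> \<circ> d = (d + L) \<circ> exp \<iota>\<close>; all sums are finite because \<open>\<iota>\<close> lowers the number of
  dotted generators. The operator \<open>[\<iota>, L]\<close> commutes up to sign with multiplication by functions on \<open>M\<close> and
  by all generators, and it kills constants, hence it is zero. Commuting it past a dotted generator
  leaves twice \<open>d\<^sub>A (d\<^sub>A y)\<close> for the coordinate \<open>y\<close>, which vanishes by the anchor-bracket relation and the
  Jacobi identity in a local frame. As the axioms speak of global sections and functions, frames and
  coordinates are first extended by bump functions.
\<close>

text \<open>The statement is the conjugation formula exp(\<iota>) d exp(-\<iota>) = d + [\<iota>, d]
  + (1/2) [\<iota>, [\<iota>, d]] + ..., cut off after the first commutator. Up to sign,
  [\<iota>, L] is the contraction with [d_A, d_A] = 2 d_A^2, so the cut-off is another form of d_A^2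
  = 0. The vector field is given only by its components, as Koszul formulas in a local frame, and
  d_A^2 = 0 has to be rebuilt from the axioms of the algebroid. All operators act chart by chart, so
  both sides can be compared in one chart. There a function is a family of coefficients, and a
  product with a component of the vector field is taken apart into multiplications by single
  generators. The graded signs then sit in a few (anti)commutation relations and not in the double
  sum of \<open>smul\<close>. One obstacle shapes the algebra: partial derivatives obey their rules
  only for smooth coefficients and only on the chart domain. Hence the contraction is linear without
  condition, while d and L are controlled on the space \<open>sfuns\<close>.\<close>

section \<open>Creation and annihilation operators\<close>

text \<open>With these rules the simplifier eta-expands equations between operators on coefficient functions.\<close>

declare plus_fun_apply [simp del] zero_fun_apply [simp del] minus_apply [simp del] uminus_apply [simp del]

lemmas fun_ops = plus_fun_apply zero_fun_apply minus_apply uminus_apply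

lemma sum_fun_app: "(sum f I) x = (\<Sum>i\<in>I. f i x)"
  by (induction I rule: infinite_finite_induct) (auto simp: fun_ops)

text \<open>The sign for moving the generator k from the front of the product to its place in
  increasing order: it passes the elements of S below k. As k itself is not counted, the same sign
  serves for S with or without k.\<close>

definition osgn :: "nat \<Rightarrow> nat set \<Rightarrow> real" where
  "osgn k S = (-1) ^ card {j\<in>S. j < k}"

lemma osgn_square [simp]: "osgn k S * osgn k S = 1" "osgn k S * (osgn k S * x) = x"
  by (simp_all add: osgn_def flip: power_add mult.assoc)

lemma osgn_insert: "k \<notin> S \<Longrightarrow> osgn l (insert k S) = (if k < l then - osgn l S else osgn l S)"
proof -
  assume k: "k \<notin> S"
  have "{j\<in>insert k S. j < l} = (if k < l then insert k {j\<in>S. j < l} else {j\<in>S. j < l})" by auto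
  then show ?thesis using k by (auto simp: osgn_def)
qed

lemma osgn_remove: "k \<in> S \<Longrightarrow> osgn l (S - {k}) = (if k < l then - osgn l S else osgn l S)"
  using osgn_insert[of k "S - {k}" l] by (auto simp: insert_absorb split: if_splits)

definition scale :: "('m \<Rightarrow> real) \<Rightarrow> ('m \<Rightarrow> spoly) \<Rightarrow> 'm \<Rightarrow> spoly" where
  "scale f G = (\<lambda>p S m. f p * G p S m)"

text \<open>A creation operator, given on coefficients and not through \<open>smul\<close>: its
  rules then hold for arbitrary families, and the comparison with \<open>smul\<close> is made once,
  in \<open>smul_odd_gen\<close>.\<close>

definition odd_mul :: "nat \<Rightarrow> ('m \<Rightarrow> spoly) \<Rightarrow> 'm \<Rightarrow> spoly" where
  "odd_mul k G = (\<lambda>p S m. if k \<in> S then osgn k S * G p (S - {k}) m else 0)"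

definition even_mul :: "nat \<Rightarrow> ('m \<Rightarrow> spoly) \<Rightarrow> 'm \<Rightarrow> spoly" where
  "even_mul \<alpha> G = (\<lambda>p S m. if \<alpha> \<in># m then G p S (m - {#\<alpha>#}) else 0)"

definition odd_der :: "nat \<Rightarrow> ('m \<Rightarrow> spoly) \<Rightarrow> 'm \<Rightarrow> spoly" where
  "odd_der k G = (\<lambda>p. odd_pd k (G p))"

definition even_der :: "nat \<Rightarrow> ('m \<Rightarrow> spoly) \<Rightarrow> 'm \<Rightarrow> spoly" where
  "even_der \<alpha> G = (\<lambda>p. even_pd \<alpha> (G p))"

lemma odd_der_eq: "odd_der k G p S m = (if k \<in> S then 0 else osgn k S * G p (insert k S) m)"
  by (simp add: odd_der_def odd_pd_def osgn_def)

lemma even_der_eq: "even_der \<alpha> G p S m = real (count m \<alpha> + 1) * G p S (add_mset \<alpha> m)"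
  by (simp add: even_der_def even_pd_def)

text \<open>Linearity over all functions on the base, smooth or not. The creation and annihilation
  operators have it, and hence the contraction; the de Rham differential does not.\<close>

definition fun_linear :: "(('m \<Rightarrow> spoly) \<Rightarrow> 'm \<Rightarrow> spoly) \<Rightarrow> bool" where
  "fun_linear T \<longleftrightarrow> (\<forall>G H. T (G + H) = T G + T H) \<and> (\<forall>f G. T (scale f G) = scale f (T G))"

lemma fun_linear_add: "fun_linear T \<Longrightarrow> T (G + H) = T G + T H"
  and fun_linear_scale: "fun_linear T \<Longrightarrow> T (scale f G) = scale f (T G)"
  by (simp_all add: fun_linear_def)

lemma scale_add: "scale f (G + H) = scale f G + scale f H"
  by (simp add: scale_def fun_eq_iff fun_ops algebra_simps)

lemma scale_scale: "scale f (scale g G) = scale (\<lambda>p. f p * g p) G"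
  by (simp add: scale_def fun_eq_iff fun_ops)

lemma scale_add_left: "scale (\<lambda>p. f p + g p) G = scale f G + scale g G"
  by (simp add: scale_def fun_eq_iff fun_ops algebra_simps)

lemma scale_zero: "scale (\<lambda>_. 0) G = 0"
  by (simp add: scale_def fun_eq_iff fun_ops)

lemma scale_zero_right [simp]: "scale f 0 = 0"
  by (simp add: scale_def fun_eq_iff fun_ops)

lemma scale_one: "scale (\<lambda>_. 1) G = G"
  by (simp add: scale_def fun_eq_iff fun_ops)

lemma scale_minus: "scale (\<lambda>_. - 1) G = - G"
  by (simp add: scale_def fun_eq_iff fun_ops)

lemma scale_minus_right: "scale f (- G) = - scale f G"
  by (simp add: scale_def fun_eq_iff fun_ops)

lemma scale_minus_left: "scale (\<lambda>p. - f p) G = - scale f G"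
  by (simp add: scale_def fun_eq_iff fun_ops)

lemma scale_sum: "scale f (sum G I) = (\<Sum>i\<in>I. scale f (G i))"
  by (induction I rule: infinite_finite_induct) (simp_all add: scale_add)

lemma scale_sum_left: "scale (\<lambda>p. \<Sum>i\<in>I. f i p) G = (\<Sum>i\<in>I. scale (f i) G)"
  by (induction I rule: infinite_finite_induct) (simp_all add: scale_add_left scale_zero)

lemma fun_linear_zero: "fun_linear T \<Longrightarrow> T 0 = 0"
  using fun_linear_scale[of T "\<lambda>_. 0" 0] by (simp add: scale_zero)

lemma fun_linear_minus: "fun_linear T \<Longrightarrow> T (- G) = - T G"
  using fun_linear_scale[of T "\<lambda>_. - 1" G] by (simp add: scale_minus)

lemma fun_linear_diff: "fun_linear T \<Longrightarrow> T (G - H) = T G - T H"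
  using fun_linear_add[of T G "- H"] by (simp add: fun_linear_minus)

lemma fun_linear_sum: "fun_linear T \<Longrightarrow> T (sum G I) = (\<Sum>i\<in>I. T (G i))"
  by (induction I rule: infinite_finite_induct) (simp_all add: fun_linear_add fun_linear_zero)

lemma fun_linear_compose: "fun_linear T \<Longrightarrow> fun_linear T' \<Longrightarrow> fun_linear (\<lambda>G. T (T' G))"
  by (simp add: fun_linear_def)

lemma fun_linear_plus: "fun_linear T \<Longrightarrow> fun_linear T' \<Longrightarrow> fun_linear (\<lambda>G. T G + T' G)"
  by (simp add: fun_linear_def scale_add)

lemma fun_linear_sum_ops: "(\<And>i. i \<in> I \<Longrightarrow> fun_linear (T i)) \<Longrightarrow> fun_linear (\<lambda>G. \<Sum>i\<in>I. T i G)"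
  by (simp add: fun_linear_def scale_sum sum.distrib)

lemma fun_linear_scale_op: "fun_linear (scale f)"
  by (simp add: fun_linear_def scale_add scale_scale mult.commute)

lemma fun_linear_odd_mul: "fun_linear (odd_mul k)"
  by (simp add: fun_linear_def odd_mul_def fun_eq_iff fun_ops scale_def algebra_simps)

lemma fun_linear_even_mul: "fun_linear (even_mul k)"
  by (simp add: fun_linear_def even_mul_def fun_eq_iff fun_ops scale_def algebra_simps)

lemma fun_linear_odd_der: "fun_linear (odd_der k)"
  by (simp add: fun_linear_def odd_der_eq fun_eq_iff fun_ops scale_def algebra_simps)

lemma fun_linear_even_der: "fun_linear (even_der k)"
  by (simp add: fun_linear_def even_der_eq fun_eq_iff fun_ops scale_def algebra_simps)

lemmas gens_linear = fun_linear_odd_mul fun_linear_even_mul fun_linear_odd_der fun_linear_even_der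

text \<open>For k = l this says that the square of an odd generator is zero: the second factor looks
  for an index that the first has removed. For distinct indices, removing the smaller one flips the
  sign of the larger one, but not conversely.\<close>

lemma odd_mul_anticommute: "odd_mul k (odd_mul l G) = - odd_mul l (odd_mul k G)"
proof (intro ext)
  fix p S m
  have "S - {k} - {l} = S - {l} - {k}" by auto
  then show "odd_mul k (odd_mul l G) p S m = (- odd_mul l (odd_mul k G)) p S m"
    by (auto simp: fun_ops odd_mul_def osgn_remove)
qed

lemma odd_der_odd_mul: "k \<noteq> l \<Longrightarrow> odd_der k (odd_mul l G) = - odd_mul l (odd_der k G)"
proof (intro ext)
  fix p S m assume "k \<noteq> l"
  moreover from this have "insert k S - {l} = insert k (S - {l})" by auto
  ultimately show "odd_der k (odd_mul l G) p S m = (- odd_mul l (odd_der k G)) p S m"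
    by (auto simp: fun_ops odd_mul_def odd_der_eq osgn_remove osgn_insert)
qed

text \<open>Together with the neighbouring lemmas these are the canonical relations of a Clifford
  and a Weyl algebra, on which the operator calculus in a chart rests.\<close>

lemma odd_der_odd_mul_same: "odd_der k (odd_mul k G) = G - odd_mul k (odd_der k G)"
proof (intro ext)
  fix p S m
  show "odd_der k (odd_mul k G) p S m = (G - odd_mul k (odd_der k G)) p S m"
    by (auto simp: fun_ops odd_mul_def odd_der_eq osgn_remove osgn_insert insert_absorb)
qed

lemma even_der_even_mul:
  "even_der k (even_mul l G) = even_mul l (even_der k G) + (if k = l then G else 0)"
proof (intro ext)
  fix p S m
  have *: "\<not> k \<in># m \<Longrightarrow> count m k = 0" by (simp add: not_in_iff)
  show "even_der k (even_mul l G) p S m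
    = (even_mul l (even_der k G) + (if k = l then G else 0)) p S m"
  proof (cases "k = l")
    case True
    show ?thesis
    proof (cases "k \<in># m")
      case mem: True
      then obtain m' where "m = add_mset k m'" by (metis insert_DiffM)
      then show ?thesis using True by (simp add: fun_ops even_mul_def even_der_eq algebra_simps)
    next
      case False
      then show ?thesis using True * by (simp add: fun_ops even_mul_def even_der_eq)
    qed
  next
    case False
    then show ?thesis
      by (auto simp: fun_ops even_mul_def even_der_eq add_mset_diff_bothsides diff_union_swap[of k l] in_diff_count)
  qed
qed

lemma even_mul_odd_mul: "even_mul k (odd_mul l G) = odd_mul l (even_mul k G)"
  and even_mul_odd_der: "even_mul k (odd_der l G) = odd_der l (even_mul k G)"
  and even_der_odd_mul: "even_der k (odd_mul l G) = odd_mul l (even_der k G)"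
  by (simp_all add: fun_eq_iff fun_ops even_mul_def odd_mul_def odd_der_eq even_der_eq)

lemma even_mul_commute: "even_mul k (even_mul l G) = even_mul l (even_mul k G)"
proof (cases "k = l")
  case False
  then have "l \<in># m - {#k#} \<longleftrightarrow> l \<in># m" "k \<in># m - {#l#} \<longleftrightarrow> k \<in># m" for m
    by (simp_all add: in_diff_count flip: count_greater_zero_iff)
  then show ?thesis
    by (simp add: fun_eq_iff fun_ops even_mul_def diff_right_commute add_mset_commute)
qed simp

section \<open>Cartan calculus of a Lie algebroid in a chart\<close>

text \<open>
  An algebraic model of one chart \<open>U\<close>: \<open>anchor_fun i \<alpha>\<close> and \<open>struct_fun \<gamma> \<alpha> \<beta>\<close> are the anchor and bracket
  coefficients of the frame. The last two axioms say that the vector field \<open>d\<^sub>A\<close> squares to zero.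
\<close>

locale lie_structure =
  fixes n r :: nat
    and U :: "'m set"
    and smooth :: "('m \<Rightarrow> real) \<Rightarrow> bool"
    and D :: "nat \<Rightarrow> ('m \<Rightarrow> real) \<Rightarrow> 'm \<Rightarrow> real"
    and anchor_fun :: "nat \<Rightarrow> nat \<Rightarrow> 'm \<Rightarrow> real"
    and struct_fun :: "nat \<Rightarrow> nat \<Rightarrow> nat \<Rightarrow> 'm \<Rightarrow> real"
  assumes smooth_const: "smooth (\<lambda>_. a)"
    and smooth_add: "smooth f \<Longrightarrow> smooth g \<Longrightarrow> smooth (\<lambda>p. f p + g p)"
    and smooth_mult: "smooth f \<Longrightarrow> smooth g \<Longrightarrow> smooth (\<lambda>p. f p * g p)"
    and smooth_D: "i < n \<Longrightarrow> smooth f \<Longrightarrow> smooth (D i f)"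
    and smooth_cong: "(\<And>p. p \<in> U \<Longrightarrow> f p = g p) \<Longrightarrow> smooth f \<Longrightarrow> smooth g"
    and D_const: "i < n \<Longrightarrow> p \<in> U \<Longrightarrow> D i (\<lambda>_. a) p = 0"
    and D_add: "i < n \<Longrightarrow> smooth f \<Longrightarrow> smooth g \<Longrightarrow> p \<in> U \<Longrightarrow> D i (\<lambda>q. f q + g q) p = D i f p + D i g p"
    and D_mult: "i < n \<Longrightarrow> smooth f \<Longrightarrow> smooth g \<Longrightarrow> p \<in> U \<Longrightarrow>
      D i (\<lambda>q. f q * g q) p = D i f p * g p + f p * D i g p"
    and D_cong: "i < n \<Longrightarrow> (\<And>q. q \<in> U \<Longrightarrow> f q = g q) \<Longrightarrow> p \<in> U \<Longrightarrow> D i f p = D i g p"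
    and smooth_anchor_fun: "i < n \<Longrightarrow> \<alpha> < r \<Longrightarrow> smooth (anchor_fun i \<alpha>)"
    and smooth_struct_fun: "\<gamma> < r \<Longrightarrow> \<alpha> < r \<Longrightarrow> \<beta> < r \<Longrightarrow> smooth (struct_fun \<gamma> \<alpha> \<beta>)"
    and struct_fun_skew: "\<gamma> < r \<Longrightarrow> \<alpha> < r \<Longrightarrow> \<beta> < r \<Longrightarrow> p \<in> U \<Longrightarrow> struct_fun \<gamma> \<alpha> \<beta> p = - struct_fun \<gamma> \<beta> \<alpha> p"
    and anchor_eq: "i < n \<Longrightarrow> \<alpha> < r \<Longrightarrow> \<beta> < r \<Longrightarrow> p \<in> U \<Longrightarrow>
      (\<Sum>j<n. anchor_fun j \<alpha> p * D j (anchor_fun i \<beta>) p) - (\<Sum>j<n. anchor_fun j \<beta> p * D j (anchor_fun i \<alpha>) p)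
        = (\<Sum>\<gamma><r. struct_fun \<gamma> \<alpha> \<beta> p * anchor_fun i \<gamma> p)"
    and jacobi: "\<gamma> < r \<Longrightarrow> \<alpha> < r \<Longrightarrow> \<beta> < r \<Longrightarrow> \<delta> < r \<Longrightarrow> p \<in> U \<Longrightarrow>
      ((\<Sum>j<n. anchor_fun j \<alpha> p * D j (struct_fun \<gamma> \<beta> \<delta>) p) + (\<Sum>\<epsilon><r. struct_fun \<gamma> \<alpha> \<epsilon> p * struct_fun \<epsilon> \<beta> \<delta> p)) +
      ((\<Sum>j<n. anchor_fun j \<beta> p * D j (struct_fun \<gamma> \<delta> \<alpha>) p) + (\<Sum>\<epsilon><r. struct_fun \<gamma> \<beta> \<epsilon> p * struct_fun \<epsilon> \<delta> \<alpha> p)) +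
      ((\<Sum>j<n. anchor_fun j \<delta> p * D j (struct_fun \<gamma> \<alpha> \<beta>) p) + (\<Sum>\<epsilon><r. struct_fun \<gamma> \<delta> \<epsilon> p * struct_fun \<epsilon> \<alpha> \<beta> p)) = 0"
begin

text \<open>Since members vanish off \<open>U\<close>, two of them are equal as soon as they agree
  on \<open>U\<close>, where the axioms about \<open>D\<close> apply. The bound N does not depend on
  the point; it provides finite expansions into monomials and the nilpotence of the
  contraction.\<close>

definition sfuns :: "('m \<Rightarrow> spoly) set" where
  "sfuns = {G. (\<forall>p. p \<notin> U \<longrightarrow> G p = 0) \<and> (\<forall>S m. smooth (\<lambda>p. G p S m)) \<and>
    (\<exists>N. \<forall>p S m. G p S m \<noteq> 0 \<longrightarrow> S \<subseteq> {..<r + n} \<and> set_mset m \<subseteq> {..<r} \<and> size m \<le> N)}"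

lemma sfunsI:
  assumes "\<And>p S m. p \<notin> U \<Longrightarrow> G p S m = 0" "\<And>S m. smooth (\<lambda>p. G p S m)"
    and "\<And>p S m. G p S m \<noteq> 0 \<Longrightarrow> S \<subseteq> {..<r + n} \<and> set_mset m \<subseteq> {..<r} \<and> size m \<le> N"
  shows "G \<in> sfuns"
  using assms unfolding sfuns_def by (auto simp: fun_eq_iff fun_ops intro!: exI[of _ N])

lemma sfuns_outside: "G \<in> sfuns \<Longrightarrow> p \<notin> U \<Longrightarrow> G p S m = 0"
  by (simp add: sfuns_def fun_ops)

lemma sfuns_smooth: "G \<in> sfuns \<Longrightarrow> smooth (\<lambda>p. G p S m)"
  by (simp add: sfuns_def)

lemma sfuns_bounded:
  assumes "G \<in> sfuns"
  obtains N where "\<And>p S m. G p S m \<noteq> 0 \<Longrightarrow> S \<subseteq> {..<r + n} \<and> set_mset m \<subseteq> {..<r} \<and> size m \<le> N"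
  using assms unfolding sfuns_def by blast

lemma smooth_cmult: "smooth f \<Longrightarrow> smooth (\<lambda>p. a * f p)"
  using smooth_mult[OF smooth_const[of a]] .

lemma D_cmult: "i < n \<Longrightarrow> smooth f \<Longrightarrow> p \<in> U \<Longrightarrow> D i (\<lambda>q. a * f q) p = a * D i f p"
  using D_mult[OF _ smooth_const[of a], of i f p] by (simp add: D_const)

lemma smooth_if: "(c \<Longrightarrow> smooth f) \<Longrightarrow> (\<not> c \<Longrightarrow> smooth g) \<Longrightarrow> smooth (\<lambda>p. if c then f p else g p)"
  by (cases c) simp_all

lemma sfuns_zero: "0 \<in> sfuns"
  by (rule sfunsI[where N = 0]) (simp_all add: fun_ops smooth_const)

lemma sfuns_add: assumes "G \<in> sfuns" "H \<in> sfuns" shows "G + H \<in> sfuns"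
proof -
  obtain N1 where N1: "\<And>p S m. G p S m \<noteq> 0 \<Longrightarrow> S \<subseteq> {..<r + n} \<and> set_mset m \<subseteq> {..<r} \<and> size m \<le> N1"
    using sfuns_bounded[OF assms(1)] by blast
  obtain N2 where N2: "\<And>p S m. H p S m \<noteq> 0 \<Longrightarrow> S \<subseteq> {..<r + n} \<and> set_mset m \<subseteq> {..<r} \<and> size m \<le> N2"
    using sfuns_bounded[OF assms(2)] by blast
  show ?thesis
  proof (rule sfunsI[where N = "max N1 N2"])
    fix p S m assume "(G + H) p S m \<noteq> 0"
    then have "G p S m \<noteq> 0 \<or> H p S m \<noteq> 0" by (auto simp: fun_ops)
    then show "S \<subseteq> {..<r + n} \<and> set_mset m \<subseteq> {..<r} \<and> size m \<le> max N1 N2"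
      using N1[of p S m] N2[of p S m] by auto
  qed (use assms in \<open>simp_all add: fun_ops sfuns_outside smooth_add sfuns_smooth\<close>)
qed

lemma sfuns_scale: assumes "G \<in> sfuns" "smooth f" shows "scale f G \<in> sfuns"
proof -
  obtain N where N: "\<And>p S m. G p S m \<noteq> 0 \<Longrightarrow> S \<subseteq> {..<r + n} \<and> set_mset m \<subseteq> {..<r} \<and> size m \<le> N"
    using sfuns_bounded[OF assms(1)] by blast
  show ?thesis
    by (rule sfunsI[where N = N])
       (use assms in \<open>auto simp: scale_def sfuns_outside smooth_mult sfuns_smooth dest!: N\<close>)
qed

lemma sfuns_minus: "G \<in> sfuns \<Longrightarrow> - G \<in> sfuns"
  using sfuns_scale[OF _ smooth_const[of "- 1"], of G] by (simp add: scale_minus)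

lemma sfuns_diff: "G \<in> sfuns \<Longrightarrow> H \<in> sfuns \<Longrightarrow> G - H \<in> sfuns"
  using sfuns_add[OF _ sfuns_minus] by fastforce

lemma sfuns_sum: "(\<And>i. i \<in> I \<Longrightarrow> G i \<in> sfuns) \<Longrightarrow> sum G I \<in> sfuns"
  by (induction I rule: infinite_finite_induct) (simp_all add: sfuns_zero sfuns_add)

lemma sfuns_odd_mul: assumes "G \<in> sfuns" "k < r + n" shows "odd_mul k G \<in> sfuns"
proof -
  obtain N where N: "\<And>p S m. G p S m \<noteq> 0 \<Longrightarrow> S \<subseteq> {..<r + n} \<and> set_mset m \<subseteq> {..<r} \<and> size m \<le> N"
    using sfuns_bounded[OF assms(1)] by blast
  show ?thesis
  proof (rule sfunsI[where N = N])
    fix p S m assume "odd_mul k G p S m \<noteq> 0"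
    then have "G p (S - {k}) m \<noteq> 0" by (auto simp: odd_mul_def split: if_splits)
    from N[OF this] assms(2) show "S \<subseteq> {..<r + n} \<and> set_mset m \<subseteq> {..<r} \<and> size m \<le> N" by auto
  qed (use assms in \<open>auto simp: odd_mul_def sfuns_outside sfuns_smooth intro!: smooth_if smooth_cmult smooth_const\<close>)
qed

lemma sfuns_even_mul: assumes "G \<in> sfuns" "k < r" shows "even_mul k G \<in> sfuns"
proof -
  obtain N where N: "\<And>p S m. G p S m \<noteq> 0 \<Longrightarrow> S \<subseteq> {..<r + n} \<and> set_mset m \<subseteq> {..<r} \<and> size m \<le> N"
    using sfuns_bounded[OF assms(1)] by blast
  show ?thesis
  proof (rule sfunsI[where N = "Suc N"])
    fix p S m assume nz: "even_mul k G p S m \<noteq> 0"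
    then have "k \<in># m" by (auto simp: even_mul_def split: if_splits)
    then obtain m' where "m = add_mset k m'" by (metis insert_DiffM)
    moreover from this nz have "G p S m' \<noteq> 0" by (auto simp: even_mul_def)
    ultimately show "S \<subseteq> {..<r + n} \<and> set_mset m \<subseteq> {..<r} \<and> size m \<le> Suc N"
      using N[of p S m'] assms(2) by auto
  qed (use assms in \<open>auto simp: even_mul_def sfuns_outside sfuns_smooth intro!: smooth_if smooth_const\<close>)
qed

lemma sfuns_odd_der: assumes "G \<in> sfuns" shows "odd_der k G \<in> sfuns"
proof -
  obtain N where N: "\<And>p S m. G p S m \<noteq> 0 \<Longrightarrow> S \<subseteq> {..<r + n} \<and> set_mset m \<subseteq> {..<r} \<and> size m \<le> N"
    using sfuns_bounded[OF assms(1)] by blast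
  show ?thesis
  proof (rule sfunsI[where N = N])
    fix p S m assume "odd_der k G p S m \<noteq> 0"
    then have "G p (insert k S) m \<noteq> 0" by (auto simp: odd_der_eq split: if_splits)
    from N[OF this] show "S \<subseteq> {..<r + n} \<and> set_mset m \<subseteq> {..<r} \<and> size m \<le> N" by auto
  qed (use assms in \<open>auto simp: odd_der_eq sfuns_outside sfuns_smooth intro!: smooth_if smooth_cmult smooth_const\<close>)
qed

lemma sfuns_even_der: assumes "G \<in> sfuns" shows "even_der k G \<in> sfuns"
proof -
  obtain N where N: "\<And>p S m. G p S m \<noteq> 0 \<Longrightarrow> S \<subseteq> {..<r + n} \<and> set_mset m \<subseteq> {..<r} \<and> size m \<le> N"
    using sfuns_bounded[OF assms(1)] by blast
  show ?thesis
  proof (rule sfunsI[where N = N])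
    fix p S m assume "even_der k G p S m \<noteq> 0"
    then have "G p S (add_mset k m) \<noteq> 0" by (auto simp: even_der_eq)
    from N[OF this] show "S \<subseteq> {..<r + n} \<and> set_mset m \<subseteq> {..<r} \<and> size m \<le> N" by auto
  qed (use assms in \<open>auto simp: even_der_eq sfuns_outside smooth_cmult sfuns_smooth simp del: of_nat_Suc\<close>)
qed

text \<open>\<open>D\<close> is unconstrained off \<open>U\<close>; the value zero there keeps the
  result in \<open>sfuns\<close>.\<close>

definition coeff_D :: "nat \<Rightarrow> ('m \<Rightarrow> spoly) \<Rightarrow> 'm \<Rightarrow> spoly" where
  "coeff_D i G = (\<lambda>p S m. if p \<in> U then D i (\<lambda>q. G q S m) p else 0)"

lemma smooth_restrict: "smooth f \<Longrightarrow> smooth (\<lambda>p. if p \<in> U then f p else 0)"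
  by (rule smooth_cong[of f]) auto

lemma D_zero: "i < n \<Longrightarrow> (\<And>q. q \<in> U \<Longrightarrow> f q = 0) \<Longrightarrow> p \<in> U \<Longrightarrow> D i f p = 0"
  using D_cong[of i f "\<lambda>_. 0" p] by (simp add: D_const)

lemma sfuns_coeff_D: assumes "G \<in> sfuns" "i < n" shows "coeff_D i G \<in> sfuns"
proof -
  obtain N where N: "\<And>p S m. G p S m \<noteq> 0 \<Longrightarrow> S \<subseteq> {..<r + n} \<and> set_mset m \<subseteq> {..<r} \<and> size m \<le> N"
    using sfuns_bounded[OF assms(1)] by blast
  show ?thesis
  proof (rule sfunsI[where N = N])
    fix p S m assume nz: "coeff_D i G p S m \<noteq> 0"
    then have "p \<in> U" by (auto simp: coeff_D_def split: if_splits)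
    \<comment> \<open>The support bound passes to derivatives: a coefficient that vanishes
      everywhere has derivative zero, so a nonzero derivative forces a nonzero value
      somewhere.\<close>
    then have "\<exists>q. G q S m \<noteq> 0"
      using nz D_zero[OF assms(2), of "\<lambda>q. G q S m" p] by (auto simp: coeff_D_def)
    then show "S \<subseteq> {..<r + n} \<and> set_mset m \<subseteq> {..<r} \<and> size m \<le> N" using N by blast
  qed (use assms in \<open>simp_all add: coeff_D_def smooth_restrict smooth_D sfuns_smooth\<close>)
qed

lemma coeff_D_add: "i < n \<Longrightarrow> G \<in> sfuns \<Longrightarrow> H \<in> sfuns \<Longrightarrow> coeff_D i (G + H) = coeff_D i G + coeff_D i H"
  by (auto simp: coeff_D_def fun_eq_iff fun_ops sfuns_smooth D_add)

lemma coeff_D_scale: "i < n \<Longrightarrow> G \<in> sfuns \<Longrightarrow> smooth f \<Longrightarrow>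
    coeff_D i (scale f G) = scale (D i f) G + scale f (coeff_D i G)"
  by (auto simp: coeff_D_def scale_def fun_eq_iff fun_ops sfuns_smooth D_mult sfuns_outside)

lemma coeff_D_odd_mul: "i < n \<Longrightarrow> G \<in> sfuns \<Longrightarrow> coeff_D i (odd_mul k G) = odd_mul k (coeff_D i G)"
  by (auto simp: coeff_D_def odd_mul_def fun_eq_iff sfuns_smooth D_cmult D_const)

lemma coeff_D_even_mul: "i < n \<Longrightarrow> G \<in> sfuns \<Longrightarrow> coeff_D i (even_mul k G) = even_mul k (coeff_D i G)"
  by (auto simp: coeff_D_def even_mul_def fun_eq_iff D_const)

section \<open>The de Rham differential and the contraction with d_A in coordinates\<close>

definition dform :: "('m \<Rightarrow> spoly) \<Rightarrow> 'm \<Rightarrow> spoly" where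
  "dform G = (\<Sum>i<n. odd_mul (r + i) (coeff_D i G)) + (\<Sum>\<alpha><r. even_mul \<alpha> (odd_der \<alpha> G))"

text \<open>
  \<open>q_base i\<close> and \<open>q_fibre \<gamma>\<close> are the multiplications by the components \<open>d\<^sub>A x\<^sup>i\<close> and \<open>d\<^sub>A \<lambda>\<^sup>\<gamma>\<close>.
\<close>

definition q_base :: "nat \<Rightarrow> ('m \<Rightarrow> spoly) \<Rightarrow> 'm \<Rightarrow> spoly" where
  "q_base i G = (\<Sum>\<alpha><r. scale (anchor_fun i \<alpha>) (odd_mul \<alpha> G))"

definition q_fibre :: "nat \<Rightarrow> ('m \<Rightarrow> spoly) \<Rightarrow> 'm \<Rightarrow> spoly" where
  "q_fibre \<gamma> G = (\<Sum>\<alpha><r. \<Sum>\<beta><r. scale (\<lambda>p. - (1 / 2) * struct_fun \<gamma> \<alpha> \<beta> p) (odd_mul \<alpha> (odd_mul \<beta> G)))"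

text \<open>The components d_A x^i and d_A \<lambda>^\<gamma> have degrees 1 and 2, the derivatives
  that they multiply have degrees -1 and -2. The sum has degree 0 and therefore obeys a Leibniz rule
  without signs.\<close>

definition iota :: "('m \<Rightarrow> spoly) \<Rightarrow> 'm \<Rightarrow> spoly" where
  "iota G = (\<Sum>i<n. q_base i (odd_der (r + i) G)) + (\<Sum>\<gamma><r. q_fibre \<gamma> (even_der \<gamma> G))"

lemma linear_q_base: "fun_linear (q_base i)"
  unfolding q_base_def by (intro fun_linear_sum_ops fun_linear_compose[OF fun_linear_scale_op] gens_linear)

lemma linear_q_fibre: "fun_linear (q_fibre i)"
  unfolding q_fibre_def
  by (intro fun_linear_sum_ops fun_linear_compose[OF fun_linear_scale_op] gens_linear
      fun_linear_compose[OF fun_linear_odd_mul])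

lemma linear_iota: "fun_linear iota"
  unfolding iota_def
  by (intro fun_linear_plus fun_linear_sum_ops fun_linear_compose[OF linear_q_base]
      fun_linear_compose[OF linear_q_fibre] gens_linear)

lemma sfuns_q_base: "G \<in> sfuns \<Longrightarrow> i < n \<Longrightarrow> q_base i G \<in> sfuns"
  unfolding q_base_def by (intro sfuns_sum sfuns_scale sfuns_odd_mul smooth_anchor_fun) auto

lemma sfuns_q_fibre: "G \<in> sfuns \<Longrightarrow> i < r \<Longrightarrow> q_fibre i G \<in> sfuns"
  unfolding q_fibre_def by (intro sfuns_sum sfuns_scale sfuns_odd_mul smooth_cmult smooth_struct_fun) auto

lemma sfuns_iota: "G \<in> sfuns \<Longrightarrow> iota G \<in> sfuns"
  unfolding iota_def by (intro sfuns_add sfuns_sum sfuns_q_base sfuns_q_fibre sfuns_odd_der sfuns_even_der) auto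

lemma sfuns_dform: "G \<in> sfuns \<Longrightarrow> dform G \<in> sfuns"
  unfolding dform_def
  by (intro sfuns_add sfuns_sum sfuns_odd_mul sfuns_even_mul sfuns_coeff_D sfuns_odd_der) auto

lemmas linear_ops = gens_linear linear_q_base linear_q_fibre linear_iota fun_linear_scale_op
lemmas push_add = linear_ops[THEN fun_linear_add]
lemmas push_minus = linear_ops[THEN fun_linear_minus]
lemmas push_diff = linear_ops[THEN fun_linear_diff]
lemmas push_sum = linear_ops[THEN fun_linear_sum]
lemmas push_zero = linear_ops[THEN fun_linear_zero]
lemmas push_scale = linear_ops[THEN fun_linear_scale]
lemmas sfuns_closed = sfuns_q_base sfuns_q_fibre sfuns_iota sfuns_dform sfuns_odd_mul sfuns_even_mul sfuns_odd_der
  sfuns_even_der sfuns_add sfuns_diff sfuns_minus sfuns_scale sfuns_coeff_D sfuns_zero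

lemma q_base_odd_mul: "q_base i (odd_mul k G) = - odd_mul k (q_base i G)"
  unfolding q_base_def
  by (simp add: fun_linear_sum fun_linear_odd_mul fun_linear_scale odd_mul_anticommute[of _ k]
      scale_minus_right sum_negf)

lemma odd_mul_swap2: "odd_mul a (odd_mul b (odd_mul k G)) = odd_mul k (odd_mul a (odd_mul b G))"
  by (simp add: odd_mul_anticommute[of _ k] fun_linear_minus[OF fun_linear_odd_mul])

lemma q_fibre_odd_mul: "q_fibre i (odd_mul k G) = odd_mul k (q_fibre i G)"
  unfolding q_fibre_def
  by (simp add: fun_linear_sum fun_linear_odd_mul fun_linear_scale odd_mul_swap2)

lemma q_base_even_mul: "q_base i (even_mul k G) = even_mul k (q_base i G)"
  unfolding q_base_def
  by (simp add: fun_linear_sum fun_linear_even_mul fun_linear_scale even_mul_odd_mul)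

lemma q_fibre_even_mul: "q_fibre i (even_mul k G) = even_mul k (q_fibre i G)"
  unfolding q_fibre_def
  by (simp add: fun_linear_sum fun_linear_even_mul fun_linear_scale even_mul_odd_mul)

text \<open>The value on a generator is the correction term of the Leibniz rule: zero for \<lambda>,
  and in the next two lemmas d_A x^i for the differential of x^i and d_A \<lambda> for the
  differential of \<lambda>.\<close>

lemma iota_odd_mul: "k < r \<Longrightarrow> iota (odd_mul k G) = odd_mul k (iota G)"
  unfolding iota_def
  by (simp add: push_add push_sum push_minus odd_der_odd_mul q_base_odd_mul q_fibre_odd_mul even_der_odd_mul)

lemma iota_xdot:
  assumes "i < n" shows "iota (odd_mul (r + i) G) = odd_mul (r + i) (iota G) + q_base i G"
proof -
  have "q_base j (odd_der (r + j) (odd_mul (r + i) G))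
    = odd_mul (r + i) (q_base j (odd_der (r + j) G)) + (if j = i then q_base i G else 0)" for j
    by (cases "j = i")
       (simp_all add: odd_der_odd_mul odd_der_odd_mul_same q_base_odd_mul push_minus push_diff)
  moreover have "(\<Sum>j<n. if j = i then q_base i G else 0) = q_base i G" using assms by simp
  ultimately show ?thesis
    unfolding iota_def by (simp add: push_add push_sum q_fibre_odd_mul even_der_odd_mul sum.distrib)
qed

lemma iota_even_mul:
  assumes "k < r" shows "iota (even_mul k G) = even_mul k (iota G) + q_fibre k G"
proof -
  have "q_fibre j (even_der j (even_mul k G))
    = even_mul k (q_fibre j (even_der j G)) + (if j = k then q_fibre k G else 0)" for j
    by (simp add: even_der_even_mul push_add push_zero q_fibre_even_mul)
  moreover have "(\<Sum>j<r. if j = k then q_fibre k G else 0) = q_fibre k G" using assms by simp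
  ultimately show ?thesis
    unfolding iota_def
    by (simp add: push_add push_sum q_base_even_mul flip: even_mul_odd_der)
       (simp add: sum.distrib)
qed

lemma iota_q_base: "iota (q_base i G) = q_base i (iota G)"
  unfolding q_base_def by (simp add: push_sum push_scale iota_odd_mul)

lemma iota_q_fibre: "iota (q_fibre i G) = q_fibre i (iota G)"
  unfolding q_fibre_def by (simp add: push_sum push_scale iota_odd_mul)

text \<open>Here membership in \<open>sfuns\<close> enters: \<open>D\<close> satisfies the sum and
  product rules for smooth functions only. The next lemma shows the term df that prevents linearity
  over functions.\<close>

lemma dform_add: "G \<in> sfuns \<Longrightarrow> H \<in> sfuns \<Longrightarrow> dform (G + H) = dform G + dform H"
  unfolding dform_def by (simp add: coeff_D_add push_add sum.distrib)

lemma dform_scale: "G \<in> sfuns \<Longrightarrow> smooth f \<Longrightarrow>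
    dform (scale f G) = (\<Sum>j<n. scale (D j f) (odd_mul (r + j) G)) + scale f (dform G)"
  unfolding dform_def by (simp add: coeff_D_scale push_add push_sum push_scale sum.distrib)

lemma dform_odd_mul:
  assumes "G \<in> sfuns" "k < r" shows "dform (odd_mul k G) = even_mul k G - odd_mul k (dform G)"
proof -
  have "even_mul j (odd_der j (odd_mul k G))
    = (if j = k then even_mul k G else 0) - odd_mul k (even_mul j (odd_der j G))" for j
    by (cases "j = k")
       (simp_all add: odd_der_odd_mul odd_der_odd_mul_same push_minus push_diff even_mul_odd_mul)
  moreover have "(\<Sum>j<r. if j = k then even_mul k G else 0) = even_mul k G" using assms by simp
  ultimately show ?thesis
    unfolding dform_def using assms
    by (simp add: push_add push_sum coeff_D_odd_mul odd_mul_anticommute[of _ k] sum_negf sum_subtractf)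
qed

lemma dform_xdot:
  assumes "G \<in> sfuns" shows "dform (odd_mul (r + i) G) = - odd_mul (r + i) (dform G)"
  unfolding dform_def using assms
  by (simp add: push_add push_sum coeff_D_odd_mul odd_mul_anticommute[of _ "r + i"] sum_negf
      odd_der_odd_mul push_minus even_mul_odd_mul)

lemma dform_even_mul:
  assumes "G \<in> sfuns" shows "dform (even_mul k G) = even_mul k (dform G)"
  unfolding dform_def using assms
  by (simp add: push_add push_sum coeff_D_even_mul even_mul_odd_mul even_mul_commute[of _ k]
      flip: even_mul_odd_der)

lemma dform_zero: "dform 0 = 0"
  using dform_add[OF sfuns_zero sfuns_zero] by simp

lemma dform_sum: "(\<And>i. i \<in> I \<Longrightarrow> G i \<in> sfuns) \<Longrightarrow> dform (sum G I) = (\<Sum>i\<in>I. dform (G i))"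
  by (induction I rule: infinite_finite_induct) (simp_all add: dform_zero dform_add sfuns_sum)

end

text \<open>The index sets are kept distinct so that \<open>sum.swap\<close> works as an oriented
  rewrite rule; in the applications several of them coincide, and such a rule could not tell the
  sums apart.\<close>

lemma sum_rotate4: "(\<Sum>b\<in>B. \<Sum>d\<in>C. \<Sum>j\<in>J. \<Sum>a\<in>A. f a b d j) = (\<Sum>a\<in>A. \<Sum>b\<in>B. \<Sum>d\<in>C. \<Sum>j\<in>J. f a b d j)"
  by (simp only: sum.swap[where A = J and B = A] sum.swap[where A = C and B = A] sum.swap[where A = B and B = A])

lemma sum_reorder4: "(\<Sum>e\<in>E. \<Sum>d\<in>C. \<Sum>a\<in>A. \<Sum>b\<in>B. f a b d e) = (\<Sum>a\<in>A. \<Sum>b\<in>B. \<Sum>d\<in>C. \<Sum>e\<in>E. f a b d e)"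
  by (simp only: sum.swap[where A = E and B = C] sum.swap[where A = E and B = A] sum.swap[where A = E and B = B]
     sum.swap[where A = C and B = A] sum.swap[where A = C and B = B])

lemma sum_rotate3: "(\<Sum>b\<in>B. \<Sum>j\<in>J. \<Sum>a\<in>A. f a b j) = (\<Sum>a\<in>A. \<Sum>b\<in>B. \<Sum>j\<in>J. f a b j)"
  by (simp only: sum.swap[where A = J and B = A] sum.swap[where A = B and B = A])

lemma eq_minus_self_zero: "X = - X \<Longrightarrow> X = 0" for X :: "'m \<Rightarrow> spoly"
  by (auto simp: fun_eq_iff fun_ops)

lemma triple_eq_zero: "X + X + X = 0 \<Longrightarrow> X = 0" for X :: "'m \<Rightarrow> spoly"
  by (auto simp: fun_eq_iff fun_ops)

section \<open>The Lie derivative, and d_A^2 = 0 on the coordinates\<close>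

context lie_structure
begin

text \<open>Multiplication by the 1-form d_A f, which is the sum of \<partial>f/\<partial>x^j times
  d_A x^j.\<close>

definition q_deriv :: "('m \<Rightarrow> real) \<Rightarrow> ('m \<Rightarrow> spoly) \<Rightarrow> 'm \<Rightarrow> spoly" where
  "q_deriv f G = (\<Sum>j<n. scale (D j f) (q_base j G))"

definition lie :: "('m \<Rightarrow> spoly) \<Rightarrow> 'm \<Rightarrow> spoly" where
  "lie G = iota (dform G) - dform (iota G)"

lemma lie_add: "G \<in> sfuns \<Longrightarrow> H \<in> sfuns \<Longrightarrow> lie (G + H) = lie G + lie H"
  unfolding lie_def by (simp add: dform_add push_add sfuns_iota)

lemma lie_zero: "lie 0 = 0"
  unfolding lie_def by (simp add: dform_zero push_zero)

lemma lie_sum: "(\<And>i. i \<in> I \<Longrightarrow> G i \<in> sfuns) \<Longrightarrow> lie (sum G I) = (\<Sum>i\<in>I. lie (G i))"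
  by (induction I rule: infinite_finite_induct) (simp_all add: lie_zero lie_add sfuns_sum)

text \<open>The Leibniz rule with L f = d_A f: \<open>dform_scale\<close> produces df, and the
  contraction replaces each differential of x^j in it by d_A x^j.\<close>

lemma lie_scale:
  assumes "G \<in> sfuns" "smooth f" shows "lie (scale f G) = scale f (lie G) + q_deriv f G"
  unfolding lie_def q_deriv_def using assms
  by (simp add: dform_scale sfuns_iota push_add push_sum push_scale iota_xdot scale_add fun_linear_diff[OF fun_linear_scale_op]
      sum.distrib)

lemma lie_odd_mul:
  assumes "G \<in> sfuns" "k < r" shows "lie (odd_mul k G) = q_fibre k G - odd_mul k (lie G)"
  unfolding lie_def using assms
  by (simp add: dform_odd_mul iota_odd_mul iota_even_mul push_diff sfuns_iota)

lemma scale_cong: "G \<in> sfuns \<Longrightarrow> (\<And>p. p \<in> U \<Longrightarrow> f p = g p) \<Longrightarrow> scale f G = scale g G"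
  unfolding scale_def fun_eq_iff by (metis mult_zero_right sfuns_outside)

text \<open>Exchanging the names of the indices and then the two odd generators shows that the sum
  is its own negative.\<close>

lemma quadratic_zero:
  assumes G: "G \<in> sfuns" and t: "\<And>\<alpha> \<beta> p. \<alpha> < r \<Longrightarrow> \<beta> < r \<Longrightarrow> p \<in> U \<Longrightarrow> t \<alpha> \<beta> p = t \<beta> \<alpha> p"
  shows "(\<Sum>\<alpha><r. \<Sum>\<beta><r. scale (t \<alpha> \<beta>) (odd_mul \<alpha> (odd_mul \<beta> G))) = 0" (is "?X = 0")
proof -
  have "?X = (\<Sum>\<beta><r. \<Sum>\<alpha><r. scale (t \<alpha> \<beta>) (odd_mul \<alpha> (odd_mul \<beta> G)))" by (rule sum.swap)
  also have "\<dots> = (\<Sum>\<beta><r. \<Sum>\<alpha><r. - scale (t \<beta> \<alpha>) (odd_mul \<beta> (odd_mul \<alpha> G)))"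
  proof (intro sum.cong refl)
    fix \<alpha> \<beta> assume "\<beta> \<in> {..<r}" "\<alpha> \<in> {..<r}"
    then have "scale (t \<alpha> \<beta>) (odd_mul \<alpha> (odd_mul \<beta> G)) = scale (t \<beta> \<alpha>) (odd_mul \<alpha> (odd_mul \<beta> G))"
      using G t by (intro scale_cong sfuns_odd_mul) auto
    then show "scale (t \<alpha> \<beta>) (odd_mul \<alpha> (odd_mul \<beta> G)) = - scale (t \<beta> \<alpha>) (odd_mul \<beta> (odd_mul \<alpha> G))"
      by (simp add: odd_mul_anticommute[of \<alpha> \<beta>] scale_minus_right)
  qed
  also have "\<dots> = - ?X" by (simp add: sum_negf)
  finally show ?thesis by (rule eq_minus_self_zero)
qed

text \<open>A rotation of three odd generators is an even permutation, so rotating the indices of t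
  alone does not change the sum. Three copies of the sum then carry the cyclic sum of t as
  coefficient.\<close>

lemma cubic_zero:
  assumes G: "G \<in> sfuns" and t: "\<And>\<alpha> \<beta> \<delta> p. \<alpha> < r \<Longrightarrow> \<beta> < r \<Longrightarrow> \<delta> < r \<Longrightarrow> p \<in> U \<Longrightarrow>
    t \<alpha> \<beta> \<delta> p + t \<beta> \<delta> \<alpha> p + t \<delta> \<alpha> \<beta> p = 0"
  shows "(\<Sum>\<alpha><r. \<Sum>\<beta><r. \<Sum>\<delta><r. scale (t \<alpha> \<beta> \<delta>) (odd_mul \<alpha> (odd_mul \<beta> (odd_mul \<delta> G)))) = 0" (is "?X = 0")
proof -
  let ?M = "\<lambda>\<alpha> \<beta> \<delta>. odd_mul \<alpha> (odd_mul \<beta> (odd_mul \<delta> G))"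
  have rot: "(\<Sum>\<alpha><r. \<Sum>\<beta><r. \<Sum>\<delta><r. scale (s \<alpha> \<beta> \<delta>) (?M \<alpha> \<beta> \<delta>)) =
    (\<Sum>\<alpha><r. \<Sum>\<beta><r. \<Sum>\<delta><r. scale (s \<beta> \<delta> \<alpha>) (?M \<alpha> \<beta> \<delta>))" for s
  proof -
    have "(\<Sum>\<alpha><r. \<Sum>\<beta><r. \<Sum>\<delta><r. scale (s \<alpha> \<beta> \<delta>) (?M \<alpha> \<beta> \<delta>)) =
      (\<Sum>\<alpha><r. \<Sum>\<beta><r. \<Sum>\<delta><r. scale (s \<beta> \<delta> \<alpha>) (?M \<beta> \<delta> \<alpha>))"
      by (rule sum_rotate3)
    also have "\<dots> = (\<Sum>\<alpha><r. \<Sum>\<beta><r. \<Sum>\<delta><r. scale (s \<beta> \<delta> \<alpha>) (?M \<alpha> \<beta> \<delta>))"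
      by (intro sum.cong refl arg_cong2[of _ _ _ _ scale] odd_mul_swap2)
    finally show ?thesis .
  qed
  have X1: "?X = (\<Sum>\<alpha><r. \<Sum>\<beta><r. \<Sum>\<delta><r. scale (t \<beta> \<delta> \<alpha>) (?M \<alpha> \<beta> \<delta>))"
    by (rule rot)
  also have "\<dots> = (\<Sum>\<alpha><r. \<Sum>\<beta><r. \<Sum>\<delta><r. scale (t \<delta> \<alpha> \<beta>) (?M \<alpha> \<beta> \<delta>))"
    by (rule rot)
  finally have X2: "?X = \<dots>" .
  have "?X + ?X + ?X = ?X + (\<Sum>\<alpha><r. \<Sum>\<beta><r. \<Sum>\<delta><r. scale (t \<beta> \<delta> \<alpha>) (?M \<alpha> \<beta> \<delta>))
      + (\<Sum>\<alpha><r. \<Sum>\<beta><r. \<Sum>\<delta><r. scale (t \<delta> \<alpha> \<beta>) (?M \<alpha> \<beta> \<delta>))"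
    by (simp only: flip: X1 X2)
  also have "\<dots> = (\<Sum>\<alpha><r. \<Sum>\<beta><r. \<Sum>\<delta><r.
      scale (\<lambda>p. t \<alpha> \<beta> \<delta> p + t \<beta> \<delta> \<alpha> p + t \<delta> \<alpha> \<beta> p) (?M \<alpha> \<beta> \<delta>))"
    by (simp add: sum.distrib scale_add_left)
  also have "\<dots> = (\<Sum>\<alpha><r. \<Sum>\<beta><r. \<Sum>\<delta><r. scale (\<lambda>_. 0) (?M \<alpha> \<beta> \<delta>))"
    by (intro sum.cong refl scale_cong sfuns_odd_mul G) (simp_all add: t)
  also have "\<dots> = 0" by (simp add: scale_zero)
  finally show ?thesis by (rule triple_eq_zero)
qed

text \<open>This is d_A (d_A x^i) = 0. Apart from that quadratic form in \<lambda>, only the sign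
  for passing the 1-form d_A x^i remains.\<close>

lemma lie_q_base:
  assumes G: "G \<in> sfuns" and i: "i < n" shows "lie (q_base i G) = - q_base i (lie G)"
proof -
  have "lie (q_base i G) = (\<Sum>\<alpha><r. scale (anchor_fun i \<alpha>) (q_fibre \<alpha> G - odd_mul \<alpha> (lie G)) + q_deriv (anchor_fun i \<alpha>) (odd_mul \<alpha> G))"
    unfolding q_base_def using assms
    by (subst lie_sum) (auto intro!: sum.cong sfuns_closed simp: lie_scale lie_odd_mul smooth_anchor_fun sfuns_odd_mul)
  also have "\<dots> = ((\<Sum>\<alpha><r. scale (anchor_fun i \<alpha>) (q_fibre \<alpha> G)) + (\<Sum>\<alpha><r. q_deriv (anchor_fun i \<alpha>) (odd_mul \<alpha> G))) - q_base i (lie G)"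
    by (simp add: q_base_def fun_linear_diff[OF fun_linear_scale_op] sum.distrib sum_subtractf)
  also have "(\<Sum>\<gamma><r. scale (anchor_fun i \<gamma>) (q_fibre \<gamma> G))
     = (\<Sum>\<alpha><r. \<Sum>\<beta><r. scale (\<lambda>p. \<Sum>\<gamma><r. anchor_fun i \<gamma> p * (- (1 / 2) * struct_fun \<gamma> \<alpha> \<beta> p)) (odd_mul \<alpha> (odd_mul \<beta> G)))"
    unfolding q_fibre_def scale_sum_left scale_sum scale_scale
    by (rule sum_rotate3[symmetric])
  also have "(\<Sum>\<beta><r. q_deriv (anchor_fun i \<beta>) (odd_mul \<beta> G))
     = (\<Sum>\<alpha><r. \<Sum>\<beta><r. scale (\<lambda>p. \<Sum>j<n. D j (anchor_fun i \<beta>) p * anchor_fun j \<alpha> p) (odd_mul \<alpha> (odd_mul \<beta> G)))"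
    unfolding q_deriv_def q_base_def scale_sum_left scale_sum scale_scale by (rule sum_rotate3)
  also have "(\<Sum>\<alpha><r. \<Sum>\<beta><r. scale (\<lambda>p. \<Sum>\<gamma><r. anchor_fun i \<gamma> p * (- (1 / 2) * struct_fun \<gamma> \<alpha> \<beta> p)) (odd_mul \<alpha> (odd_mul \<beta> G)))
     + (\<Sum>\<alpha><r. \<Sum>\<beta><r. scale (\<lambda>p. \<Sum>j<n. D j (anchor_fun i \<beta>) p * anchor_fun j \<alpha> p) (odd_mul \<alpha> (odd_mul \<beta> G)))
     = (\<Sum>\<alpha><r. \<Sum>\<beta><r. scale (\<lambda>p. (\<Sum>\<gamma><r. anchor_fun i \<gamma> p * (- (1 / 2) * struct_fun \<gamma> \<alpha> \<beta> p)) +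
          (\<Sum>j<n. D j (anchor_fun i \<beta>) p * anchor_fun j \<alpha> p)) (odd_mul \<alpha> (odd_mul \<beta> G)))"
    by (simp add: scale_add_left sum.distrib)
  also have "\<dots> = 0"
  \<comment> \<open>Let \<rho>_\<alpha> be the derivation with components
    \<open>anchor_fun j \<alpha>\<close>. By \<open>anchor_eq\<close> the coefficient is half the
    sum of \<rho>_\<alpha>(\<rho>_\<beta> x^i) and \<rho>_\<beta>(\<rho>_\<alpha> x^i), hence
    symmetric.\<close>
  proof (rule quadratic_zero[OF G])
    fix \<alpha> \<beta> p assume *: "\<alpha> < r" "\<beta> < r" "p \<in> U"
    have "(\<Sum>\<gamma><r. anchor_fun i \<gamma> p * (- (1 / 2) * struct_fun \<gamma> \<alpha> \<beta> p)) = - (1/2) * (\<Sum>\<gamma><r. struct_fun \<gamma> \<alpha> \<beta> p * anchor_fun i \<gamma> p)"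
      by (simp add: sum_distrib_left algebra_simps)
    moreover have "(\<Sum>\<gamma><r. anchor_fun i \<gamma> p * (- (1 / 2) * struct_fun \<gamma> \<beta> \<alpha> p)) = (1/2) * (\<Sum>\<gamma><r. struct_fun \<gamma> \<alpha> \<beta> p * anchor_fun i \<gamma> p)"
      unfolding sum_distrib_left by (intro sum.cong refl, subst struct_fun_skew) (use * in auto)
    ultimately show "(\<Sum>\<gamma><r. anchor_fun i \<gamma> p * (- (1 / 2) * struct_fun \<gamma> \<alpha> \<beta> p)) + (\<Sum>j<n. D j (anchor_fun i \<beta>) p * anchor_fun j \<alpha> p)
      = (\<Sum>\<gamma><r. anchor_fun i \<gamma> p * (- (1 / 2) * struct_fun \<gamma> \<beta> \<alpha> p)) + (\<Sum>j<n. D j (anchor_fun i \<alpha>) p * anchor_fun j \<beta> p)"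
      using anchor_eq[OF i *] by (simp add: mult.commute)
  qed
  finally show ?thesis by simp
qed

text \<open>This is d_A (d_A \<lambda>^\<gamma>) = 0. The cubic form has two sources, the
  derivatives of the structure functions and the 2-forms that replace one of the two factors
  \<lambda>; they match the two kinds of terms in \<open>jacobi\<close>.\<close>

lemma lie_q_fibre:
  assumes G: "G \<in> sfuns" and g: "\<gamma> < r" shows "lie (q_fibre \<gamma> G) = q_fibre \<gamma> (lie G)"
proof -
  let ?c = "\<lambda>\<alpha> \<beta> p. - (1 / 2) * struct_fun \<gamma> \<alpha> \<beta> p"
  let ?M = "\<lambda>\<alpha> \<beta> \<delta>. odd_mul \<alpha> (odd_mul \<beta> (odd_mul \<delta> G))"
  have L2: "lie (odd_mul \<alpha> (odd_mul \<beta> G)) = (q_fibre \<alpha> (odd_mul \<beta> G) - q_fibre \<beta> (odd_mul \<alpha> G)) + odd_mul \<alpha> (odd_mul \<beta> (lie G))"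
    if "\<alpha> < r" "\<beta> < r" for \<alpha> \<beta>
    using that G by (simp add: lie_odd_mul sfuns_odd_mul push_diff q_fibre_odd_mul)
  have c: "scale (?c \<alpha> \<beta>) (odd_mul \<alpha> (odd_mul \<beta> G)) \<in> sfuns" if "\<alpha> < r" "\<beta> < r" for \<alpha> \<beta>
    by (intro sfuns_scale sfuns_odd_mul smooth_cmult smooth_struct_fun G) (use that g in auto)
  have "lie (q_fibre \<gamma> G) = (\<Sum>\<alpha><r. \<Sum>\<beta><r. lie (scale (?c \<alpha> \<beta>) (odd_mul \<alpha> (odd_mul \<beta> G))))"
    unfolding q_fibre_def by (subst lie_sum, (intro sfuns_sum c; simp), intro sum.cong refl lie_sum c) simp_all
  also have "\<dots> = (\<Sum>\<alpha><r. \<Sum>\<beta><r. scale (?c \<alpha> \<beta>) (q_fibre \<alpha> (odd_mul \<beta> G)) - scale (?c \<alpha> \<beta>) (q_fibre \<beta> (odd_mul \<alpha> G))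
      + scale (?c \<alpha> \<beta>) (odd_mul \<alpha> (odd_mul \<beta> (lie G))) + q_deriv (?c \<alpha> \<beta>) (odd_mul \<alpha> (odd_mul \<beta> G)))"
  proof (intro sum.cong refl)
    fix \<alpha> \<beta> assume *: "\<alpha> \<in> {..<r}" "\<beta> \<in> {..<r}"
    have "lie (scale (?c \<alpha> \<beta>) (odd_mul \<alpha> (odd_mul \<beta> G)))
      = scale (?c \<alpha> \<beta>) (lie (odd_mul \<alpha> (odd_mul \<beta> G))) + q_deriv (?c \<alpha> \<beta>) (odd_mul \<alpha> (odd_mul \<beta> G))"
      by (intro lie_scale sfuns_odd_mul smooth_cmult smooth_struct_fun G) (use * g in auto)
    then show "lie (scale (?c \<alpha> \<beta>) (odd_mul \<alpha> (odd_mul \<beta> G)))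
      = scale (?c \<alpha> \<beta>) (q_fibre \<alpha> (odd_mul \<beta> G)) - scale (?c \<alpha> \<beta>) (q_fibre \<beta> (odd_mul \<alpha> G))
        + scale (?c \<alpha> \<beta>) (odd_mul \<alpha> (odd_mul \<beta> (lie G))) + q_deriv (?c \<alpha> \<beta>) (odd_mul \<alpha> (odd_mul \<beta> G))"
      using * by (simp only: L2 lessThan_iff scale_add fun_linear_diff[OF fun_linear_scale_op])
  qed
  also have "\<dots> = (\<Sum>\<alpha><r. \<Sum>\<beta><r. scale (?c \<alpha> \<beta>) (q_fibre \<alpha> (odd_mul \<beta> G)))
      - (\<Sum>\<alpha><r. \<Sum>\<beta><r. scale (?c \<alpha> \<beta>) (q_fibre \<beta> (odd_mul \<alpha> G)))
      + (\<Sum>\<alpha><r. \<Sum>\<beta><r. q_deriv (?c \<alpha> \<beta>) (odd_mul \<alpha> (odd_mul \<beta> G))) + q_fibre \<gamma> (lie G)"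
    unfolding q_fibre_def[of \<gamma>] by (simp add: sum.distrib sum_subtractf)
  \<comment> \<open>After exchanging the names both sums involve
    \<open>q_fibre \<alpha> (odd_mul \<beta> G)\<close>; skew symmetry then makes one coefficient of
    the two halves.\<close>
  also have "(\<Sum>\<alpha><r. \<Sum>\<beta><r. scale (?c \<alpha> \<beta>) (q_fibre \<beta> (odd_mul \<alpha> G))) =
      (\<Sum>\<beta><r. \<Sum>\<alpha><r. scale (?c \<alpha> \<beta>) (q_fibre \<beta> (odd_mul \<alpha> G)))"
    by (rule sum.swap)
  also have "(\<Sum>\<alpha><r. \<Sum>\<beta><r. scale (?c \<alpha> \<beta>) (q_fibre \<alpha> (odd_mul \<beta> G))) - \<dots> =
     (\<Sum>\<alpha><r. \<Sum>\<beta><r. scale (?c \<alpha> \<beta>) (q_fibre \<alpha> (odd_mul \<beta> G)) - scale (?c \<beta> \<alpha>) (q_fibre \<alpha> (odd_mul \<beta> G)))"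
    by (simp add: sum_subtractf)
  also have "\<dots> = (\<Sum>\<alpha><r. \<Sum>\<beta><r. scale (\<lambda>p. - struct_fun \<gamma> \<alpha> \<beta> p) (q_fibre \<alpha> (odd_mul \<beta> G)))"
  proof (intro sum.cong refl)
    fix \<alpha> \<beta> assume *: "\<alpha> \<in> {..<r}" "\<beta> \<in> {..<r}"
    then have q: "q_fibre \<alpha> (odd_mul \<beta> G) \<in> sfuns" using G by (auto intro!: sfuns_closed)
    have "scale (?c \<alpha> \<beta>) (q_fibre \<alpha> (odd_mul \<beta> G)) - scale (?c \<beta> \<alpha>) (q_fibre \<alpha> (odd_mul \<beta> G))
      = scale (\<lambda>p. ?c \<alpha> \<beta> p + - ?c \<beta> \<alpha> p) (q_fibre \<alpha> (odd_mul \<beta> G))"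
      by (simp only: scale_add_left scale_minus_left) simp
    also have "\<dots> = scale (\<lambda>p. - struct_fun \<gamma> \<alpha> \<beta> p) (q_fibre \<alpha> (odd_mul \<beta> G))"
      by (rule scale_cong[OF q], subst (2) struct_fun_skew) (use * g in auto)
    finally show "scale (?c \<alpha> \<beta>) (q_fibre \<alpha> (odd_mul \<beta> G)) - scale (?c \<beta> \<alpha>) (q_fibre \<alpha> (odd_mul \<beta> G))
      = scale (\<lambda>p. - struct_fun \<gamma> \<alpha> \<beta> p) (q_fibre \<alpha> (odd_mul \<beta> G))" .
  qed
  also have "\<dots> = (\<Sum>\<alpha><r. \<Sum>\<beta><r. \<Sum>\<delta><r.
      scale (\<lambda>p. \<Sum>\<epsilon><r. - struct_fun \<gamma> \<epsilon> \<delta> p * (- (1 / 2) * struct_fun \<epsilon> \<alpha> \<beta> p)) (?M \<alpha> \<beta> \<delta>))"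
    unfolding q_fibre_def scale_sum_left scale_sum scale_scale by (rule sum_reorder4)
  also have "(\<Sum>\<alpha><r. \<Sum>\<beta><r. q_deriv (?c \<alpha> \<beta>) (odd_mul \<alpha> (odd_mul \<beta> G)))
    = (\<Sum>\<alpha><r. \<Sum>\<beta><r. \<Sum>\<delta><r. scale (\<lambda>p. \<Sum>j<n. D j (?c \<beta> \<delta>) p * anchor_fun j \<alpha> p) (?M \<alpha> \<beta> \<delta>))"
    unfolding q_deriv_def q_base_def scale_sum_left scale_sum scale_scale by (rule sum_rotate4)
  also have "(\<Sum>\<alpha><r. \<Sum>\<beta><r. \<Sum>\<delta><r.
      scale (\<lambda>p. \<Sum>\<epsilon><r. - struct_fun \<gamma> \<epsilon> \<delta> p * (- (1 / 2) * struct_fun \<epsilon> \<alpha> \<beta> p)) (?M \<alpha> \<beta> \<delta>)) + \<dots> =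
     (\<Sum>\<alpha><r. \<Sum>\<beta><r. \<Sum>\<delta><r. scale (\<lambda>p. (\<Sum>\<epsilon><r. - struct_fun \<gamma> \<epsilon> \<delta> p * (- (1 / 2) * struct_fun \<epsilon> \<alpha> \<beta> p)) +
       (\<Sum>j<n. D j (?c \<beta> \<delta>) p * anchor_fun j \<alpha> p)) (?M \<alpha> \<beta> \<delta>))"
    by (simp add: scale_add_left sum.distrib)
  also have "\<dots> = 0"
  proof (rule cubic_zero[OF G])
    \<comment> \<open>The quadratic term that accompanies a derivative term here belongs to another
      rotation of the three indices than in \<open>jacobi\<close>, for instance e3 in place of e1.
      The sum over all rotations is the same.\<close>
    have aux: "a1 + e1 + (a2 + e2) + (a3 + e3) = 0 \<Longrightarrow>
      - (1/2) * (a1 + e3) + - (1/2) * (a2 + e1) + - (1/2) * (a3 + e2) = (0::real)" for a1 a2 a3 e1 e2 e3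
      by argo
    fix \<alpha> \<beta> \<delta> p assume *: "\<alpha> < r" "\<beta> < r" "\<delta> < r" "p \<in> U"
    have t: "(\<Sum>\<epsilon><r. - struct_fun \<gamma> \<epsilon> \<delta> p * (- (1 / 2) * struct_fun \<epsilon> \<alpha> \<beta> p)) + (\<Sum>j<n. D j (?c \<beta> \<delta>) p * anchor_fun j \<alpha> p)
      = - (1/2) * ((\<Sum>j<n. anchor_fun j \<alpha> p * D j (struct_fun \<gamma> \<beta> \<delta>) p) + (\<Sum>\<epsilon><r. struct_fun \<gamma> \<delta> \<epsilon> p * struct_fun \<epsilon> \<alpha> \<beta> p))"
      if "\<alpha> < r" "\<beta> < r" "\<delta> < r" for \<alpha> \<beta> \<delta>
    proof -
      have "(\<Sum>\<epsilon><r. - struct_fun \<gamma> \<epsilon> \<delta> p * (- (1 / 2) * struct_fun \<epsilon> \<alpha> \<beta> p)) = (\<Sum>\<epsilon><r. - (1/2) * (struct_fun \<gamma> \<delta> \<epsilon> p * struct_fun \<epsilon> \<alpha> \<beta> p))"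
        by (intro sum.cong refl, subst struct_fun_skew) (use that * g in auto)
      moreover have "(\<Sum>j<n. D j (?c \<beta> \<delta>) p * anchor_fun j \<alpha> p) = (\<Sum>j<n. - (1/2) * (anchor_fun j \<alpha> p * D j (struct_fun \<gamma> \<beta> \<delta>) p))"
        by (intro sum.cong refl, subst D_cmult) (use that * g in \<open>auto intro: smooth_struct_fun\<close>)
      ultimately show ?thesis by (simp only: sum_distrib_left distrib_left) (simp only: add.commute)?
    qed
    show "(\<Sum>\<epsilon><r. - struct_fun \<gamma> \<epsilon> \<delta> p * (- (1 / 2) * struct_fun \<epsilon> \<alpha> \<beta> p)) + (\<Sum>j<n. D j (?c \<beta> \<delta>) p * anchor_fun j \<alpha> p)
      + ((\<Sum>\<epsilon><r. - struct_fun \<gamma> \<epsilon> \<alpha> p * (- (1 / 2) * struct_fun \<epsilon> \<beta> \<delta> p)) + (\<Sum>j<n. D j (?c \<delta> \<alpha>) p * anchor_fun j \<beta> p))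
      + ((\<Sum>\<epsilon><r. - struct_fun \<gamma> \<epsilon> \<beta> p * (- (1 / 2) * struct_fun \<epsilon> \<delta> \<alpha> p)) + (\<Sum>j<n. D j (?c \<alpha> \<beta>) p * anchor_fun j \<delta> p)) = 0"
      unfolding t[OF *(1-3)] t[OF *(2,3,1)] t[OF *(3,1,2)]
      using jacobi[OF g *] by (rule aux)
  qed
  finally show ?thesis by simp
qed

section \<open>The commutator of the contraction with the Lie derivative vanishes\<close>

definition iota_lie :: "('m \<Rightarrow> spoly) \<Rightarrow> 'm \<Rightarrow> spoly" where
  "iota_lie G = iota (lie G) - lie (iota G)"

lemma iota_lie_add: "G \<in> sfuns \<Longrightarrow> H \<in> sfuns \<Longrightarrow> iota_lie (G + H) = iota_lie G + iota_lie H"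
  unfolding iota_lie_def by (simp add: lie_add push_add sfuns_iota)

lemma iota_lie_zero: "iota_lie 0 = 0"
  unfolding iota_lie_def by (simp add: lie_zero push_zero)

lemma iota_lie_sum: "(\<And>i. i \<in> I \<Longrightarrow> G i \<in> sfuns) \<Longrightarrow> iota_lie (sum G I) = (\<Sum>i\<in>I. iota_lie (G i))"
  by (induction I rule: infinite_finite_induct) (simp_all add: iota_lie_zero iota_lie_add sfuns_sum)

text \<open>L contributes terms \<open>q_deriv f\<close>, but they cancel in the commutator: d_A f
  contains no dotted generator, so the contraction passes through it.\<close>

lemma iota_lie_scale:
  assumes "G \<in> sfuns" "smooth f" shows "iota_lie (scale f G) = scale f (iota_lie G)"
proof -
  have "iota (q_deriv f G) = q_deriv f (iota G)"
    unfolding q_deriv_def by (simp add: push_sum push_scale iota_q_base)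
  then show ?thesis
    unfolding iota_lie_def using assms
    by (simp add: lie_scale push_add push_scale sfuns_iota fun_linear_diff[OF fun_linear_scale_op])
qed

lemma iota_lie_odd_mul:
  assumes "G \<in> sfuns" "k < r" shows "iota_lie (odd_mul k G) = - odd_mul k (iota_lie G)"
  unfolding iota_lie_def using assms
  by (simp add: lie_odd_mul iota_odd_mul push_diff sfuns_iota iota_q_fibre)

text \<open>Moving the generator out leaves the correction
  \<open>q_base i (lie G) + lie (q_base i G)\<close> twice, and \<open>lie_q_base\<close> says that
  it is zero. The even generators are treated in the same way with
  \<open>lie_q_fibre\<close>.\<close>

lemma iota_lie_xdot:
  assumes G: "G \<in> sfuns" and i: "i < n" shows "iota_lie (odd_mul (r + i) G) = - odd_mul (r + i) (iota_lie G)"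
proof -
  \<comment> \<open>The last two terms together multiply by minus the de Rham differential of d_A
    x^i. Left unexpanded, they recombine into \<open>lie\<close> once the contraction is
    applied.\<close>
  have LLx: "lie (odd_mul (r + i) H) = - odd_mul (r + i) (lie H) - q_base i (dform H) - dform (q_base i H)"
    if "H \<in> sfuns" for H
    unfolding lie_def using that i
    by (simp add: dform_xdot iota_xdot push_minus push_diff dform_add sfuns_closed)
  have "iota_lie (odd_mul (r + i) G) = - odd_mul (r + i) (iota_lie G) - q_base i (lie G) - q_base i (lie G)
      - lie (q_base i G) - lie (q_base i G)"
    unfolding iota_lie_def using assms
    by (simp add: LLx iota_xdot push_diff push_minus lie_add sfuns_closed iota_q_base)
       (simp add: lie_def push_diff iota_q_base algebra_simps)
  then show ?thesis by (simp add: lie_q_base[OF G i])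
qed

lemma iota_lie_even_mul:
  assumes G: "G \<in> sfuns" and i: "i < r" shows "iota_lie (even_mul i G) = even_mul i (iota_lie G)"
proof -
  have LLx: "lie (even_mul i H) = even_mul i (lie H) + q_fibre i (dform H) - dform (q_fibre i H)"
    if "H \<in> sfuns" for H
    unfolding lie_def using that i
    by (simp add: dform_even_mul iota_even_mul push_add push_diff dform_add sfuns_closed)
  have "iota_lie (even_mul i G) = even_mul i (iota_lie G) + q_fibre i (lie G) + q_fibre i (lie G)
      - lie (q_fibre i G) - lie (q_fibre i G)"
    unfolding iota_lie_def using assms
    by (simp add: LLx iota_even_mul push_diff push_add lie_add sfuns_closed iota_q_fibre)
       (simp add: lie_def push_diff iota_q_fibre algebra_simps)
  then show ?thesis by (simp add: lie_q_fibre[OF G i])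
qed

text \<open>The constant 1 is restricted to \<open>U\<close> because members of \<open>sfuns\<close>
  vanish elsewhere.\<close>

definition basis_fun :: "nat set \<Rightarrow> nat multiset \<Rightarrow> 'm \<Rightarrow> spoly" where
  "basis_fun S m = (\<lambda>p S' m'. if p \<in> U \<and> S' = S \<and> m' = m then 1 else 0)"

lemma sfuns_basis_fun:
  assumes "S \<subseteq> {..<r + n}" "set_mset m \<subseteq> {..<r}" shows "basis_fun S m \<in> sfuns"
proof (rule sfunsI[where N = "size m"])
  fix S' m' show "smooth (\<lambda>p. basis_fun S m p S' m')"
    by (rule smooth_cong[OF _ smooth_const[of "if S' = S \<and> m' = m then 1 else 0"]])
      (auto simp: basis_fun_def)
qed (use assms in \<open>auto simp: basis_fun_def split: if_splits\<close>)

lemma iota_lie_basis_empty: "iota_lie (basis_fun {} {#}) = 0"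
proof -
  have "odd_der k (basis_fun {} {#}) = 0" "even_der k (basis_fun {} {#}) = 0" for k
    by (simp_all add: fun_eq_iff fun_ops odd_der_eq even_der_eq basis_fun_def)
  moreover have "coeff_D i (basis_fun {} {#}) = 0" if "i < n" for i
  proof -
    have "D i (\<lambda>q. if q \<in> U \<and> S = {} \<and> m = {#} then 1 else 0) p = 0" if "p \<in> U" for p S m
      using D_cong[OF \<open>i < n\<close>, of "\<lambda>q. if q \<in> U \<and> S = {} \<and> m = {#} then 1 else 0"
          "\<lambda>q. if S = {} \<and> m = {#} then 1 else 0" p] D_const[OF \<open>i < n\<close> that]
      by (auto simp: that)
    then show ?thesis by (auto simp: fun_eq_iff fun_ops coeff_D_def basis_fun_def)
  qed
  ultimately have "iota (basis_fun {} {#}) = 0" "dform (basis_fun {} {#}) = 0"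
    by (simp_all add: iota_def dform_def push_zero)
  then show ?thesis by (simp add: iota_lie_def lie_def push_zero dform_zero)
qed

lemma iota_lie_basis_fun:
  assumes "S \<subseteq> {..<r + n}" "set_mset m \<subseteq> {..<r}" shows "iota_lie (basis_fun S m) = 0"
proof -
  have m: "iota_lie (basis_fun {} m) = 0" using assms(2)
  proof (induction m)
    case (add \<alpha> m)
    have "basis_fun {} (add_mset \<alpha> m) = even_mul \<alpha> (basis_fun {} m)"
      by (auto simp: fun_eq_iff basis_fun_def even_mul_def)
    then show ?case using add by (simp add: iota_lie_even_mul sfuns_basis_fun push_zero)
  qed (simp add: iota_lie_basis_empty)
  have "finite S" using assms(1) finite_subset by blast
  then show ?thesis using assms(1)
  \<comment> \<open>The inserted index lies below all others, so its generator stands in front of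
    the ordered product and the sign is 1.\<close>
  proof (induction S rule: finite_linorder_min_induct)
    case (insert k S)
    have "{j \<in> insert k S. j < k} = {}" using insert.hyps by auto
    then have "osgn k (insert k S) = 1" by (simp only: osgn_def card.empty power_0)
    then have "basis_fun (insert k S) m = odd_mul k (basis_fun S m)"
      using insert.hyps by (auto simp: fun_eq_iff basis_fun_def odd_mul_def)
    moreover have "iota_lie (odd_mul k (basis_fun S m)) = - odd_mul k (iota_lie (basis_fun S m))"
      using insert.prems assms(2) iota_lie_xdot[of "basis_fun S m" "k - r"]
      by (cases "k < r") (auto simp: iota_lie_odd_mul sfuns_basis_fun)
    ultimately show ?case using insert by (simp add: push_zero)
  qed (simp add: m)
qed

lemma finite_bounded_msets: "finite {m. set_mset m \<subseteq> {..<r} \<and> size m \<le> N}"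
proof (rule finite_subset)
  show "{m. set_mset m \<subseteq> {..<r} \<and> size m \<le> N} \<subseteq> mset ` {xs. set xs \<subseteq> {..<r} \<and> length xs \<le> N}"
  proof
    fix m assume "m \<in> {m. set_mset m \<subseteq> {..<r} \<and> size m \<le> N}"
    moreover obtain xs where "m = mset xs" by (metis ex_mset)
    ultimately show "m \<in> mset ` {xs. set xs \<subseteq> {..<r} \<and> length xs \<le> N}" by auto
  qed
qed (simp add: finite_lists_length_le)

lemma iota_lie_commute:
  assumes G: "G \<in> sfuns" shows "iota (lie G) = lie (iota G)"
proof -
  obtain N where N: "\<And>p S m. G p S m \<noteq> 0 \<Longrightarrow> S \<subseteq> {..<r + n} \<and> set_mset m \<subseteq> {..<r} \<and> size m \<le> N"
    using sfuns_bounded[OF G] by blast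
  \<comment> \<open>The coefficients of G are themselves smooth functions on the base, so G is a
    combination of monomials over these functions. The bound N keeps the set of monomials
    finite.\<close>
  let ?B = "Pow {..<r + n} \<times> {m. set_mset m \<subseteq> {..<r} \<and> size m \<le> N}"
  let ?t = "\<lambda>x. scale (\<lambda>p. G p (fst x) (snd x)) (basis_fun (fst x) (snd x))"
  have fin: "finite ?B" by (simp add: finite_bounded_msets)
  have "G = (\<Sum>x\<in>?B. ?t x)"
  proof (intro ext)
    fix p S m
    have "(\<Sum>x\<in>?B. ?t x) p S m = (\<Sum>x\<in>?B. if x = (S, m) then (if p \<in> U then G p S m else 0) else 0)"
      by (auto simp: sum_fun_app scale_def basis_fun_def prod_eq_iff intro!: sum.cong)
    also have "\<dots> = (if (S, m) \<in> ?B then (if p \<in> U then G p S m else 0) else 0)"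
      using fin by (simp only: sum.delta)
    also have "\<dots> = G p S m" using N[of p S m] sfuns_outside[OF G] by auto
    finally show "G p S m = (\<Sum>x\<in>?B. ?t x) p S m" by simp
  qed
  moreover have "iota_lie (\<Sum>x\<in>?B. ?t x) = (\<Sum>x\<in>?B. iota_lie (?t x))"
    by (rule iota_lie_sum) (auto intro!: sfuns_scale sfuns_basis_fun simp: sfuns_smooth[OF G])
  moreover have "iota_lie (?t x) = 0" if "x \<in> ?B" for x
    using that by (auto simp: iota_lie_scale sfuns_basis_fun sfuns_smooth[OF G] iota_lie_basis_fun)
  ultimately have "iota_lie G = 0" by simp
  then show ?thesis by (simp add: iota_lie_def)
qed

section \<open>Powers and exponential of the contraction\<close>

lemma sfuns_funpow: "G \<in> sfuns \<Longrightarrow> (iota ^^ k) G \<in> sfuns"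
  by (induction k) (simp_all add: sfuns_iota)

lemma funpow_dform: "G \<in> sfuns \<Longrightarrow>
  (iota ^^ Suc k) (dform G) = dform ((iota ^^ Suc k) G) + scale (\<lambda>_. real (Suc k)) (lie ((iota ^^ k) G))"
proof (induction k)
  case 0
  then show ?case by (simp add: lie_def scale_one)
next
  case (Suc k)
  have "(iota ^^ Suc (Suc k)) (dform G) = iota (dform ((iota ^^ Suc k) G)) + scale (\<lambda>_. real (Suc k)) (iota (lie ((iota ^^ k) G)))"
    using Suc by (simp add: push_add push_scale)
  also have "iota (dform ((iota ^^ Suc k) G)) = dform ((iota ^^ Suc (Suc k)) G) + lie ((iota ^^ Suc k) G)"
    by (simp add: lie_def)
  also have "iota (lie ((iota ^^ k) G)) = lie ((iota ^^ Suc k) G)"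
    using Suc.prems by (simp add: iota_lie_commute sfuns_funpow)
  also have "dform ((iota ^^ Suc (Suc k)) G) + lie ((iota ^^ Suc k) G) + scale (\<lambda>_. real (Suc k)) (lie ((iota ^^ Suc k) G))
    = dform ((iota ^^ Suc (Suc k)) G) + scale (\<lambda>p. real (Suc k) + 1) (lie ((iota ^^ Suc k) G))"
    by (simp only: scale_add_left scale_one) (simp add: add.assoc add.commute)
  finally show ?case by (simp add: add.commute)
qed

text \<open>The weight counts the dotted generators of a monomial. Each summand of
  \<open>iota\<close> differentiates by one of them and multiplies by generators \<lambda> only,
  whose indices lie below r and do not count.\<close>

lemma iota_weight:
  assumes "\<And>p S m. w < card (S \<inter> {r..<r + n}) + size m \<Longrightarrow> G p S m = 0"
    and "G \<in> sfuns" and "w \<le> card (S \<inter> {r..<r + n}) + size m"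
  shows "iota G p S m = 0"
proof -
  have odd0: "odd_mul \<alpha> H p S m = 0" if "\<alpha> < r" "\<And>S. w \<le> card (S \<inter> {r..<r + n}) + size m \<Longrightarrow> H p S m = 0"
     "w \<le> card (S \<inter> {r..<r + n}) + size m" for H S \<alpha>
  proof -
    have "(S - {\<alpha>}) \<inter> {r..<r + n} = S \<inter> {r..<r + n}" using that(1) by auto
    then show ?thesis using that by (simp add: odd_mul_def)
  qed
  have "odd_der (r + i) G p S m = 0" if "i < n" "w \<le> card (S \<inter> {r..<r + n}) + size m" for i S
  proof (cases "r + i \<in> S")
    case False
    have "insert (r + i) S \<inter> {r..<r + n} = insert (r + i) (S \<inter> {r..<r + n})" using that by auto
    moreover have "card (insert (r + i) (S \<inter> {r..<r + n})) = Suc (card (S \<inter> {r..<r + n}))"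
      using False by simp
    ultimately show ?thesis using False that assms(1)[of "insert (r + i) S" m p] by (simp add: odd_der_eq)
  qed (simp add: odd_der_eq)
  then have 1: "q_base i (odd_der (r + i) G) p S m = 0" if "i < n" for i
    using that odd0 assms(3) by (simp add: q_base_def sum_fun_app scale_def)
  have "even_der \<gamma> G p S m = 0" if "w \<le> card (S \<inter> {r..<r + n}) + size m" for \<gamma> S
    using that assms(1) by (simp add: even_der_eq)
  then have "odd_mul \<alpha> (even_der \<gamma> G) p S m = 0" if "\<alpha> < r" "w \<le> card (S \<inter> {r..<r + n}) + size m" for \<gamma> \<alpha> S
    using that odd0 by simp
  then have 2: "q_fibre \<gamma> (even_der \<gamma> G) p S m = 0" for \<gamma>
    using odd0 assms(3) by (simp add: q_fibre_def sum_fun_app scale_def)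
  show ?thesis using 1 2 by (simp add: iota_def sum_fun_app fun_ops)
qed

lemma iota_nilpotent:
  assumes G: "G \<in> sfuns" obtains K where "\<And>k. k \<ge> K \<Longrightarrow> (iota ^^ k) G = 0"
proof -
  obtain N where N: "\<And>p S m. G p S m \<noteq> 0 \<Longrightarrow> S \<subseteq> {..<r + n} \<and> set_mset m \<subseteq> {..<r} \<and> size m \<le> N"
    using sfuns_bounded[OF G] by blast
  \<comment> \<open>N bounds the number of even dotted generators and n that of the odd ones, so G
    has no coefficient of weight N + n + 1 or more.\<close>
  have "(iota ^^ k) G p S m = 0" if "N + n + 1 \<le> card (S \<inter> {r..<r + n}) + size m + k" for p S m k
    using that
  proof (induction k arbitrary: p S m)
    case 0
    have "card (S \<inter> {r..<r + n}) \<le> card {r..<r + n}" by (intro card_mono) auto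
    then show ?case using 0 N[of p S m] by fastforce
  next
    case (Suc k)
    \<comment> \<open>After k steps the weights above N + n - k are empty; one more step empties
      that weight as well.\<close>
    show ?case
      unfolding funpow.simps o_apply
      by (rule iota_weight[where w = "N + n - k"]) (use Suc sfuns_funpow[OF G] in auto)
  qed
  then have "(iota ^^ k) G = 0" if "k \<ge> N + n + 1" for k
    using that by (simp add: fun_eq_iff fun_ops)
  then show ?thesis using that by blast
qed

definition exp_iota :: "('m \<Rightarrow> spoly) \<Rightarrow> 'm \<Rightarrow> spoly" where
  "exp_iota G = (\<lambda>p S m. \<Sum>k. (iota ^^ k) G p S m / fact k)"

lemma exp_iota_finite:
  assumes "\<And>k. k \<ge> K \<Longrightarrow> (iota ^^ k) G = 0"
  shows "exp_iota G = (\<Sum>k<K. scale (\<lambda>_. 1 / fact k) ((iota ^^ k) G))"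
proof (intro ext)
  fix p S m
  show "exp_iota G p S m = (\<Sum>k<K. scale (\<lambda>_. 1 / fact k) ((iota ^^ k) G)) p S m"
    unfolding exp_iota_def
    by (subst suminf_finite[of "{..<K}"]) (auto simp: assms sum_fun_app scale_def fun_ops)
qed

lemma sfuns_exp_iota: assumes G: "G \<in> sfuns" shows "exp_iota G \<in> sfuns"
proof -
  obtain K where K: "\<And>k. k \<ge> K \<Longrightarrow> (iota ^^ k) G = 0" using iota_nilpotent[OF G] by blast
  have "exp_iota G = (\<Sum>k<K. scale (\<lambda>_. 1 / fact k) ((iota ^^ k) G))"
    by (rule exp_iota_finite) (rule K)
  then show ?thesis
    by (simp only:) (intro sfuns_sum sfuns_scale sfuns_funpow smooth_const G)
qed

lemma dform_scale_const: "G \<in> sfuns \<Longrightarrow> dform (scale (\<lambda>_. a) G) = scale (\<lambda>_. a) (dform G)"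
proof -
  assume G: "G \<in> sfuns"
  \<comment> \<open>The derivative of a constant is known to vanish on \<open>U\<close> only, hence
    the detour through \<open>scale_cong\<close>.\<close>
  have "scale (D j (\<lambda>_. a)) (odd_mul (r + j) G) = scale (\<lambda>_. 0) (odd_mul (r + j) G)" if "j < n" for j
    by (rule scale_cong) (use that G in \<open>auto simp: D_const intro!: sfuns_odd_mul\<close>)
  then show ?thesis using G by (simp add: dform_scale smooth_const scale_zero)
qed

lemma lie_scale_const: "G \<in> sfuns \<Longrightarrow> lie (scale (\<lambda>_. a) G) = scale (\<lambda>_. a) (lie G)"
  unfolding lie_def
  by (simp add: push_scale dform_scale_const sfuns_iota fun_linear_diff[OF fun_linear_scale_op])

theorem exp_iota_dform:
  assumes G: "G \<in> sfuns"
  shows "exp_iota (dform G) = dform (exp_iota G) + lie (exp_iota G)"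
proof -
  obtain K1 where K1: "\<And>k. k \<ge> K1 \<Longrightarrow> (iota ^^ k) G = 0" using iota_nilpotent[OF G] by blast
  obtain K2 where K2: "\<And>k. k \<ge> K2 \<Longrightarrow> (iota ^^ k) (dform G) = 0" using iota_nilpotent[OF sfuns_dform[OF G]] by blast
  define K where "K = max K1 K2"
  have K: "(iota ^^ k) G = 0" "(iota ^^ k) (dform G) = 0" if "k \<ge> K" for k
    using that K1 K2 by (auto simp: K_def)
  let ?f = "\<lambda>k. scale (\<lambda>_. 1 / fact k)"
  \<comment> \<open>The same series cut at K + 1 and at K: because of the shift of index in
    \<open>funpow_dform\<close>, the terms under d need the longer sum and those under L the shorter
    one.\<close>
  have e1: "exp_iota G = (\<Sum>k<Suc K. ?f k ((iota ^^ k) G))" by (rule exp_iota_finite) (simp add: K)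
  have e0: "exp_iota G = (\<Sum>k<K. ?f k ((iota ^^ k) G))" by (rule exp_iota_finite) (simp add: K)
  have pw: "?f k ((iota ^^ k) G) \<in> sfuns" for k using G by (intro sfuns_scale sfuns_funpow smooth_const)
  have "exp_iota (dform G) = (\<Sum>k<Suc K. ?f k ((iota ^^ k) (dform G)))" by (rule exp_iota_finite) (simp add: K)
  also have "\<dots> = dform G + (\<Sum>k<K. ?f (Suc k) ((iota ^^ Suc k) (dform G)))"
    unfolding sum.lessThan_Suc_shift by (simp add: scale_one)
  \<comment> \<open>The factor k + 1 from \<open>funpow_dform\<close> turns 1/(k+1)! into 1/k!, the
    weight that belongs to the k-th power.\<close>
  also have "(\<Sum>k<K. ?f (Suc k) ((iota ^^ Suc k) (dform G)))
     = (\<Sum>k<K. ?f (Suc k) (dform ((iota ^^ Suc k) G)) + ?f k (lie ((iota ^^ k) G)))"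
    unfolding funpow_dform[OF G] scale_add scale_scale
    by (intro sum.cong refl arg_cong2[of _ _ _ _ "(+)"] arg_cong2[of _ _ _ _ scale])
       (simp_all del: of_nat_Suc add: fact_Suc)
  also have "dform G + \<dots> = (\<Sum>k<Suc K. ?f k (dform ((iota ^^ k) G))) + (\<Sum>k<K. ?f k (lie ((iota ^^ k) G)))"
    unfolding sum.lessThan_Suc_shift by (simp add: scale_one sum.distrib add.assoc)
  also have "(\<Sum>k<Suc K. ?f k (dform ((iota ^^ k) G))) = dform (exp_iota G)"
    unfolding e1 using pw G by (simp only: dform_sum) (simp add: dform_scale_const sfuns_funpow del: funpow.simps)
  also have "(\<Sum>k<K. ?f k (lie ((iota ^^ k) G))) = lie (exp_iota G)"
    unfolding e0 using pw G by (simp only: lie_sum) (simp add: lie_scale_const sfuns_funpow)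
  finally show ?thesis .
qed

end

section \<open>Calculus of smooth functions\<close>

text \<open>\<open>Euclidean_space n\<close> consists of the sequences that vanish from n on.
  Changing a coordinate below n stays inside, so along such a line relative openness can be tested
  in the whole function space.\<close>

lemma slice_in_open:
  assumes "openin (Euclidean_space n) U" "x \<in> U" "i < n"
  shows "\<forall>\<^sub>F t in nhds (x i). x(i := t) \<in> U"
proof -
  obtain W where W: "openin (powertop_real UNIV) W" "U = W \<inter> {x. \<forall>i\<ge>n. x i = 0}"
    using assms(1) by (auto simp: Euclidean_space_def openin_subtopology)
  then have "open W" by (simp add: euclidean_product_topology)
  have "continuous_on UNIV (\<lambda>t. x(i := t))"
  proof (rule continuous_on_coordinatewise_then_product)
    fix j show "continuous_on UNIV (\<lambda>t. (x(i := t)) j)" by (cases "j = i") auto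
  qed
  then have "open ((\<lambda>t. x(i := t)) -` W)" using \<open>open W\<close> by (metis open_vimage)
  moreover have "x i \<in> (\<lambda>t. x(i := t)) -` W" using assms(2) W(2) by auto
  ultimately have "\<forall>\<^sub>F t in nhds (x i). t \<in> (\<lambda>t. x(i := t)) -` W" by (rule eventually_nhds_in_open)
  then show ?thesis
    by eventually_elim (use assms W(2) in auto)
qed

lemma pd_cong:
  assumes "openin (Euclidean_space n) U" "x \<in> U" "i < n" "\<And>y. y \<in> U \<Longrightarrow> f y = g y"
  shows "pd i f x = pd i g x"
  unfolding pd_def
  by (rule deriv_cong_ev) (use slice_in_open[OF assms(1-3)] assms(4) in \<open>auto elim: eventually_mono\<close>)

text \<open>\<open>pd\<close> is total because \<open>deriv\<close> is, so the existence of the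
  derivative has to be recorded separately.\<close>

definition has_pd :: "nat \<Rightarrow> ((nat \<Rightarrow> real) \<Rightarrow> real) \<Rightarrow> (nat \<Rightarrow> real) \<Rightarrow> bool" where
  "has_pd i f x \<longleftrightarrow> (\<lambda>t. f (x(i := t))) differentiable at (x i)"

lemma has_pd_iff: "has_pd i f x \<longleftrightarrow> ((\<lambda>t. f (x(i := t))) has_real_derivative pd i f x) (at (x i))"
  unfolding has_pd_def pd_def by (rule DERIV_deriv_iff_real_differentiable[symmetric])

lemma pdiffI: "((\<lambda>t. f (x(i := t))) has_real_derivative d) (at (x i)) \<Longrightarrow> has_pd i f x \<and> pd i f x = d"
  unfolding has_pd_def pd_def by (metis DERIV_imp_deriv real_differentiable_def)

lemma has_pd_cong:
  assumes "openin (Euclidean_space n) U" "x \<in> U" "i < n" "\<And>y. y \<in> U \<Longrightarrow> f y = g y"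
    and "has_pd i f x"
  shows "has_pd i g x"
proof -
  have "((\<lambda>t. g (x(i := t))) has_real_derivative pd i f x) (at (x i))"
    using assms(5) unfolding has_pd_iff
    by (rule DERIV_cong_ev[OF refl _ refl, THEN iffD1, rotated])
       (use slice_in_open[OF assms(1-3)] assms(4) in \<open>auto elim: eventually_mono\<close>)
  then show ?thesis using pdiffI by blast
qed

lemma has_pd_add: "has_pd i f x \<Longrightarrow> has_pd i g x \<Longrightarrow>
    has_pd i (\<lambda>y. f y + g y) x \<and> pd i (\<lambda>y. f y + g y) x = pd i f x + pd i g x"
  by (intro pdiffI) (auto simp: has_pd_iff intro!: derivative_eq_intros)

lemma has_pd_mult: "has_pd i f x \<Longrightarrow> has_pd i g x \<Longrightarrow>
    has_pd i (\<lambda>y. f y * g y) x \<and> pd i (\<lambda>y. f y * g y) x = pd i f x * g x + f x * pd i g x"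
  by (intro pdiffI) (auto simp: has_pd_iff intro!: derivative_eq_intros)

lemma has_pd_const: "has_pd i (\<lambda>y. a) x \<and> pd i (\<lambda>y. a) x = 0"
  by (intro pdiffI) (auto intro!: derivative_eq_intros)

lemma has_pd_coord: "has_pd i (\<lambda>y. y j) x \<and> pd i (\<lambda>y. y j) x = (if i = j then 1 else 0)"
  by (intro pdiffI) (auto intro!: derivative_eq_intros)

lemma has_pd_compose:
  assumes "has_pd i f x" "h differentiable at (f x)"
  shows "has_pd i (\<lambda>y. h (f y)) x \<and> pd i (\<lambda>y. h (f y)) x = deriv h (f x) * pd i f x"
proof (rule pdiffI)
  have "(h has_real_derivative deriv h (f x)) (at (f (x(i := x i))))"
    using assms(2) by (simp add: DERIV_deriv_iff_real_differentiable)
  moreover have "((\<lambda>t. f (x(i := t))) has_real_derivative pd i f x) (at (x i))"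
    using assms(1) by (simp add: has_pd_iff)
  ultimately show "((\<lambda>t. h (f (x(i := t)))) has_real_derivative deriv h (f x) * pd i f x) (at (x i))"
    by (rule DERIV_chain2)
qed

text \<open>Differentiability by recursion on the order. With \<open>smooth_on\<close> the product
  and chain rules would have to be iterated along a list of indices; here each is applied once per
  induction step.\<close>

primrec ck_on :: "nat \<Rightarrow> (nat \<Rightarrow> real) set \<Rightarrow> nat \<Rightarrow> ((nat \<Rightarrow> real) \<Rightarrow> real) \<Rightarrow> bool" where
  "ck_on n U 0 f \<longleftrightarrow> continuous_on U f"
| "ck_on n U (Suc k) f \<longleftrightarrow> continuous_on U f \<and> (\<forall>i<n. (\<forall>x\<in>U. has_pd i f x) \<and> ck_on n U k (pd i f))"

lemma smooth_on_pd: "smooth_on n U f \<Longrightarrow> i < n \<Longrightarrow> smooth_on n U (pd i f)"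
  unfolding smooth_on_def
proof (intro allI impI)
  fix "is" assume a: "\<forall>is. set is \<subseteq> {..<n} \<longrightarrow>
      continuous_on U (foldr pd is f) \<and>
      (\<forall>x\<in>U. \<forall>i<n. (\<lambda>t. foldr pd is f (x(i := t))) differentiable at (x i))"
    "i < n" "set is \<subseteq> {..<n}"
  then show "continuous_on U (foldr pd is (pd i f)) \<and>
      (\<forall>x\<in>U. \<forall>j<n. (\<lambda>t. foldr pd is (pd i f) (x(j := t))) differentiable at (x j))"
    using a(1)[rule_format, of "is @ [i]"] by simp
qed

lemma smooth_on_cont: "smooth_on n U f \<Longrightarrow> continuous_on U f"
  and smooth_on_has_pd: "smooth_on n U f \<Longrightarrow> i < n \<Longrightarrow> x \<in> U \<Longrightarrow> has_pd i f x"
  unfolding smooth_on_def has_pd_def by (auto dest: spec[of _ "[]"])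

lemma smooth_on_iff_ck_on: "smooth_on n U f \<longleftrightarrow> (\<forall>k. ck_on n U k f)"
proof
  assume "smooth_on n U f"
  moreover have "smooth_on n U f \<Longrightarrow> ck_on n U k f" for k
    by (induction k arbitrary: f) (auto simp: smooth_on_cont smooth_on_has_pd smooth_on_pd)
  ultimately show "\<forall>k. ck_on n U k f" by blast
next
  assume "\<forall>k. ck_on n U k f"
  moreover have "continuous_on U (foldr pd is f) \<and> (\<forall>x\<in>U. \<forall>i<n. has_pd i (foldr pd is f) x)"
    if "\<forall>k. ck_on n U k f" "set is \<subseteq> {..<n}" for "is"
    using that
  \<comment> \<open>\<open>foldr\<close> applies the last index first, so the derivative that
    \<open>ck_on\<close> peels off from f sits at the end of the list.\<close>
  proof (induction "is" arbitrary: f rule: rev_induct)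
    case Nil
    then show ?case using spec[OF Nil(1), of "Suc 0"] by auto
  next
    case (snoc i "is")
    have "\<forall>k. ck_on n U k (pd i f)"
    proof
      fix k show "ck_on n U k (pd i f)" using spec[OF snoc.prems(1), of "Suc k"] snoc.prems(2) by auto
    qed
    then show ?case using snoc by auto
  qed
  ultimately show "smooth_on n U f" unfolding smooth_on_def has_pd_def by blast
qed

lemma ck_on_cont: "ck_on n U k f \<Longrightarrow> continuous_on U f"
  by (cases k) auto

lemma ck_on_Suc_imp: "ck_on n U (Suc k) f \<Longrightarrow> ck_on n U k f"
  by (induction k arbitrary: f) auto

lemma ck_on_subset: "ck_on n U k f \<Longrightarrow> V \<subseteq> U \<Longrightarrow> ck_on n V k f"
  by (induction k arbitrary: f) (auto intro: continuous_on_subset)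

text \<open>The rules for \<open>pd\<close> of sums and products are equations at points of
  differentiability, not between functions; this lemma allows their use under
  \<open>ck_on\<close>.\<close>

lemma ck_on_cong: "openin (Euclidean_space n) U \<Longrightarrow> (\<And>x. x \<in> U \<Longrightarrow> f x = g x) \<Longrightarrow> ck_on n U k f \<Longrightarrow> ck_on n U k g"
proof (induction k arbitrary: f g)
  case 0
  then show ?case using continuous_on_cong by fastforce
next
  case (Suc k)
  have "continuous_on U g" using Suc.prems continuous_on_cong by (metis ck_on.simps(2))
  moreover have "has_pd i g x" if "i < n" "x \<in> U" for i x
    using has_pd_cong[OF Suc.prems(1) that(2,1) Suc.prems(2)] Suc.prems(3) that by auto
  moreover have "ck_on n U k (pd i g)" if "i < n" for i
    by (rule Suc.IH[of "pd i f"]) (use Suc.prems that in \<open>auto intro: pd_cong\<close>)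
  ultimately show ?case by simp
qed

text \<open>The sets W are open only relative to the sequences vanishing from n on. As U lies among
  these, W can be replaced by an open set of the whole function space.\<close>

lemma continuous_on_local:
  fixes f :: "(nat \<Rightarrow> real) \<Rightarrow> real"
  assumes "\<And>x. x \<in> U \<Longrightarrow> \<exists>W. openin (Euclidean_space n) W \<and> x \<in> W \<and> continuous_on W f"
  shows "continuous_on U f"
  unfolding continuous_on_eq_continuous_within
proof
  fix x assume x: "x \<in> U"
  then obtain W where W: "openin (Euclidean_space n) W" "x \<in> W" "continuous_on W f" using assms by blast
  obtain W' where W': "openin (powertop_real UNIV) W'" "W = W' \<inter> {x. \<forall>i\<ge>n. x i = 0}"
    using W(1) by (auto simp: Euclidean_space_def openin_subtopology)
  then have "open W'" by (simp add: euclidean_product_topology)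
  have "U \<subseteq> {x. \<forall>i\<ge>n. x i = 0}"
    using assms openin_subset by (fastforce simp: topspace_Euclidean_space)
  then have "U \<inter> W' \<subseteq> W" using W' by auto
  then have "continuous (at x within U \<inter> W') f"
    using W(2,3) continuous_on_eq_continuous_within continuous_within_subset by blast
  moreover have "at x within U \<inter> W' = at x within U"
    using W(2) W'(2) \<open>open W'\<close> by (intro at_within_nhd[of x W']) auto
  ultimately show "continuous (at x within U) f" by (simp add: continuous_within)
qed

lemma ck_on_local:
  assumes "\<And>x. x \<in> U \<Longrightarrow> \<exists>W. openin (Euclidean_space n) W \<and> x \<in> W \<and> ck_on n W k f"
  shows "ck_on n U k f"
  using assms
proof (induction k arbitrary: f)
  case 0
  show ?case unfolding ck_on.simps by (rule continuous_on_local[of U n]) (use 0 in simp)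
next
  case (Suc k)
  have "continuous_on U f"
  proof (rule continuous_on_local[of U n])
    fix x assume "x \<in> U"
    from Suc.prems[OF this] show "\<exists>W. openin (Euclidean_space n) W \<and> x \<in> W \<and> continuous_on W f"
      unfolding ck_on.simps by blast
  qed
  moreover have "ck_on n U k (pd i f)" if "i < n" for i
  proof (rule Suc.IH)
    fix x assume "x \<in> U"
    from Suc.prems[OF this] show "\<exists>W. openin (Euclidean_space n) W \<and> x \<in> W \<and> ck_on n W k (pd i f)"
      unfolding ck_on.simps using that by blast
  qed
  moreover have "has_pd i f x" if i: "i < n" and x: "x \<in> U" for i x
    using Suc.prems[OF x] i unfolding ck_on.simps by blast
  ultimately show ?case unfolding ck_on.simps by blast
qed

lemma ck_on_const: "ck_on n U k (\<lambda>_. a)"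
proof (induction k arbitrary: a)
  case (Suc k)
  have "pd i (\<lambda>_. a) = (\<lambda>_. 0)" for i using has_pd_const by (auto simp: fun_eq_iff)
  then show ?case using Suc has_pd_const by auto
qed simp

lemma continuous_on_coord: "continuous_on U (\<lambda>x::nat \<Rightarrow> real. x j)"
  by (rule continuous_on_subset[OF continuous_on_product_coordinates subset_UNIV])

lemma ck_on_coord: "ck_on n U k (\<lambda>x. x j)"
proof (cases k)
  case (Suc k')
  have "pd i (\<lambda>x. x j) = (\<lambda>_. if i = j then 1 else 0)" for i using has_pd_coord by (auto simp: fun_eq_iff)
  then show ?thesis using Suc has_pd_coord ck_on_const by (simp add: continuous_on_coord)
next
  case 0
  then show ?thesis by (simp add: continuous_on_coord)
qed

lemma ck_on_add:
  assumes U: "openin (Euclidean_space n) U"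
  shows "ck_on n U k f \<Longrightarrow> ck_on n U k g \<Longrightarrow> ck_on n U k (\<lambda>x. f x + g x)"
proof (induction k arbitrary: f g)
  case (Suc k)
  have "ck_on n U k (pd i (\<lambda>x. f x + g x))" if "i < n" for i
    by (rule ck_on_cong[OF U, of "\<lambda>x. pd i f x + pd i g x"])
       (use Suc that has_pd_add in \<open>auto\<close>)
  then show ?case using Suc.prems has_pd_add by (auto intro: continuous_on_add)
qed (auto intro: continuous_on_add)

lemma ck_on_mult:
  assumes U: "openin (Euclidean_space n) U"
  shows "ck_on n U k f \<Longrightarrow> ck_on n U k g \<Longrightarrow> ck_on n U k (\<lambda>x. f x * g x)"
proof (induction k arbitrary: f g)
  case (Suc k)
  have "ck_on n U k (pd i (\<lambda>x. f x * g x))" if "i < n" for i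
  proof (rule ck_on_cong[OF U, of "\<lambda>x. pd i f x * g x + f x * pd i g x"])
    show "ck_on n U k (\<lambda>x. pd i f x * g x + f x * pd i g x)"
      by (intro ck_on_add[OF U] Suc.IH ck_on_Suc_imp[OF Suc.prems(1)] ck_on_Suc_imp[OF Suc.prems(2)])
         (use Suc.prems that in simp_all)
  qed (use Suc.prems that has_pd_mult in auto)
  then show ?case using Suc.prems has_pd_mult by (auto intro: continuous_on_mult)
qed (auto intro: continuous_on_mult)

definition rsmooth :: "(real \<Rightarrow> real) \<Rightarrow> bool" where
  "rsmooth h \<longleftrightarrow> (\<forall>k x. ((deriv ^^ k) h) differentiable at x)"

lemma rsmooth_deriv: "rsmooth h \<Longrightarrow> rsmooth (deriv h)"
  unfolding rsmooth_def
proof (intro allI)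
  fix k x assume "\<forall>k x. (deriv ^^ k) h differentiable at x"
  then have "(deriv ^^ Suc k) h differentiable at x" by blast
  then show "(deriv ^^ k) (deriv h) differentiable at x" by (simp only: funpow_Suc_right o_apply)
qed

lemma rsmooth_diff: "rsmooth h \<Longrightarrow> h differentiable at x"
  unfolding rsmooth_def by (drule spec[of _ 0]) simp

lemma rsmooth_cont:
  assumes "rsmooth h" "continuous_on U f" shows "continuous_on U (\<lambda>x. h (f x))"
proof -
  have "continuous_on UNIV h"
    using rsmooth_diff[OF assms(1)] by (simp add: continuous_on_eq_continuous_at differentiable_imp_continuous_within)
  then show ?thesis by (rule continuous_on_compose2[OF _ assms(2) subset_UNIV])
qed

lemma ck_on_compose:
  assumes U: "openin (Euclidean_space n) U"
  shows "rsmooth h \<Longrightarrow> ck_on n U k f \<Longrightarrow> ck_on n U k (\<lambda>x. h (f x))"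
proof (induction k arbitrary: h)
  case 0
  then show ?case by (simp add: rsmooth_cont)
next
  case (Suc k)
  have "continuous_on U (\<lambda>x. h (f x))" by (rule rsmooth_cont[OF Suc.prems(1) ck_on_cont[OF Suc.prems(2)]])
  moreover have "ck_on n U k (pd i (\<lambda>x. h (f x)))" if "i < n" for i
  proof (rule ck_on_cong[OF U, of "\<lambda>x. deriv h (f x) * pd i f x"])
    show "ck_on n U k (\<lambda>x. deriv h (f x) * pd i f x)"
    proof (rule ck_on_mult[OF U])
      show "ck_on n U k (\<lambda>x. deriv h (f x))"
        by (rule Suc.IH[OF rsmooth_deriv[OF Suc.prems(1)] ck_on_Suc_imp[OF Suc.prems(2)]])
      show "ck_on n U k (pd i f)" using Suc.prems(2) that by simp
    qed
    fix x assume "x \<in> U"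
    then have "has_pd i f x" using Suc.prems(2) that by simp
    from has_pd_compose[OF this rsmooth_diff[OF Suc.prems(1)]]
    show "deriv h (f x) * pd i f x = pd i (\<lambda>x. h (f x)) x" by (simp only:)
  qed
  moreover have "has_pd i (\<lambda>x. h (f x)) x" if "i < n" "x \<in> U" for i x
  proof -
    have "has_pd i f x" using Suc.prems(2) that by simp
    from has_pd_compose[OF this rsmooth_diff[OF Suc.prems(1)]] show ?thesis ..
  qed
  ultimately show ?case unfolding ck_on.simps by blast
qed

lemma smooth_on_const: "smooth_on n U (\<lambda>_. a)"
  unfolding smooth_on_iff_ck_on by (intro allI ck_on_const)

lemma smooth_on_coord: "smooth_on n U (\<lambda>x. x j)"
  unfolding smooth_on_iff_ck_on by (intro allI ck_on_coord)

lemma smooth_on_add: "openin (Euclidean_space n) U \<Longrightarrow> smooth_on n U f \<Longrightarrow> smooth_on n U g \<Longrightarrow>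
    smooth_on n U (\<lambda>x. f x + g x)"
  unfolding smooth_on_iff_ck_on by (intro allI ck_on_add) (erule spec | assumption)+

lemma smooth_on_mult: "openin (Euclidean_space n) U \<Longrightarrow> smooth_on n U f \<Longrightarrow> smooth_on n U g \<Longrightarrow>
    smooth_on n U (\<lambda>x. f x * g x)"
  unfolding smooth_on_iff_ck_on by (intro allI ck_on_mult) (erule spec | assumption)+

lemma smooth_on_compose: "openin (Euclidean_space n) U \<Longrightarrow> rsmooth h \<Longrightarrow> smooth_on n U f \<Longrightarrow>
    smooth_on n U (\<lambda>x. h (f x))"
  unfolding smooth_on_iff_ck_on by (rule allI, erule (1) ck_on_compose, erule spec)

lemma smooth_on_cong: "openin (Euclidean_space n) U \<Longrightarrow> (\<And>x. x \<in> U \<Longrightarrow> f x = g x) \<Longrightarrow>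
    smooth_on n U f \<Longrightarrow> smooth_on n U g"
  unfolding smooth_on_iff_ck_on by (rule allI, rule ck_on_cong, assumption, assumption, erule spec)

lemma smooth_on_subset: "smooth_on n U f \<Longrightarrow> V \<subseteq> U \<Longrightarrow> smooth_on n V f"
  unfolding smooth_on_iff_ck_on by (rule allI, rule ck_on_subset, erule spec)

lemma smooth_on_local:
  assumes "\<And>x. x \<in> U \<Longrightarrow> \<exists>W. openin (Euclidean_space n) W \<and> x \<in> W \<and> smooth_on n W f"
  shows "smooth_on n U f"
  unfolding smooth_on_iff_ck_on
proof
  fix k show "ck_on n U k f"
  proof (rule ck_on_local)
    fix x assume "x \<in> U"
    from assms[OF this] show "\<exists>W. openin (Euclidean_space n) W \<and> x \<in> W \<and> ck_on n W k f"
      unfolding smooth_on_iff_ck_on by blast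
  qed
qed

lemma smooth_on_prod: "openin (Euclidean_space n) U \<Longrightarrow> (\<And>i. i \<in> I \<Longrightarrow> smooth_on n U (f i)) \<Longrightarrow>
    smooth_on n U (\<lambda>x. \<Prod>i\<in>I. f i x)"
  by (induction I rule: infinite_finite_induct) (simp_all add: smooth_on_const smooth_on_mult)

section \<open>Flat functions and smooth cutoffs\<close>

text \<open>The polynomial makes this family of flat functions closed under differentiation.\<close>

definition flat :: "real poly \<Rightarrow> real \<Rightarrow> real" where
  "flat P t = (if t > 0 then poly P (1 / t) * exp (- (1 / t)) else 0)"

lemma poly_times_exp_tendsto_0: "((\<lambda>s. poly P s * exp (- s)) \<longlongrightarrow> (0::real)) at_top"
proof -
  have "((\<lambda>s. \<Sum>i\<le>degree P. coeff P i * (s ^ i / exp s)) \<longlongrightarrow> (\<Sum>i\<le>degree P. coeff P i * 0)) at_top"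
    by (intro tendsto_intros tendsto_power_div_exp_0)
  then show ?thesis
    by (simp add: poly_altdef exp_minus field_simps sum_divide_distrib)
qed

text \<open>With s = 1/t one has ds/dt = -s^2, so the derivative of P(s) exp(-s) is s^2 (P(s) -
  P'(s)) exp(-s). This is where the polynomial factor comes from.\<close>

lemma flat_has_derivative:
  "(flat P has_real_derivative flat ([:0, 0, 1:] * (P - pderiv P)) t) (at t)"
proof -
  consider "t > 0" | "t < 0" | "t = 0" by linarith
  then show ?thesis
  proof cases
    case 1
    have "((\<lambda>t. poly P (1 / t) * exp (- (1 / t))) has_real_derivative
      flat ([:0, 0, 1:] * (P - pderiv P)) t) (at t)"
      using 1 by (auto intro!: derivative_eq_intros simp: flat_def field_simps power2_eq_square)
    then show ?thesis
      by (rule DERIV_cong_ev[OF refl _ refl, THEN iffD1, rotated])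
         (use eventually_nhds_in_open[of "{0<..}" t] 1 in \<open>auto elim!: eventually_mono simp: flat_def\<close>)
  next
    case 2
    have "((\<lambda>t. 0) has_real_derivative flat ([:0, 0, 1:] * (P - pderiv P)) t) (at t)"
      using 2 by (simp add: flat_def)
    then show ?thesis
      by (rule DERIV_cong_ev[OF refl _ refl, THEN iffD1, rotated])
         (use eventually_nhds_in_open[of "{..<0}" t] 2 in \<open>auto elim!: eventually_mono simp: flat_def\<close>)
  next
    case 3
    have "((\<lambda>h. flat P h / h) \<longlongrightarrow> 0) (at_right 0)"
    proof (rule Lim_transform_eventually)
      have "filterlim (\<lambda>h::real. 1 / h) at_top (at_right 0)"
        using filterlim_inverse_at_top_right by (simp add: inverse_eq_divide)
      \<comment> \<open>Division by h multiplies the polynomial by s = 1/h, which is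
        \<open>pCons 0 P\<close>.\<close>
      from filterlim_compose[OF poly_times_exp_tendsto_0[of "pCons 0 P"] this]
      show "((\<lambda>h. poly (pCons 0 P) (1 / h) * exp (- (1 / h))) \<longlongrightarrow> 0) (at_right 0)" .
      show "\<forall>\<^sub>F h in at_right 0. poly (pCons 0 P) (1 / h) * exp (- (1 / h)) = flat P h / h"
        by (auto simp: eventually_at_filter flat_def)
    qed
    moreover have "((\<lambda>h. flat P h / h) \<longlongrightarrow> 0) (at_left 0)"
      by (rule Lim_transform_eventually[of "\<lambda>_. 0"]) (auto simp: eventually_at_filter flat_def)
    ultimately have "((\<lambda>h. flat P h / h) \<longlongrightarrow> 0) (at 0)" by (simp add: filterlim_split_at_real filterlim_at_split)
    then show ?thesis using 3 by (simp add: DERIV_def flat_def)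
  qed
qed

lemma rsmooth_flat: "rsmooth (flat P)"
proof -
  have "\<exists>Q. (deriv ^^ k) (flat P) = flat Q" for k
  proof (induction k)
    case (Suc k)
    then obtain Q where "(deriv ^^ k) (flat P) = flat Q" by blast
    moreover have "deriv (flat Q) = flat ([:0, 0, 1:] * (Q - pderiv Q))"
      by (rule ext, rule DERIV_imp_deriv, rule flat_has_derivative)
    ultimately have "(deriv ^^ Suc k) (flat P) = flat ([:0, 0, 1:] * (Q - pderiv Q))"
      by (simp only: funpow.simps o_apply)
    then show ?case by blast
  qed auto
  moreover have "flat Q differentiable at x" for Q x
    using flat_has_derivative[of Q x] unfolding real_differentiable_def by (rule exI)
  ultimately show ?thesis unfolding rsmooth_def by (intro allI) (metis (full_types))
qed

text \<open>
  The outer \<open>flat 1\<close> is constant for \<open>t\<^sup>2 \<le> 1\<close> and vanishes once \<open>t\<^sup>2 - 1 \<ge> 3\<close>; unlike a quotient of two bumps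
  this needs no smoothness of reciprocals.
\<close>

definition cutoff :: "real \<Rightarrow> real" where
  "cutoff t = flat 1 (flat 1 3 - flat 1 (t\<^sup>2 - 1)) / flat 1 (flat 1 3)"

lemma flat_1_pos: "t > 0 \<Longrightarrow> flat 1 t > 0" and flat_1_mono: "0 < s \<Longrightarrow> s \<le> t \<Longrightarrow> flat 1 s \<le> flat 1 t"
  by (simp_all add: flat_def frac_le)

lemma cutoff_eq_1: assumes "\<bar>t\<bar> \<le> 1" shows "cutoff t = 1"
proof -
  have "t\<^sup>2 \<le> 1" using assms by (simp add: abs_square_le_1)
  then have "flat 1 (t\<^sup>2 - 1) = 0" by (simp add: flat_def)
  moreover have "flat 1 (flat 1 3) > 0" by (intro flat_1_pos) simp
  ultimately show ?thesis by (simp add: cutoff_def)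
qed

lemma cutoff_eq_0: assumes "2 \<le> \<bar>t\<bar>" shows "cutoff t = 0"
proof -
  have "2\<^sup>2 \<le> t\<^sup>2" using power_mono[OF assms, of 2] by simp
  then have "flat 1 3 \<le> flat 1 (t\<^sup>2 - 1)" by (intro flat_1_mono) auto
  then show ?thesis by (simp add: cutoff_def flat_def[of _ "flat 1 3 - flat 1 (t\<^sup>2 - 1)"])
qed

lemma smooth_on_cutoff:
  assumes U: "openin (Euclidean_space n) U" and f: "smooth_on n U f"
  shows "smooth_on n U (\<lambda>x. cutoff (f x))"
proof -
  note s1 = smooth_on_add[OF U smooth_on_mult[OF U f f] smooth_on_const[of n U "- 1"]]
  note s2 = smooth_on_compose[OF U rsmooth_flat[of 1] s1]
  note s3 = smooth_on_add[OF U smooth_on_const[of n U "flat 1 3"] smooth_on_mult[OF U smooth_on_const[of n U "- 1"] s2]]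
  note s4 = smooth_on_compose[OF U rsmooth_flat[of 1] s3]
  have "cutoff t = inverse (flat 1 (flat 1 3)) * flat 1 (flat 1 3 + - 1 * flat 1 (t * t + - 1))" for t
    by (simp add: cutoff_def power2_eq_square field_simps)
  with smooth_on_mult[OF U smooth_on_const[of n U "inverse (flat 1 (flat 1 3))"] s4]
  show ?thesis by (simp only:)
qed

section \<open>Boxes, the mean value theorem along coordinate edges, and the chain rule\<close>

lemma open_contains_box:
  assumes U: "openin (Euclidean_space n) U" and x: "x \<in> U"
  obtains e where "e > 0" "\<And>y. (\<forall>i<n. \<bar>y i - x i\<bar> \<le> e) \<Longrightarrow> (\<forall>i\<ge>n. y i = 0) \<Longrightarrow> y \<in> U"
proof -
  obtain W where W: "openin (powertop_real UNIV) W" "U = W \<inter> {x. \<forall>i\<ge>n. x i = 0}"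
    using U by (auto simp: Euclidean_space_def openin_subtopology)
  obtain X where X: "x \<in> (\<Pi>\<^sub>E i\<in>UNIV. X i)" "\<And>i. open (X i)" "(\<Pi>\<^sub>E i\<in>UNIV. X i) \<subseteq> W"
    using product_topology_open_contains_basis[OF W(1), of x] x W(2) by (metis IntD1 open_openin)
  have "\<exists>e>0. cball (x i) e \<subseteq> X i" for i
  proof -
    have "x i \<in> X i" using X(1) by (simp add: PiE_iff)
    then show ?thesis using open_contains_cball X(2)[of i] by blast
  qed
  then obtain e where e: "\<And>i. e i > 0" "\<And>i. cball (x i) (e i) \<subseteq> X i" by metis
  \<comment> \<open>Only finitely many coordinates vary, so the minimum of their radii is positive;
    the element 1 covers n = 0.\<close>
  define d where "d = Min (insert 1 (e ` {..<n}))"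
  have d: "d > 0" "i < n \<Longrightarrow> d \<le> e i" for i unfolding d_def using e(1) by auto
  show ?thesis
  proof (rule that[OF d(1)])
    fix y assume y: "\<forall>i<n. \<bar>y i - x i\<bar> \<le> d" "\<forall>i\<ge>n. y i = (0::real)"
    have "y i \<in> X i" for i
    proof (cases "i < n")
      case True
      then have "\<bar>y i - x i\<bar> \<le> e i" using y(1) d(2)[OF True] by fastforce
      then have "y i \<in> cball (x i) (e i)" by (simp add: dist_real_def abs_minus_commute)
      then show ?thesis using e(2) by blast
    next
      case False
      then have "y i = x i" using y(2) x W(2) by simp
      then show ?thesis using X(1) by (simp add: PiE_iff)
    qed
    then have "y \<in> (\<Pi>\<^sub>E i\<in>UNIV. X i)" by (simp add: PiE_iff)
    then have "y \<in> W" using X(3) by blast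
    then show "y \<in> U" unfolding W(2) using y(2) by blast
  qed
qed

lemma tendsto_fun_coordinatewise:
  fixes g :: "'a \<Rightarrow> nat \<Rightarrow> real"
  assumes "\<And>i. ((\<lambda>t. g t i) \<longlongrightarrow> l i) F"
  shows "(g \<longlongrightarrow> l) F"
proof -
  have "limitin (product_topology (\<lambda>i. euclidean) UNIV) g l F"
    using assms by (simp add: limitin_componentwise)
  then show ?thesis by (simp add: euclidean_product_topology)
qed

text \<open>Only partial derivatives are at hand, so the increment of f is split along a path that
  changes one coordinate at a time, with the one-variable mean value theorem on each edge.\<close>

lemma telescope_partial_derivatives:
  assumes f: "\<And>k x. k < n \<Longrightarrow> (\<forall>i<n. \<bar>x i - a i\<bar> \<le> e) \<Longrightarrow> (\<forall>i\<ge>n. x i = 0) \<Longrightarrow> has_pd k f x"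
    and a: "\<And>i. i \<ge> n \<Longrightarrow> a i = 0"
    and y: "\<And>i. i < n \<Longrightarrow> \<bar>y i - a i\<bar> \<le> e" "\<And>i. i \<ge> n \<Longrightarrow> y i = 0"
  shows "\<exists>\<xi>. (\<forall>k<n. \<forall>i. \<bar>\<xi> k i - a i\<bar> \<le> \<bar>y i - a i\<bar>) \<and>
    f y - f a = (\<Sum>k<n. pd k f (\<xi> k) * (y k - a k))"
proof -
  \<comment> \<open>The corners of the path: the first k coordinates are already those of y, the
    others still those of a.\<close>
  define z where "z k = (\<lambda>i. if i < k then y i else a i)" for k
  have step: "\<exists>\<xi>. (\<forall>i. \<bar>\<xi> i - a i\<bar> \<le> \<bar>y i - a i\<bar>) \<and> f (z (Suc k)) - f (z k) = pd k f \<xi> * (y k - a k)"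
    if k: "k < n" for k
  proof -
    have zs: "(z k)(k := y k) = z (Suc k)" "(z k)(k := a k) = z k"
      by (auto simp: z_def less_Suc_eq)
    have in_box: "\<bar>((z k)(k := s)) i - a i\<bar> \<le> \<bar>y i - a i\<bar>" if "\<bar>s - a k\<bar> \<le> \<bar>y k - a k\<bar>" for s i
      using that by (auto simp: z_def)
    have der: "((\<lambda>t. f ((z k)(k := t))) has_real_derivative pd k f ((z k)(k := s))) (at s)"
      if s: "\<bar>s - a k\<bar> \<le> \<bar>y k - a k\<bar>" for s
    proof -
      have "has_pd k f ((z k)(k := s))"
      proof (rule f[OF k])
        show "\<forall>i<n. \<bar>((z k)(k := s)) i - a i\<bar> \<le> e" using in_box[OF s] y(1) order_trans by blast
        show "\<forall>i\<ge>n. ((z k)(k := s)) i = 0" using k a y(2) by (auto simp: z_def)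
      qed
      then show ?thesis by (simp add: has_pd_iff)
    qed
    have "\<exists>s. \<bar>s - a k\<bar> \<le> \<bar>y k - a k\<bar> \<and>
      f ((z k)(k := y k)) - f ((z k)(k := a k)) = pd k f ((z k)(k := s)) * (y k - a k)"
    proof (cases "y k" "a k" rule: linorder_cases)
      case less
      have "\<exists>s. y k < s \<and> s < a k \<and> f ((z k)(k := a k)) - f ((z k)(k := y k)) = (a k - y k) * pd k f ((z k)(k := s))"
        by (rule MVT2[OF less]) (use less in \<open>intro der; simp\<close>)
      then obtain s where s: "y k < s" "s < a k"
        "f ((z k)(k := a k)) - f ((z k)(k := y k)) = (a k - y k) * pd k f ((z k)(k := s))" by blast
      show ?thesis using s by (intro exI[of _ s]) (simp add: algebra_simps)
    next
      case greater
      have "\<exists>s. a k < s \<and> s < y k \<and> f ((z k)(k := y k)) - f ((z k)(k := a k)) = (y k - a k) * pd k f ((z k)(k := s))"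
        by (rule MVT2[OF greater]) (use greater in \<open>intro der; simp\<close>)
      then obtain s where s: "a k < s" "s < y k"
        "f ((z k)(k := y k)) - f ((z k)(k := a k)) = (y k - a k) * pd k f ((z k)(k := s))" by blast
      show ?thesis using s by (intro exI[of _ s]) (simp add: algebra_simps)
    qed auto
    then obtain s where s: "\<bar>s - a k\<bar> \<le> \<bar>y k - a k\<bar>"
      "f ((z k)(k := y k)) - f ((z k)(k := a k)) = pd k f ((z k)(k := s)) * (y k - a k)" by blast
    show ?thesis
      using in_box[OF s(1)] s(2) unfolding zs by (intro exI[of _ "(z k)(k := s)"]) blast
  qed
  then obtain \<xi> where \<xi>: "\<And>k. k < n \<Longrightarrow> (\<forall>i. \<bar>\<xi> k i - a i\<bar> \<le> \<bar>y i - a i\<bar>) \<and>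
    f (z (Suc k)) - f (z k) = pd k f (\<xi> k) * (y k - a k)" by metis
  have "z n = y" "z 0 = a" using a y(2) by (auto simp: z_def fun_eq_iff)
  then have "f y - f a = (\<Sum>k<n. f (z (Suc k)) - f (z k))"
    using sum_lessThan_telescope[of "\<lambda>k. f (z k)" n] by simp
  also have "\<dots> = (\<Sum>k<n. pd k f (\<xi> k) * (y k - a k))" by (intro sum.cong refl) (use \<xi> in simp)
  finally show ?thesis using \<xi> by blast
qed

text \<open>Differentiability along the curve comes from the continuity of the partial derivatives:
  the intermediate points are in each coordinate at most as far from g t0 as g t is, hence tend to g
  t0 with t.\<close>

lemma curve_chain_rule:
  assumes U: "openin (Euclidean_space n) U"
    and f: "\<And>k x. k < n \<Longrightarrow> x \<in> U \<Longrightarrow> has_pd k f x" "\<And>k. k < n \<Longrightarrow> continuous_on U (pd k f)"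
    and g: "\<And>k. k < n \<Longrightarrow> ((\<lambda>t. g t k) has_real_derivative g' k) (at t0)"
    and gU: "\<forall>\<^sub>F t in nhds t0. g t \<in> U"
  shows "((\<lambda>t. f (g t)) has_real_derivative (\<Sum>k<n. pd k f (g t0) * g' k)) (at t0)"
proof -
  let ?a = "g t0"
  have a: "?a \<in> U" using gU eventually_nhds_x_imp_x by blast
  have U0: "x i = 0" if "x \<in> U" "i \<ge> n" for x i
    using openin_subset[OF U] that by (auto simp: topspace_Euclidean_space)
  obtain e where e: "e > 0" "\<And>y. (\<forall>i<n. \<bar>y i - ?a i\<bar> \<le> e) \<Longrightarrow> (\<forall>i\<ge>n. y i = 0) \<Longrightarrow> y \<in> U"
    using open_contains_box[OF U a] by blast
  define good where "good t \<longleftrightarrow> g t \<in> U \<and> (\<forall>i<n. \<bar>g t i - ?a i\<bar> \<le> e)" for t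
  have gt: "((\<lambda>t. g t i) \<longlongrightarrow> ?a i) (at t0)" if "i < n" for i
    using DERIV_isCont[OF g[OF that]] by (simp add: isCont_def)
  have "\<forall>\<^sub>F t in at t0. \<forall>i\<in>{..<n}. \<bar>g t i - ?a i\<bar> \<le> e"
  proof (rule eventually_ball_finite)
    show "\<forall>i\<in>{..<n}. \<forall>\<^sub>F t in at t0. \<bar>g t i - ?a i\<bar> \<le> e"
    proof
      fix i assume "i \<in> {..<n}"
      then have "\<forall>\<^sub>F t in at t0. dist (g t i) (?a i) < e" using tendstoD[OF gt e(1)] by simp
      then show "\<forall>\<^sub>F t in at t0. \<bar>g t i - ?a i\<bar> \<le> e"
        by eventually_elim (simp add: dist_real_def)
    qed
  qed simp
  moreover have "\<forall>\<^sub>F t in at t0. g t \<in> U" using gU by (simp add: eventually_at_filter eventually_mono)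
  ultimately have good: "\<forall>\<^sub>F t in at t0. good t" by eventually_elim (simp add: good_def)
  have "\<exists>\<xi>. (\<forall>k<n. \<forall>i. \<bar>\<xi> k i - ?a i\<bar> \<le> \<bar>g t i - ?a i\<bar>) \<and>
    f (g t) - f ?a = (\<Sum>k<n. pd k f (\<xi> k) * (g t k - ?a k))" if "good t" for t
  proof (rule telescope_partial_derivatives[where e = e])
    show "has_pd k f x" if "k < n" "\<forall>i<n. \<bar>x i - ?a i\<bar> \<le> e" "\<forall>i\<ge>n. x i = 0" for k x
      by (rule f(1)[OF that(1) e(2)[OF that(2,3)]])
    show "?a i = 0" "g t i = 0" if "n \<le> i" for i
      using U0 a that \<open>good t\<close> by (simp_all add: good_def)
    show "\<bar>g t i - ?a i\<bar> \<le> e" if "i < n" for i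
      using that \<open>good t\<close> by (simp add: good_def)
  qed
  \<comment> \<open>Intermediate points exist for t near t0 only; with the implication inside, they
    can be chosen as a function of all t, of which a limit can be taken.\<close>
  then have "\<forall>t. \<exists>\<xi>. good t \<longrightarrow> (\<forall>k<n. \<forall>i. \<bar>\<xi> k i - ?a i\<bar> \<le> \<bar>g t i - ?a i\<bar>) \<and>
    f (g t) - f ?a = (\<Sum>k<n. pd k f (\<xi> k) * (g t k - ?a k))" by blast
  from choice[OF this] obtain \<xi> where "\<forall>t. good t \<longrightarrow> (\<forall>k<n. \<forall>i. \<bar>\<xi> t k i - ?a i\<bar> \<le> \<bar>g t i - ?a i\<bar>) \<and>
    f (g t) - f ?a = (\<Sum>k<n. pd k f (\<xi> t k) * (g t k - ?a k))" by blast
  then have \<xi>: "\<And>t k i. good t \<Longrightarrow> k < n \<Longrightarrow> \<bar>\<xi> t k i - ?a i\<bar> \<le> \<bar>g t i - ?a i\<bar>"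
    "\<And>t. good t \<Longrightarrow> f (g t) - f ?a = (\<Sum>k<n. pd k f (\<xi> t k) * (g t k - ?a k))" by blast+
  have lim: "((\<lambda>t. pd k f (\<xi> t k)) \<longlongrightarrow> pd k f ?a) (at t0)" if k: "k < n" for k
  proof (rule continuous_on_tendsto_compose[OF f(2)[OF k]])
    show "((\<lambda>t. \<xi> t k) \<longlongrightarrow> ?a) (at t0)"
    proof (rule tendsto_fun_coordinatewise)
      fix i
      have le: "\<forall>\<^sub>F t in at t0. norm (\<xi> t k i - ?a i) \<le> \<bar>g t i - ?a i\<bar>"
        using good by eventually_elim (use \<xi>(1) k in simp)
      have "((\<lambda>t. \<bar>g t i - ?a i\<bar>) \<longlongrightarrow> 0) (at t0)"
      proof (cases "i < n")
        case True
        have "((\<lambda>t. \<bar>g t i - ?a i\<bar>) \<longlongrightarrow> \<bar>?a i - ?a i\<bar>) (at t0)"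
          by (intro tendsto_intros gt True)
        then show ?thesis by simp
      next
        case False
        have "\<forall>\<^sub>F t in at t0. 0 = \<bar>g t i - ?a i\<bar>"
          using good
        proof eventually_elim
          case (elim t)
          then have "g t i = 0" "?a i = 0" using U0 a False by (simp_all add: good_def)
          then show ?case by simp
        qed
        then show ?thesis by (rule Lim_transform_eventually[OF tendsto_const])
      qed
      from Lim_null_comparison[OF le this] show "((\<lambda>t. \<xi> t k i) \<longlongrightarrow> ?a i) (at t0)"
        by (simp add: LIM_zero_iff)
    qed
    show "?a \<in> U" by (rule a)
    show "\<forall>\<^sub>F t in at t0. \<xi> t k \<in> U"
      using good
    proof eventually_elim
      case (elim t)
      show ?case
      proof (rule e(2))
        show "\<forall>i<n. \<bar>\<xi> t k i - ?a i\<bar> \<le> e" using \<xi>(1)[OF elim k] elim order_trans unfolding good_def by blast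
        show "\<forall>i\<ge>n. \<xi> t k i = 0"
        proof (intro allI impI)
          fix i assume i: "n \<le> i"
          have "g t i = 0" "?a i = 0" using elim a U0 i by (auto simp: good_def)
          then show "\<xi> t k i = 0" using \<xi>(1)[OF elim k, of i] by simp
        qed
      qed
    qed
  qed
  have "((\<lambda>t. \<Sum>k<n. pd k f (\<xi> t k) * ((g t k - ?a k) / (t - t0))) \<longlongrightarrow> (\<Sum>k<n. pd k f ?a * g' k)) (at t0)"
    by (intro tendsto_sum tendsto_mult lim) (use g in \<open>auto simp: has_field_derivative_iff\<close>)
  moreover have "\<forall>\<^sub>F t in at t0. (\<Sum>k<n. pd k f (\<xi> t k) * ((g t k - ?a k) / (t - t0))) = (f (g t) - f ?a) / (t - t0)"
    using good by eventually_elim (simp add: \<xi>(2) sum_divide_distrib)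
  ultimately have "((\<lambda>t. (f (g t) - f ?a) / (t - t0)) \<longlongrightarrow> (\<Sum>k<n. pd k f ?a * g' k)) (at t0)"
    by (rule Lim_transform_eventually)
  then show ?thesis by (simp add: has_field_derivative_iff)
qed

lemma continuous_on_Euclidean_compose:
  fixes \<phi> :: "(nat \<Rightarrow> real) \<Rightarrow> nat \<Rightarrow> real"
  assumes "openin (Euclidean_space n) U" "continuous_on U f" "\<And>x. x \<in> V \<Longrightarrow> \<phi> x \<in> U"
    and "\<And>j. j < n \<Longrightarrow> continuous_on V (\<lambda>x. \<phi> x j)"
  shows "continuous_on V (\<lambda>x. f (\<phi> x))"
proof (rule continuous_on_compose2[OF assms(2)])
  show "continuous_on V \<phi>"
  proof (rule continuous_on_coordinatewise_then_product)
    fix i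
    show "continuous_on V (\<lambda>x. \<phi> x i)"
    proof (cases "i < n")
      case False
      have "\<phi> x i = 0" if "x \<in> V" for x
        using openin_subset[OF assms(1)] assms(3)[OF that] False by (auto simp: topspace_Euclidean_space)
      then show ?thesis by (intro continuous_on_eq[OF continuous_on_const[of V 0]]) simp
    qed (rule assms(4))
  qed
qed (use assms(3) in auto)

text \<open>Only the order of the composite is inducted on. As f stays smooth, its partial
  derivatives satisfy the hypothesis again, and the chain rule expresses the derivatives of the
  composite through them.\<close>

lemma ck_on_chain:
  assumes U: "openin (Euclidean_space n) U" and V: "openin (Euclidean_space n) V"
    and \<phi>: "\<And>x. x \<in> V \<Longrightarrow> \<phi> x \<in> U" "\<And>j. j < n \<Longrightarrow> smooth_on n V (\<lambda>x. \<phi> x j)"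
  shows "smooth_on n U f \<Longrightarrow> ck_on n V k (\<lambda>x. f (\<phi> x))"
proof (induction k arbitrary: f)
  case 0
  show ?case unfolding ck_on.simps
    by (rule continuous_on_Euclidean_compose[OF U smooth_on_cont[OF 0] \<phi>(1) smooth_on_cont[OF \<phi>(2)]])
next
  case (Suc k)
  note IH = Suc.IH and f = Suc.prems
  have der: "has_pd i (\<lambda>x. f (\<phi> x)) x \<and> pd i (\<lambda>x. f (\<phi> x)) x = (\<Sum>j<n. pd j f (\<phi> x) * pd i (\<lambda>x. \<phi> x j) x)"
    if i: "i < n" and x: "x \<in> V" for i x
  proof (rule pdiffI)
    have "((\<lambda>t. f (\<phi> (x(i := t)))) has_real_derivative
      (\<Sum>j<n. pd j f (\<phi> (x(i := x i))) * pd i (\<lambda>x. \<phi> x j) x)) (at (x i))"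
    proof (rule curve_chain_rule[OF U])
      show "\<And>k x. k < n \<Longrightarrow> x \<in> U \<Longrightarrow> has_pd k f x" by (rule smooth_on_has_pd[OF Suc.prems])
      show "\<And>k. k < n \<Longrightarrow> continuous_on U (pd k f)" by (rule smooth_on_cont[OF smooth_on_pd[OF Suc.prems]])
      show "((\<lambda>t. \<phi> (x(i := t)) k) has_real_derivative pd i (\<lambda>x. \<phi> x k) x) (at (x i))" if "k < n" for k
        using smooth_on_has_pd[OF \<phi>(2)[OF that] i x] by (simp only: has_pd_iff)
      show "\<forall>\<^sub>F t in nhds (x i). \<phi> (x(i := t)) \<in> U"
        using slice_in_open[OF V x i] by eventually_elim (rule \<phi>(1))
    qed
    then show "((\<lambda>t. f (\<phi> (x(i := t)))) has_real_derivative
      (\<Sum>j<n. pd j f (\<phi> x) * pd i (\<lambda>x. \<phi> x j) x)) (at (x i))" by simp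
  qed
  have "ck_on n V k (pd i (\<lambda>x. f (\<phi> x)))" if i: "i < n" for i
  proof (rule ck_on_cong[OF V])
    have "ck_on n V k (\<lambda>x. \<Sum>j<m. pd j f (\<phi> x) * pd i (\<lambda>x. \<phi> x j) x)" if "m \<le> n" for m
      using that
    proof (induction m)
      case (Suc m)
      have m: "m < n" "m \<le> n" using Suc by auto
      have "ck_on n V k (pd i (\<lambda>x. \<phi> x m))"
        using smooth_on_pd[OF \<phi>(2)[OF m(1)] i] unfolding smooth_on_iff_ck_on by (rule spec)
      from ck_on_mult[OF V IH[OF smooth_on_pd[OF f m(1)]] this]
      have "ck_on n V k (\<lambda>x. pd m f (\<phi> x) * pd i (\<lambda>x. \<phi> x m) x)" .
      then show ?case unfolding sum.lessThan_Suc by (rule ck_on_add[OF V Suc.IH[OF m(2)]])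
    qed (simp add: ck_on_const)
    then show "ck_on n V k (\<lambda>x. \<Sum>j<n. pd j f (\<phi> x) * pd i (\<lambda>x. \<phi> x j) x)" by blast
    fix x assume "x \<in> V"
    from der[OF i this]
    show "(\<Sum>j<n. pd j f (\<phi> x) * pd i (\<lambda>x. \<phi> x j) x) = pd i (\<lambda>x. f (\<phi> x)) x" by simp
  qed
  moreover have "continuous_on V (\<lambda>x. f (\<phi> x))"
    by (rule continuous_on_Euclidean_compose[OF U smooth_on_cont[OF Suc.prems] \<phi>(1) smooth_on_cont[OF \<phi>(2)]])
  ultimately show ?case unfolding ck_on.simps using der by blast
qed

lemma smooth_on_chain:
  assumes "openin (Euclidean_space n) U" "openin (Euclidean_space n) V"
    and "\<And>x. x \<in> V \<Longrightarrow> \<phi> x \<in> U" "\<And>j. j < n \<Longrightarrow> smooth_on n V (\<lambda>x. \<phi> x j)" "smooth_on n U f"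
  shows "smooth_on n V (\<lambda>x. f (\<phi> x))"
  unfolding smooth_on_iff_ck_on by (intro allI, rule ck_on_chain[OF assms])

section \<open>Local structure of a Lie algebroid\<close>

text \<open>Smoothness as seen in a single chart; \<open>smooth_fun_chartI\<close> passes from it to
  all charts on open subsets of the chart domain.\<close>

definition chart_smooth ::
  "('m::topological_space, 'v, 'z) vbundle_scheme \<Rightarrow> ('m, 'v) bchart \<Rightarrow> 'm set \<Rightarrow> ('m \<Rightarrow> real) \<Rightarrow> bool" where
  "chart_smooth A c V f \<longleftrightarrow> smooth_on (bdim A) (ccrd c ` (V \<inter> cdom c)) (f \<circ> cpar c)"

lemma smooth_fun_iff: "smooth_fun A V f \<longleftrightarrow> open V \<and> (\<forall>c\<in>atlas A. chart_smooth A c V f)"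
  by (simp add: smooth_fun_def chart_smooth_def)

section \<open>Smooth functions on the base, and bump functions\<close>

locale smooth_bundle =
  fixes A :: "('m::{t2_space, second_countable_topology}, 'v::real_vector, 'z) vbundle_scheme"
  assumes vector_bundle: "vector_bundle A"
begin

lemma subspace_fibre: "subspace (fibre A p)"
  using vector_bundle unfolding vector_bundle_def by blast

lemma atlas_covers: obtains c where "c \<in> atlas A" "p \<in> cdom c"
  using vector_bundle unfolding vector_bundle_def by blast

context
  fixes c assumes c: "c \<in> atlas A"
begin

lemma open_cdom: "open (cdom c)"
  and openin_ccrd: "openin (Euclidean_space (bdim A)) (ccrd c ` cdom c)"
  and chart_homeomorphism: "homeomorphism (cdom c) (ccrd c ` cdom c) (ccrd c) (cpar c)"
  and frame_inj: "p \<in> cdom c \<Longrightarrow> inj_on (\<lambda>\<alpha>. cfrm c \<alpha> p) {..<brank A}"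
  and frame_independent: "p \<in> cdom c \<Longrightarrow> independent ((\<lambda>\<alpha>. cfrm c \<alpha> p) ` {..<brank A})"
  and frame_span: "p \<in> cdom c \<Longrightarrow> span ((\<lambda>\<alpha>. cfrm c \<alpha> p) ` {..<brank A}) = fibre A p"
  using vector_bundle c unfolding vector_bundle_def by blast+

lemma frame_transition_smooth: "c' \<in> atlas A \<Longrightarrow> \<alpha> < brank A \<Longrightarrow> \<beta> < brank A \<Longrightarrow>
    smooth_on (bdim A) (ccrd c ` (cdom c \<inter> cdom c')) ((\<lambda>p. coframe A c' \<beta> p (cfrm c \<alpha> p)) \<circ> cpar c)"
  using vector_bundle c unfolding vector_bundle_def by blast

lemma cpar_ccrd: "p \<in> cdom c \<Longrightarrow> cpar c (ccrd c p) = p"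
  using chart_homeomorphism by (simp add: homeomorphism_def)

lemma openin_ccrd_image:
  assumes "open V" shows "openin (Euclidean_space (bdim A)) (ccrd c ` (V \<inter> cdom c))"
proof -
  have "openin (top_of_set (cdom c)) (V \<inter> cdom c)"
    using assms by (metis inf_commute openin_open_Int)
  from homeomorphism_imp_open_map[OF chart_homeomorphism this]
  obtain O' where O': "open O'" "ccrd c ` (V \<inter> cdom c) = ccrd c ` cdom c \<inter> O'"
    by (auto simp: openin_open)
  have "openin (powertop_real UNIV) O'" using O'(1) by (simp add: euclidean_product_topology)
  then have "openin (Euclidean_space (bdim A)) ({x. \<forall>i\<ge>bdim A. x i = 0} \<inter> O')"
    unfolding Euclidean_space_def by (rule openin_subtopology_Int2)
  then have "openin (Euclidean_space (bdim A)) (ccrd c ` cdom c \<inter> ({x. \<forall>i\<ge>bdim A. x i = 0} \<inter> O'))"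
    by (rule openin_Int[OF openin_ccrd])
  moreover have "ccrd c ` cdom c \<inter> ({x. \<forall>i\<ge>bdim A. x i = 0} \<inter> O') = ccrd c ` cdom c \<inter> O'"
    using openin_subset[OF openin_ccrd] by (auto simp: topspace_Euclidean_space)
  ultimately show ?thesis using O'(2) by simp
qed

lemma chart_smooth_const: "chart_smooth A c V (\<lambda>_. a)"
  unfolding chart_smooth_def o_def by (rule smooth_on_const)

lemma chart_smooth_add: "open V \<Longrightarrow> chart_smooth A c V f \<Longrightarrow> chart_smooth A c V g \<Longrightarrow>
    chart_smooth A c V (\<lambda>q. f q + g q)"
  unfolding chart_smooth_def o_def by (rule smooth_on_add[OF openin_ccrd_image])

lemma chart_smooth_mult: "open V \<Longrightarrow> chart_smooth A c V f \<Longrightarrow> chart_smooth A c V g \<Longrightarrow>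
    chart_smooth A c V (\<lambda>q. f q * g q)"
  unfolding chart_smooth_def o_def by (rule smooth_on_mult[OF openin_ccrd_image])

lemma chart_smooth_cong:
  assumes V: "open V" and fg: "\<And>q. q \<in> V \<Longrightarrow> q \<in> cdom c \<Longrightarrow> f q = g q" and f: "chart_smooth A c V f"
  shows "chart_smooth A c V g"
  unfolding chart_smooth_def
  by (rule smooth_on_cong[OF openin_ccrd_image[OF V] _ f[unfolded chart_smooth_def]])
     (use fg in \<open>auto simp: cpar_ccrd\<close>)

lemma chart_smooth_subset: "chart_smooth A c V f \<Longrightarrow> W \<subseteq> V \<Longrightarrow> chart_smooth A c W f"
  unfolding chart_smooth_def by (erule smooth_on_subset) auto

lemma chart_smooth_local:
  assumes "\<And>q. q \<in> V \<Longrightarrow> q \<in> cdom c \<Longrightarrow> \<exists>W. open W \<and> q \<in> W \<and> chart_smooth A c W f"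
  shows "chart_smooth A c V f"
  unfolding chart_smooth_def
proof (rule smooth_on_local)
  fix x assume "x \<in> ccrd c ` (V \<inter> cdom c)"
  then obtain q where q: "x = ccrd c q" "q \<in> V" "q \<in> cdom c" by blast
  then obtain W where W: "open W" "q \<in> W" "chart_smooth A c W f" using assms by blast
  show "\<exists>W. openin (Euclidean_space (bdim A)) W \<and> x \<in> W \<and> smooth_on (bdim A) W (f \<circ> cpar c)"
    using q W openin_ccrd_image[OF W(1)]
    by (intro exI[of _ "ccrd c ` (W \<inter> cdom c)"]) (simp add: chart_smooth_def)
qed

lemma chart_smooth_coord: "chart_smooth A c V (\<lambda>q. ccrd c q i)" if "open V"
  unfolding chart_smooth_def
  by (rule smooth_on_cong[OF openin_ccrd_image[OF that] _ smooth_on_coord[of _ _ i]])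
     (auto simp: cpar_ccrd)

lemma chart_smooth_cutoff: "open V \<Longrightarrow> chart_smooth A c V f \<Longrightarrow> chart_smooth A c V (\<lambda>q. cutoff (f q))"
  unfolding chart_smooth_def o_def by (rule smooth_on_cutoff[OF openin_ccrd_image])

lemma chart_smooth_prod: "open V \<Longrightarrow> (\<And>i. i \<in> I \<Longrightarrow> chart_smooth A c V (f i)) \<Longrightarrow>
    chart_smooth A c V (\<lambda>q. \<Prod>i\<in>I. f i q)"
  unfolding chart_smooth_def o_def by (rule smooth_on_prod[OF openin_ccrd_image])

lemma cpd_cong:
  assumes "open V" "p \<in> V" "p \<in> cdom c" "i < bdim A" "\<And>q. q \<in> V \<Longrightarrow> q \<in> cdom c \<Longrightarrow> f q = g q"
  shows "cpd c i f p = cpd c i g p"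
  unfolding cpd_def
  by (rule pd_cong[OF openin_ccrd_image[OF assms(1)]]) (use assms in \<open>auto simp: cpar_ccrd\<close>)

lemma cpd_const: "cpd c i (\<lambda>_. a) p = 0"
  unfolding cpd_def o_def using has_pd_const by blast

lemma cpd_coord: 
  assumes "p \<in> cdom c" "i < bdim A" shows "cpd c i (\<lambda>q. ccrd c q j) p = (if i = j then 1 else 0)"
proof -
  have "pd i ((\<lambda>q. ccrd c q j) \<circ> cpar c) (ccrd c p) = pd i (\<lambda>x. x j) (ccrd c p)"
    by (rule pd_cong[OF openin_ccrd]) (use assms in \<open>auto simp: cpar_ccrd\<close>)
  then show ?thesis unfolding cpd_def using has_pd_coord by simp
qed

lemma chart_smooth_has_pd:
  "chart_smooth A c V f \<Longrightarrow> p \<in> V \<Longrightarrow> p \<in> cdom c \<Longrightarrow> i < bdim A \<Longrightarrow> has_pd i (f \<circ> cpar c) (ccrd c p)"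
  unfolding chart_smooth_def by (rule smooth_on_has_pd) auto

lemma cpd_add:
  assumes "chart_smooth A c V f" "chart_smooth A c V g" "p \<in> V" "p \<in> cdom c" "i < bdim A"
  shows "cpd c i (\<lambda>q. f q + g q) p = cpd c i f p + cpd c i g p"
  using has_pd_add[OF chart_smooth_has_pd[OF assms(1,3-5)] chart_smooth_has_pd[OF assms(2-5)]]
  by (simp add: cpd_def o_def)

lemma cpd_mult:
  assumes "chart_smooth A c V f" "chart_smooth A c V g" "p \<in> V" "p \<in> cdom c" "i < bdim A"
  shows "cpd c i (\<lambda>q. f q * g q) p = cpd c i f p * g p + f p * cpd c i g p"
  using has_pd_mult[OF chart_smooth_has_pd[OF assms(1,3-5)] chart_smooth_has_pd[OF assms(2-5)]] assms(4)
  by (simp add: cpd_def o_def cpar_ccrd)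

lemma chart_smooth_cpd:
  assumes "open V" "chart_smooth A c V f" "i < bdim A" shows "chart_smooth A c V (cpd c i f)"
  unfolding chart_smooth_def
  by (rule smooth_on_cong[OF openin_ccrd_image[OF assms(1)] _
        smooth_on_pd[OF assms(2)[unfolded chart_smooth_def] assms(3)]])
     (auto simp: cpd_def cpar_ccrd)

text \<open>In the other chart f is its expression in c after the transition map, so smoothness
  follows from the chain rule in several variables.\<close>

lemma chart_smooth_change:
  assumes c': "c' \<in> atlas A" and V: "open V" "V \<subseteq> cdom c" and f: "chart_smooth A c V f"
  shows "chart_smooth A c' V f"
proof -
  have c'_cpar: "cpar c' (ccrd c' p) = p" if "p \<in> cdom c'" for p
    using vector_bundle c' that by (auto simp: vector_bundle_def homeomorphism_def)
  have V': "openin (Euclidean_space (bdim A)) (ccrd c' ` (V \<inter> cdom c'))"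
    using smooth_bundle.openin_ccrd_image[OF smooth_bundle_axioms c' V(1)] .
  have "smooth_on (bdim A) (ccrd c' ` (V \<inter> cdom c')) (\<lambda>x. (f \<circ> cpar c) (ccrd c (cpar c' x)))"
  proof (rule smooth_on_chain[OF openin_ccrd_image[OF V(1)] V' _ _ f[unfolded chart_smooth_def]])
    show "ccrd c (cpar c' x) \<in> ccrd c ` (V \<inter> cdom c)" if "x \<in> ccrd c' ` (V \<inter> cdom c')" for x
      using that V(2) by (auto simp: c'_cpar)
    show "smooth_on (bdim A) (ccrd c' ` (V \<inter> cdom c')) (\<lambda>x. ccrd c (cpar c' x) j)" if "j < bdim A" for j
    proof -
      have "smooth_on (bdim A) (ccrd c' ` (cdom c' \<inter> cdom c)) ((\<lambda>p. ccrd c p j) \<circ> cpar c')"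
        using vector_bundle c c' that unfolding vector_bundle_def by blast
      then show ?thesis unfolding o_def by (rule smooth_on_subset) (use V(2) in blast)
    qed
  qed
  then show ?thesis
    unfolding chart_smooth_def
    by (rule smooth_on_cong[OF V', rotated]) (use V(2) in \<open>auto simp: c'_cpar cpar_ccrd\<close>)
qed

lemma smooth_fun_chartI:
  "open V \<Longrightarrow> V \<subseteq> cdom c \<Longrightarrow> chart_smooth A c V f \<Longrightarrow> smooth_fun A V f"
  unfolding smooth_fun_iff using chart_smooth_change by blast

end

lemma smooth_fun_chart: "smooth_fun A V f \<Longrightarrow> c \<in> atlas A \<Longrightarrow> chart_smooth A c V f"
  unfolding smooth_fun_iff by blast

lemma smooth_fun_open: "smooth_fun A V f \<Longrightarrow> open V"
  unfolding smooth_fun_iff by blast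

lemma smooth_fun_const: "open V \<Longrightarrow> smooth_fun A V (\<lambda>_. a)"
  unfolding smooth_fun_iff using chart_smooth_const by blast

lemma smooth_fun_add: "smooth_fun A V f \<Longrightarrow> smooth_fun A V g \<Longrightarrow> smooth_fun A V (\<lambda>q. f q + g q)"
  unfolding smooth_fun_iff using chart_smooth_add by blast

lemma smooth_fun_mult: "smooth_fun A V f \<Longrightarrow> smooth_fun A V g \<Longrightarrow> smooth_fun A V (\<lambda>q. f q * g q)"
  unfolding smooth_fun_iff using chart_smooth_mult by blast

lemma smooth_fun_cong:
  assumes "\<And>q. q \<in> V \<Longrightarrow> f q = g q" "smooth_fun A V f" shows "smooth_fun A V g"
  unfolding smooth_fun_iff
proof (intro conjI ballI)
  show "open V" by (rule smooth_fun_open[OF assms(2)])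
  fix c assume c: "c \<in> atlas A"
  show "chart_smooth A c V g"
    by (rule chart_smooth_cong[OF c smooth_fun_open[OF assms(2)] assms(1) smooth_fun_chart[OF assms(2) c]])
qed

lemma smooth_fun_subset: "smooth_fun A V f \<Longrightarrow> open W \<Longrightarrow> W \<subseteq> V \<Longrightarrow> smooth_fun A W f"
  unfolding smooth_fun_iff using chart_smooth_subset by blast

lemma smooth_fun_local:
  assumes "\<And>q. q \<in> V \<Longrightarrow> \<exists>W. q \<in> W \<and> smooth_fun A W f" "open V"
  shows "smooth_fun A V f"
  unfolding smooth_fun_iff
proof (intro conjI ballI)
  fix c assume c: "c \<in> atlas A"
  show "chart_smooth A c V f"
  proof (rule chart_smooth_local[OF c])
    fix q assume "q \<in> V"
    then obtain W where "q \<in> W" "smooth_fun A W f" using assms(1) by blast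
    then show "\<exists>W. open W \<and> q \<in> W \<and> chart_smooth A c W f"
      using smooth_fun_open smooth_fun_chart[OF _ c] by blast
  qed
qed (rule assms(2))

lemma smooth_fun_Un:
  assumes "smooth_fun A V f" "smooth_fun A W f" shows "smooth_fun A (V \<union> W) f"
  by (rule smooth_fun_local) (use assms in \<open>auto dest: smooth_fun_open\<close>)

lemma smooth_fun_coord: "c \<in> atlas A \<Longrightarrow> smooth_fun A (cdom c) (\<lambda>q. ccrd c q i)"
  by (rule smooth_fun_chartI[OF _ open_cdom order_refl chart_smooth_coord[OF _ open_cdom]])

text \<open>K is the image of a compact box and therefore closed in the Hausdorff space M.
  Closedness in M, and not only in the chart domain, is what makes the extension by zero
  smooth.\<close>

lemma bump_function:
  assumes c: "c \<in> atlas A" and p: "p \<in> cdom c" and W: "open W" "p \<in> W"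
  obtains f K W' where "smooth_fun A UNIV f" "closed K" "K \<subseteq> W \<inter> cdom c" "\<And>q. q \<notin> K \<Longrightarrow> f q = 0"
    "open W'" "p \<in> W'" "W' \<subseteq> W \<inter> cdom c" "\<And>q. q \<in> W' \<Longrightarrow> f q = 1"
proof -
  let ?n = "bdim A" and ?x = "ccrd c p"
  obtain e where e: "e > 0" "\<And>y. (\<forall>i<?n. \<bar>y i - ?x i\<bar> \<le> e) \<Longrightarrow> (\<forall>i\<ge>?n. y i = 0) \<Longrightarrow> y \<in> ccrd c ` (W \<inter> cdom c)"
    using open_contains_box[OF openin_ccrd_image[OF c W(1)], of ?x] p W(2) by blast
  \<comment> \<open>The factors {0} from n on present the box as a product over all indices, so that
    its compactness follows from that of the factors.\<close>
  define B where "B = (\<Pi>\<^sub>E i\<in>UNIV. if i < ?n then {?x i - e..?x i + e} else {0})"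
  have B: "y \<in> B \<longleftrightarrow> (\<forall>i<?n. \<bar>y i - ?x i\<bar> \<le> e) \<and> (\<forall>i\<ge>?n. y i = 0)" for y
  proof -
    have "y i \<in> (if i < ?n then {?x i - e..?x i + e} else {0}) \<longleftrightarrow>
      (i < ?n \<longrightarrow> \<bar>y i - ?x i\<bar> \<le> e) \<and> (i \<ge> ?n \<longrightarrow> y i = 0)" for i by (auto simp: abs_le_iff)
    then show ?thesis unfolding B_def PiE_iff by auto
  qed
  define K where "K = cpar c ` B"
  have BU: "B \<subseteq> ccrd c ` (W \<inter> cdom c)" using e(2) B by blast
  then have "K \<subseteq> cpar c ` ccrd c ` (W \<inter> cdom c)" unfolding K_def by (rule image_mono)
  also have "\<dots> = (\<lambda>q. q) ` (W \<inter> cdom c)"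
    unfolding image_image by (rule image_cong[OF refl]) (simp add: cpar_ccrd[OF c])
  also have "\<dots> = W \<inter> cdom c" by simp
  finally have KW: "K \<subseteq> W \<inter> cdom c" .
  have "compactin (product_topology (\<lambda>_. euclidean) UNIV) B"
    unfolding B_def compactin_PiE by auto
  then have "compact B" by (simp add: euclidean_product_topology)
  moreover have "continuous_on B (cpar c)"
    using chart_homeomorphism[OF c] BU by (auto simp: homeomorphism_def intro: continuous_on_subset)
  ultimately have "closed K" unfolding K_def by (intro compact_imp_closed compact_continuous_image)
  \<comment> \<open>\<open>cutoff\<close> is 1 up to distance 1 and 0 from distance 2 on; the
    scaling by 2/e moves these to e/2 and e, the half-width of the box.\<close>
  define f where "f q = (if q \<in> cdom c then \<Prod>i<?n. cutoff ((ccrd c q i + - ?x i) * (2 / e)) else 0)" for q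
  have f0: "f q = 0" if "q \<notin> K" for q
  proof (cases "q \<in> cdom c")
    case True
    then have "ccrd c q \<notin> B" using that cpar_ccrd[OF c True] unfolding K_def by (metis imageI)
    moreover have "\<forall>i\<ge>?n. ccrd c q i = 0"
      using openin_subset[OF openin_ccrd[OF c]] True by (auto simp: topspace_Euclidean_space)
    ultimately obtain i where i: "i < ?n" "\<not> \<bar>ccrd c q i - ?x i\<bar> \<le> e" using B by blast
    have "2 \<le> \<bar>(ccrd c q i + - ?x i) * (2 / e)\<bar>"
      using i(2) e(1) by (simp add: abs_mult field_simps)
    then have "cutoff ((ccrd c q i + - ?x i) * (2 / e)) = 0" by (rule cutoff_eq_0)
    then show ?thesis using i(1) True by (auto simp: f_def intro!: prod_zero)
  qed (simp add: f_def)
  have "chart_smooth A c (cdom c) (\<lambda>q. \<Prod>i<?n. cutoff ((ccrd c q i + - ?x i) * (2 / e)))"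
    by (intro chart_smooth_prod[OF c] chart_smooth_cutoff[OF c] chart_smooth_mult[OF c]
        chart_smooth_add[OF c] chart_smooth_coord[OF c] chart_smooth_const[OF c] open_cdom[OF c])
  then have "smooth_fun A (cdom c) (\<lambda>q. \<Prod>i<?n. cutoff ((ccrd c q i + - ?x i) * (2 / e)))"
    by (rule smooth_fun_chartI[OF c open_cdom[OF c] order_refl])
  then have s1: "smooth_fun A (cdom c) f"
    by (rule smooth_fun_cong[rotated]) (simp add: f_def)
  have s2: "smooth_fun A (- K) f"
    by (rule smooth_fun_cong[OF _ smooth_fun_const[of "- K" 0]])
       (use \<open>closed K\<close> f0 in auto)
  have un: "cdom c \<union> - K = UNIV" using KW by blast
  have smooth: "smooth_fun A UNIV f" using smooth_fun_Un[OF s1 s2] unfolding un .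
  define W' where "W' = W \<inter> cdom c \<inter> (\<Inter>i<?n. {q \<in> cdom c. ccrd c q i \<in> ball (?x i) (e / 2)})"
  have oi: "open {q \<in> cdom c. ccrd c q i \<in> ball (?x i) (e / 2)}" for i
  proof -
    have "continuous_on (cdom c) (\<lambda>q. ccrd c q i)"
      by (rule continuous_on_product_then_coordinatewise) (use chart_homeomorphism[OF c] in \<open>simp add: homeomorphism_def\<close>)
    from continuous_open_preimage[OF this open_cdom[OF c] open_ball]
    moreover have "cdom c \<inter> (\<lambda>q. ccrd c q i) -` ball (?x i) (e / 2) = {q \<in> cdom c. ccrd c q i \<in> ball (?x i) (e / 2)}"
      by blast
    ultimately show ?thesis by metis
  qed
  have "open W'" unfolding W'_def
    by (intro open_Int open_INT ballI W(1) open_cdom[OF c] oi finite_lessThan)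
  moreover have "p \<in> W'" unfolding W'_def using p W(2) e(1) by auto
  moreover have "f q = 1" if "q \<in> W'" for q
  proof -
    have "cutoff ((ccrd c q i + - ?x i) * (2 / e)) = 1" if "i < ?n" for i
    proof (rule cutoff_eq_1)
      have "ccrd c q i \<in> ball (?x i) (e / 2)" using \<open>q \<in> W'\<close> that unfolding W'_def by auto
      then show "\<bar>(ccrd c q i + - ?x i) * (2 / e)\<bar> \<le> 1"
        using e(1) by (simp add: dist_real_def divide_simps) argo
    qed
    then show ?thesis using that by (simp add: f_def W'_def)
  qed
  ultimately show ?thesis using that[OF smooth \<open>closed K\<close> KW f0] unfolding W'_def by blast
qed

text \<open>The product is smooth on W and zero on the complement of K, and these two open sets
  cover M. The values of g outside W are irrelevant because they are multiplied by 0.\<close>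

lemma smooth_fun_extend:
  assumes "smooth_fun A UNIV f" "closed K" "\<And>q. q \<notin> K \<Longrightarrow> f q = 0" "K \<subseteq> W" "smooth_fun A W g"
  shows "smooth_fun A UNIV (\<lambda>q. f q * g q)"
proof -
  have s1: "smooth_fun A W (\<lambda>q. f q * g q)"
    by (intro smooth_fun_mult assms(5) smooth_fun_subset[OF assms(1) smooth_fun_open[OF assms(5)]]) simp
  have s2: "smooth_fun A (- K) (\<lambda>q. f q * g q)"
    by (rule smooth_fun_cong[OF _ smooth_fun_const[of "- K" 0]]) (use assms(2,3) in auto)
  have un: "W \<union> - K = UNIV" using assms(4) by blast
  show ?thesis using smooth_fun_Un[OF s1 s2] unfolding un .
qed

end

section \<open>Frames, coframes and global sections\<close>

context smooth_bundle
begin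

lemma coframe_frame:
  assumes "c \<in> atlas A" "p \<in> cdom c" "\<alpha> < brank A" "\<beta> < brank A"
  shows "coframe A c \<alpha> p (cfrm c \<beta> p) = (if \<alpha> = \<beta> then 1 else 0)"
proof -
  have "cfrm c \<alpha> p = cfrm c \<beta> p \<longleftrightarrow> \<alpha> = \<beta>"
    using inj_onD[OF frame_inj[OF assms(1,2)]] assms(3,4) by auto
  then show ?thesis
    unfolding coframe_def using representation_basis[OF frame_independent[OF assms(1,2)]] assms(4) by simp
qed

lemma coframe_zero: "coframe A c \<alpha> p 0 = 0"
  by (simp add: coframe_def representation_zero)

lemma frame_in_fibre: "c \<in> atlas A \<Longrightarrow> p \<in> cdom c \<Longrightarrow> \<alpha> < brank A \<Longrightarrow> cfrm c \<alpha> p \<in> fibre A p"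
  by (subst frame_span[symmetric]) (auto intro: span_base)

context
  fixes c p assumes cp: "c \<in> atlas A" "p \<in> cdom c"
begin

lemma coframe_add:
  "v \<in> fibre A p \<Longrightarrow> w \<in> fibre A p \<Longrightarrow> coframe A c \<alpha> p (v + w) = coframe A c \<alpha> p v + coframe A c \<alpha> p w"
  by (simp add: coframe_def representation_add frame_independent[OF cp] frame_span[OF cp])

lemma coframe_scale: "v \<in> fibre A p \<Longrightarrow> coframe A c \<alpha> p (a *\<^sub>R v) = a * coframe A c \<alpha> p v"
  by (simp add: coframe_def representation_scale frame_independent[OF cp] frame_span[OF cp])

lemma coframe_sum: "(\<And>i. i \<in> I \<Longrightarrow> v i \<in> fibre A p) \<Longrightarrow>
    coframe A c \<alpha> p (sum v I) = (\<Sum>i\<in>I. coframe A c \<alpha> p (v i))"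
  by (simp add: coframe_def representation_sum frame_independent[OF cp] frame_span[OF cp])

lemma frame_expansion:
  assumes "v \<in> fibre A p" shows "v = (\<Sum>\<alpha><brank A. coframe A c \<alpha> p v *\<^sub>R cfrm c \<alpha> p)"
proof -
  let ?B = "(\<lambda>\<alpha>. cfrm c \<alpha> p) ` {..<brank A}"
  have "(\<Sum>b\<in>?B. representation ?B v b *\<^sub>R b) = v"
    by (rule sum_representation_eq) (use assms frame_independent[OF cp] frame_span[OF cp] in auto)
  then show ?thesis unfolding coframe_def by (simp add: sum.reindex[OF frame_inj[OF cp]])
qed

end

lemma sections_iff: "s \<in> sections A \<longleftrightarrow> (\<forall>p. s p \<in> fibre A p) \<and>
    (\<forall>c\<in>atlas A. \<forall>\<alpha><brank A. smooth_fun A (cdom c) (\<lambda>p. coframe A c \<alpha> p (s p)))"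
proof -
  have "smooth_on (bdim A) (ccrd c ` cdom c) ((\<lambda>p. coframe A c \<alpha> p (s p)) \<circ> cpar c)
      \<longleftrightarrow> smooth_fun A (cdom c) (\<lambda>p. coframe A c \<alpha> p (s p))" if "c \<in> atlas A" for c \<alpha>
    using smooth_fun_chartI[OF that open_cdom[OF that] order_refl] smooth_fun_chart[OF _ that]
    unfolding chart_smooth_def by (metis inf.idem)
  then show ?thesis unfolding sections_def mem_Collect_eq by simp
qed

lemma section_fibre: "s \<in> sections A \<Longrightarrow> s p \<in> fibre A p"
  and section_smooth: "s \<in> sections A \<Longrightarrow> c \<in> atlas A \<Longrightarrow> \<alpha> < brank A \<Longrightarrow>
    smooth_fun A (cdom c) (\<lambda>p. coframe A c \<alpha> p (s p))"
  unfolding sections_iff by blast+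

lemma section_zero: "(\<lambda>_. 0) \<in> sections A"
  unfolding sections_iff
  using subspace_0[OF subspace_fibre] smooth_fun_const[OF open_cdom] by (simp add: coframe_zero)

lemma section_add: assumes "s \<in> sections A" "t \<in> sections A" shows "(\<lambda>p. s p + t p) \<in> sections A"
  unfolding sections_iff
proof (intro conjI allI ballI impI)
  fix p show "s p + t p \<in> fibre A p" using assms by (intro subspace_add subspace_fibre section_fibre)
next
  fix c \<alpha> assume c: "c \<in> atlas A" "\<alpha> < brank A"
  show "smooth_fun A (cdom c) (\<lambda>p. coframe A c \<alpha> p (s p + t p))"
    by (rule smooth_fun_cong[OF _ smooth_fun_add[OF section_smooth[OF assms(1) c] section_smooth[OF assms(2) c]]])
       (use assms c in \<open>simp add: coframe_add section_fibre\<close>)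
qed

lemma section_scale:
  assumes "smooth_fun A UNIV f" "s \<in> sections A" shows "(\<lambda>p. f p *\<^sub>R s p) \<in> sections A"
  unfolding sections_iff
proof (intro conjI allI ballI impI)
  fix p show "f p *\<^sub>R s p \<in> fibre A p" using assms by (intro subspace_scale subspace_fibre section_fibre)
next
  fix c \<alpha> assume c: "c \<in> atlas A" "\<alpha> < brank A"
  show "smooth_fun A (cdom c) (\<lambda>p. coframe A c \<alpha> p (f p *\<^sub>R s p))"
    by (rule smooth_fun_cong[OF _ smooth_fun_mult[OF smooth_fun_subset[OF assms(1) open_cdom[OF c(1)]]
            section_smooth[OF assms(2) c]]])
       (use assms c in \<open>simp_all add: coframe_scale section_fibre\<close>)
qed

lemma section_sum: "(\<And>i. i \<in> I \<Longrightarrow> s i \<in> sections A) \<Longrightarrow> (\<lambda>p. \<Sum>i\<in>I. s i p) \<in> sections A"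
  by (induction I rule: infinite_finite_induct) (simp_all add: section_zero section_add)

text \<open>Off the chart domain the frame has arbitrary values, which f turns into 0. In another
  chart the section is smooth on the overlap by the transition functions and zero off K.\<close>

lemma section_frame:
  assumes c: "c \<in> atlas A" and \<alpha>: "\<alpha> < brank A" and f: "smooth_fun A UNIV f"
    and K: "closed K" "K \<subseteq> cdom c" "\<And>q. q \<notin> K \<Longrightarrow> f q = 0"
  shows "(\<lambda>p. f p *\<^sub>R cfrm c \<alpha> p) \<in> sections A"
  unfolding sections_iff
proof (intro conjI allI ballI impI)
  fix p show "f p *\<^sub>R cfrm c \<alpha> p \<in> fibre A p"
  proof (cases "p \<in> cdom c")
    case True
    then show ?thesis by (intro subspace_scale subspace_fibre frame_in_fibre c \<alpha>)
  next
    case False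
    then have "f p = 0" using K by blast
    then show ?thesis using subspace_0[OF subspace_fibre] by simp
  qed
next
  fix c' \<beta> assume c': "c' \<in> atlas A" "\<beta> < brank A"
  let ?h = "\<lambda>p. coframe A c' \<beta> p (f p *\<^sub>R cfrm c \<alpha> p)" and ?V = "cdom c \<inter> cdom c'"
  have V: "open ?V" "?V \<subseteq> cdom c" using open_cdom c c' by auto
  have "chart_smooth A c ?V (\<lambda>p. coframe A c' \<beta> p (cfrm c \<alpha> p))"
    using frame_transition_smooth[OF c c'(1) \<alpha> c'(2)] by (simp add: chart_smooth_def inf_commute inf_left_commute)
  then have "smooth_fun A ?V (\<lambda>p. coframe A c' \<beta> p (cfrm c \<alpha> p))"
    by (rule smooth_fun_chartI[OF c V])
  then have "smooth_fun A ?V (\<lambda>p. f p * coframe A c' \<beta> p (cfrm c \<alpha> p))"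
    by (intro smooth_fun_mult smooth_fun_subset[OF f V(1)]) simp_all
  then have s1: "smooth_fun A ?V ?h"
    by (rule smooth_fun_cong[rotated]) (use c c' \<alpha> in \<open>simp add: coframe_scale frame_in_fibre\<close>)
  have "open (cdom c' - K)" using open_cdom[OF c'(1)] K(1) by (rule open_Diff)
  then have s2: "smooth_fun A (cdom c' - K) ?h"
    by (intro smooth_fun_cong[OF _ smooth_fun_const[of "cdom c' - K" 0]]) (simp_all add: K(3) coframe_zero)
  have un: "?V \<union> (cdom c' - K) = cdom c'" using K(2) by blast
  show "smooth_fun A (cdom c') ?h" using smooth_fun_Un[OF s1 s2] unfolding un .
qed

end

section \<open>The axioms of a Lie algebroid, and the anchor as a local operator\<close>

locale algebroid_ctx =
  fixes A :: "('m::{t2_space, second_countable_topology}, 'v::real_vector) algebroid"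
  assumes lie_algebroid: "lie_algebroid A"

sublocale algebroid_ctx \<subseteq> smooth_bundle A
  by unfold_locales (use lie_algebroid in \<open>simp add: lie_algebroid_def\<close>)

context algebroid_ctx
begin

lemma smooth_anchor: "smooth_anchor A"
  and bracket_section: "s \<in> sections A \<Longrightarrow> t \<in> sections A \<Longrightarrow> bracket A s t \<in> sections A"
  and bracket_linear: "s \<in> sections A \<Longrightarrow> t \<in> sections A \<Longrightarrow> u \<in> sections A \<Longrightarrow>
      bracket A (\<lambda>p. a *\<^sub>R s p + b *\<^sub>R t p) u = (\<lambda>p. a *\<^sub>R bracket A s u p + b *\<^sub>R bracket A t u p)"
  and bracket_skew: "s \<in> sections A \<Longrightarrow> t \<in> sections A \<Longrightarrow> bracket A s t = (\<lambda>p. - bracket A t s p)"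
  and bracket_jacobi: "s \<in> sections A \<Longrightarrow> t \<in> sections A \<Longrightarrow> u \<in> sections A \<Longrightarrow>
      bracket A s (bracket A t u) p + bracket A t (bracket A u s) p + bracket A u (bracket A s t) p = 0"
  and bracket_leibniz: "s \<in> sections A \<Longrightarrow> t \<in> sections A \<Longrightarrow> smooth_fun A UNIV f \<Longrightarrow>
      bracket A s (\<lambda>p. f p *\<^sub>R t p) = (\<lambda>p. f p *\<^sub>R bracket A s t p + anchor A p (s p) f *\<^sub>R t p)"
  and anchor_bracket: "s \<in> sections A \<Longrightarrow> t \<in> sections A \<Longrightarrow> smooth_fun A UNIV f \<Longrightarrow>
      anchor A p (bracket A s t p) f = anchor A p (s p) (\<lambda>q. anchor A q (t q) f)
          - anchor A p (t p) (\<lambda>q. anchor A q (s q) f)"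
  using lie_algebroid unfolding lie_algebroid_def by blast+

lemma anchor_tangent: "v \<in> fibre A p \<Longrightarrow> tangent_vector A p (anchor A p v)"
  and anchor_linear: "v \<in> fibre A p \<Longrightarrow> w \<in> fibre A p \<Longrightarrow> p \<in> V \<Longrightarrow> smooth_fun A V f \<Longrightarrow>
      anchor A p (a *\<^sub>R v + b *\<^sub>R w) f = a * anchor A p v f + b * anchor A p w f"
  and anchor_smooth: "s \<in> sections A \<Longrightarrow> smooth_fun A UNIV f \<Longrightarrow> smooth_fun A UNIV (\<lambda>p. anchor A p (s p) f)"
proof -
  note sa = smooth_anchor[unfolded smooth_anchor_def]
  show "v \<in> fibre A p \<Longrightarrow> tangent_vector A p (anchor A p v)"
    using conjunct1[OF sa] by simp
  show "v \<in> fibre A p \<Longrightarrow> w \<in> fibre A p \<Longrightarrow> p \<in> V \<Longrightarrow> smooth_fun A V f \<Longrightarrow>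
      anchor A p (a *\<^sub>R v + b *\<^sub>R w) f = a * anchor A p v f + b * anchor A p w f"
    using conjunct1[OF conjunct2[OF sa]] by blast
  show "s \<in> sections A \<Longrightarrow> smooth_fun A UNIV f \<Longrightarrow> smooth_fun A UNIV (\<lambda>p. anchor A p (s p) f)"
    using conjunct2[OF conjunct2[OF sa]] by simp
qed

text \<open>The coefficients are found by evaluation on the coordinates. These are smooth on the
  chart domain only, which is admissible since tangent vectors act on functions smooth near
  p.\<close>

lemma anchor_expansion:
  assumes "c \<in> atlas A" "p \<in> cdom c" "v \<in> fibre A p" "p \<in> V" "smooth_fun A V f"
  shows "anchor A p v f = (\<Sum>i<bdim A. anchor A p v (\<lambda>q. ccrd c q i) * cpd c i f p)"
proof -
  obtain a where a: "\<And>V f. p \<in> V \<Longrightarrow> smooth_fun A V f \<Longrightarrow> anchor A p v f = (\<Sum>i<bdim A. a i * cpd c i f p)"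
    using anchor_tangent[OF assms(3)] assms(1,2) unfolding tangent_vector_def by blast
  have "anchor A p v (\<lambda>q. ccrd c q j) = a j" if "j < bdim A" for j
  proof -
    have "anchor A p v (\<lambda>q. ccrd c q j) = (\<Sum>i<bdim A. a i * cpd c i (\<lambda>q. ccrd c q j) p)"
      by (rule a[OF assms(2) smooth_fun_coord[OF assms(1)]])
    also have "\<dots> = (\<Sum>i<bdim A. if i = j then a i else 0)"
      by (intro sum.cong refl) (simp add: cpd_coord[OF assms(1,2)])
    finally show ?thesis using that by simp
  qed
  then show ?thesis using a[OF assms(4,5)] by simp
qed

text \<open>Coordinate derivatives see only values near p. The two functions may be smooth on
  different sets, so a local function can be exchanged for a global one.\<close>

lemma anchor_germ:
  assumes "v \<in> fibre A p" "p \<in> V" "smooth_fun A V f" "p \<in> W" "smooth_fun A W g"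
    and N: "open N" "p \<in> N" "\<And>q. q \<in> N \<Longrightarrow> f q = g q"
  shows "anchor A p v f = anchor A p v g"
proof -
  obtain c where c: "c \<in> atlas A" "p \<in> cdom c" using atlas_covers by blast
  have "cpd c i f p = cpd c i g p" if "i < bdim A" for i
    by (rule cpd_cong[OF c(1) N(1,2) c(2) that N(3)])
  then show ?thesis
    using anchor_expansion[OF c assms(1-3)] anchor_expansion[OF c assms(1,4,5)] by simp
qed

lemma anchor_const:
  assumes "v \<in> fibre A p" "p \<in> V" "open V" "\<And>q. q \<in> V \<Longrightarrow> f q = a"
  shows "anchor A p v f = 0"
proof -
  obtain c where c: "c \<in> atlas A" "p \<in> cdom c" using atlas_covers by blast
  have "smooth_fun A V f" by (rule smooth_fun_cong[OF _ smooth_fun_const[OF assms(3)]]) (simp add: assms(4))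
  then have "anchor A p v f = (\<Sum>i<bdim A. anchor A p v (\<lambda>q. ccrd c q i) * cpd c i f p)"
    by (rule anchor_expansion[OF c assms(1,2)])
  moreover have "cpd c i f p = 0" if "i < bdim A" for i
  proof -
    have "cpd c i f p = cpd c i (\<lambda>_. a) p"
      by (rule cpd_cong[OF c(1) assms(3,2) c(2) that]) (simp add: assms(4))
    then show ?thesis by (simp add: cpd_const[OF c(1)])
  qed
  ultimately show ?thesis by simp
qed

lemma anchor_zero: "p \<in> V \<Longrightarrow> smooth_fun A V f \<Longrightarrow> anchor A p 0 f = 0"
  using anchor_linear[of 0 p 0 V f 0 0] subspace_0[OF subspace_fibre] by simp

lemma anchor_sum:
  assumes "p \<in> V" "smooth_fun A V f" "\<And>i. i \<in> I \<Longrightarrow> v i \<in> fibre A p"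
  shows "anchor A p (\<Sum>i\<in>I. a i *\<^sub>R v i) f = (\<Sum>i\<in>I. a i * anchor A p (v i) f)"
  using assms(3)
proof (induction I rule: infinite_finite_induct)
  case (insert i I)
  have "(\<Sum>i\<in>I. a i *\<^sub>R v i) \<in> fibre A p"
    by (intro subspace_sum subspace_scale subspace_fibre) (use insert in auto)
  then have "anchor A p (a i *\<^sub>R v i + 1 *\<^sub>R (\<Sum>i\<in>I. a i *\<^sub>R v i)) f
    = a i * anchor A p (v i) f + 1 * anchor A p (\<Sum>i\<in>I. a i *\<^sub>R v i) f"
    using insert by (intro anchor_linear[OF _ _ assms(1,2)]) auto
  then show ?case using insert by simp
qed (simp_all add: anchor_zero[OF assms(1,2)])

section \<open>Locality of the bracket\<close>

lemma bracket_zero_left: "u \<in> sections A \<Longrightarrow> bracket A (\<lambda>_. 0) u = (\<lambda>_. 0)"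
  using bracket_linear[OF section_zero section_zero, of u 0 0] by simp

lemma bracket_zero_right: "u \<in> sections A \<Longrightarrow> bracket A u (\<lambda>_. 0) = (\<lambda>_. 0)"
  using bracket_skew[OF _ section_zero, of u] bracket_zero_left[of u] by simp

lemma bracket_add_left: "s \<in> sections A \<Longrightarrow> t \<in> sections A \<Longrightarrow> u \<in> sections A \<Longrightarrow>
    bracket A (\<lambda>p. s p + t p) u = (\<lambda>p. bracket A s u p + bracket A t u p)"
  using bracket_linear[of s t u 1 1] by simp

lemma bracket_add_right: "s \<in> sections A \<Longrightarrow> t \<in> sections A \<Longrightarrow> u \<in> sections A \<Longrightarrow>
    bracket A u (\<lambda>p. s p + t p) = (\<lambda>p. bracket A u s p + bracket A u t p)"
  using bracket_add_left[of s t u] bracket_skew[of u "\<lambda>p. s p + t p"] bracket_skew[of u s] bracket_skew[of u t]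
  by (simp add: section_add)

lemma bracket_sum_right: "u \<in> sections A \<Longrightarrow> (\<And>i. i \<in> I \<Longrightarrow> s i \<in> sections A) \<Longrightarrow>
    bracket A u (\<lambda>p. \<Sum>i\<in>I. s i p) = (\<lambda>p. \<Sum>i\<in>I. bracket A u (s i) p)"
  by (induction I rule: infinite_finite_induct)
     (simp_all add: bracket_zero_right bracket_add_right section_sum)

text \<open>For a bump function f supported in N the section f t is zero everywhere. The Leibniz
  rule for its bracket with s, taken at p where f is 1 and t is 0, leaves just the bracket of s and
  t.\<close>

lemma bracket_local_zero:
  assumes s: "s \<in> sections A" and t: "t \<in> sections A" and N: "open N" "p \<in> N" "\<And>q. q \<in> N \<Longrightarrow> t q = 0"
  shows "bracket A s t p = 0"
proof -
  obtain c where c: "c \<in> atlas A" "p \<in> cdom c" using atlas_covers by blast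
  obtain f K W' where f: "smooth_fun A UNIV f" "K \<subseteq> N \<inter> cdom c" "\<And>q. q \<notin> K \<Longrightarrow> f q = 0"
    "p \<in> W'" "\<And>q. q \<in> W' \<Longrightarrow> f q = 1"
    using bump_function[OF c N(1,2)] by metis
  have "f q *\<^sub>R t q = 0" for q
    using f(2,3) N(3) by (cases "q \<in> K") auto
  then have ft: "(\<lambda>q. f q *\<^sub>R t q) = (\<lambda>_. 0)" by (rule ext)
  have "bracket A s (\<lambda>_. 0) = (\<lambda>p. f p *\<^sub>R bracket A s t p + anchor A p (s p) f *\<^sub>R t p)"
    using bracket_leibniz[OF s t f(1)] unfolding ft .
  then have "0 = f p *\<^sub>R bracket A s t p + anchor A p (s p) f *\<^sub>R t p"
    unfolding bracket_zero_right[OF s] by (rule fun_cong)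
  then show ?thesis using f(4,5) N(2,3) by simp
qed

lemma bracket_germ_right:
  assumes s: "s \<in> sections A" and t: "t \<in> sections A" "t' \<in> sections A"
    and N: "open N" "p \<in> N" "\<And>q. q \<in> N \<Longrightarrow> t q = t' q"
  shows "bracket A s t p = bracket A s t' p"
proof -
  let ?u = "\<lambda>q. t q + (- 1) *\<^sub>R t' q"
  have mt: "(\<lambda>q. (- 1) *\<^sub>R t' q) \<in> sections A"
    by (rule section_scale[OF smooth_fun_const[OF open_UNIV] t(2)])
  have "bracket A s ?u p = 0"
    by (rule bracket_local_zero[OF s section_add[OF t(1) mt] N(1,2)]) (simp add: N(3))
  \<comment> \<open>The linearity axiom concerns the first argument; in the second, the scalar -1 is
    taken out by the Leibniz rule, since the anchor kills constants.\<close>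
  moreover have "bracket A s (\<lambda>q. (- 1) *\<^sub>R t' q) p = - bracket A s t' p"
    using bracket_leibniz[OF s t(2) smooth_fun_const[OF open_UNIV, of "- 1"]]
      anchor_const[OF section_fibre[OF s], of p UNIV "\<lambda>_. - 1" "- 1"] by simp
  ultimately show ?thesis using bracket_add_right[OF t(1) mt s] by simp
qed

lemma bracket_germ:
  assumes "s \<in> sections A" "s' \<in> sections A" "t \<in> sections A" "t' \<in> sections A"
    and N: "open N" "p \<in> N" "\<And>q. q \<in> N \<Longrightarrow> s q = s' q \<and> t q = t' q"
  shows "bracket A s t p = bracket A s' t' p"
proof -
  have "bracket A s t p = bracket A s t' p" by (rule bracket_germ_right[OF assms(1,3,4) N(1,2)]) (simp add: N(3))
  also have "\<dots> = - bracket A t' s p" using bracket_skew[OF assms(1,4)] by simp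
  also have "bracket A t' s p = bracket A t' s' p"
    by (rule bracket_germ_right[OF assms(4,1,2) N(1,2)]) (simp add: N(3))
  also have "- \<dots> = bracket A s' t' p" using bracket_skew[OF assms(2,4)] by simp
  finally show ?thesis .
qed

text \<open>The description in \<open>local_bracket\<close> has a unique solution because brackets
  of sections with equal germs agree, by \<open>bracket_germ\<close>; any global extensions may thus
  be used.\<close>

lemma local_bracket_eq:
  assumes "s' \<in> sections A" "t' \<in> sections A"
    and N: "open N" "p \<in> N" "\<And>q. q \<in> N \<Longrightarrow> s' q = s q \<and> t' q = t q"
  shows "local_bracket A s t p = bracket A s' t' p"
  unfolding local_bracket_def
proof (rule the_equality)
  have "\<forall>\<^sub>F q in nhds p. s' q = s q \<and> t' q = t q"
    using N unfolding eventually_nhds by blast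
  then show "\<exists>s''\<in>sections A. \<exists>t''\<in>sections A.
      (\<forall>\<^sub>F q in nhds p. s'' q = s q \<and> t'' q = t q) \<and> bracket A s' t' p = bracket A s'' t'' p"
    using assms(1,2) by blast
next
  fix v assume "\<exists>s''\<in>sections A. \<exists>t''\<in>sections A.
      (\<forall>\<^sub>F q in nhds p. s'' q = s q \<and> t'' q = t q) \<and> v = bracket A s'' t'' p"
  then obtain s'' t'' M where *: "s'' \<in> sections A" "t'' \<in> sections A" "v = bracket A s'' t'' p"
    "open M" "p \<in> M" "\<And>q. q \<in> M \<Longrightarrow> s'' q = s q \<and> t'' q = t q"
    unfolding eventually_nhds by blast
  show "v = bracket A s' t' p"
    unfolding *(3) by (rule bracket_germ[OF *(1) assms(1) *(2) assms(2), of "N \<inter> M"]) (use N * in auto)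
qed

end

section \<open>Structure functions of a local frame\<close>

context algebroid_ctx
begin

definition anchor_fun :: "('m, 'v) bchart \<Rightarrow> nat \<Rightarrow> nat \<Rightarrow> 'm \<Rightarrow> real" where
  "anchor_fun c i \<alpha> p = anchor A p (cfrm c \<alpha> p) (\<lambda>q. ccrd c q i)"

definition struct_fun :: "('m, 'v) bchart \<Rightarrow> nat \<Rightarrow> nat \<Rightarrow> nat \<Rightarrow> 'm \<Rightarrow> real" where
  "struct_fun c \<gamma> \<alpha> \<beta> p = coframe A c \<gamma> p (local_bracket A (cfrm c \<alpha>) (cfrm c \<beta>) p)"

text \<open>Global substitutes, near p, for a frame and for coordinates. One bump function serves
  them all, so they are valid on a common neighbourhood W; its closed support K permits further
  extensions by zero.\<close>

lemma local_frame:
  assumes c: "c \<in> atlas A" and p: "p \<in> cdom c"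
  obtains W f K E where "open W" "p \<in> W" "W \<subseteq> cdom c" "smooth_fun A UNIV f" "closed K" "K \<subseteq> cdom c"
    "\<And>q. q \<notin> K \<Longrightarrow> f q = 0" "\<And>q. q \<in> W \<Longrightarrow> f q = 1"
    "\<And>\<alpha>. \<alpha> < brank A \<Longrightarrow> E \<alpha> \<in> sections A" "\<And>\<alpha> q. q \<in> W \<Longrightarrow> E \<alpha> q = cfrm c \<alpha> q"
    "\<And>\<alpha> \<beta> q. \<alpha> < brank A \<Longrightarrow> \<beta> < brank A \<Longrightarrow> q \<in> W \<Longrightarrow>
      local_bracket A (cfrm c \<alpha>) (cfrm c \<beta>) q = bracket A (E \<alpha>) (E \<beta>) q"
    "\<And>i. smooth_fun A UNIV (\<lambda>q. f q * ccrd c q i)"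
    "\<And>i q v. q \<in> W \<Longrightarrow> v \<in> fibre A q \<Longrightarrow>
      anchor A q v (\<lambda>q. f q * ccrd c q i) = anchor A q v (\<lambda>q. ccrd c q i)"
proof -
  obtain f K W where fK: "smooth_fun A UNIV f" "closed K" "K \<subseteq> UNIV \<inter> cdom c" "\<And>q. q \<notin> K \<Longrightarrow> f q = 0"
    "open W" "p \<in> W" "W \<subseteq> UNIV \<inter> cdom c" "\<And>q. q \<in> W \<Longrightarrow> f q = 1"
    using bump_function[OF c p open_UNIV UNIV_I] by metis
  then have KW: "K \<subseteq> cdom c" "W \<subseteq> cdom c" by auto
  define E where "E \<alpha> = (\<lambda>q. f q *\<^sub>R cfrm c \<alpha> q)" for \<alpha>
  have E: "E \<alpha> \<in> sections A" if "\<alpha> < brank A" for \<alpha>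
    unfolding E_def by (rule section_frame[OF c that fK(1,2) KW(1) fK(4)])
  have EW: "E \<alpha> q = cfrm c \<alpha> q" if "q \<in> W" for \<alpha> q
    unfolding E_def by (simp add: fK(8)[OF that])
  have X: "smooth_fun A UNIV (\<lambda>q. f q * ccrd c q i)" for i
    by (rule smooth_fun_extend[OF fK(1,2,4) KW(1) smooth_fun_coord[OF c]])
  show ?thesis
  proof (rule that[OF fK(5,6) KW(2) fK(1,2) KW(1) fK(4,8) E EW _ X])
    show "local_bracket A (cfrm c \<alpha>) (cfrm c \<beta>) q = bracket A (E \<alpha>) (E \<beta>) q"
      if "\<alpha> < brank A" "\<beta> < brank A" "q \<in> W" for \<alpha> \<beta> q
      by (rule local_bracket_eq[OF E[OF that(1)] E[OF that(2)] fK(5) that(3)]) (simp add: EW)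
    show "anchor A q v (\<lambda>q. f q * ccrd c q i) = anchor A q v (\<lambda>q. ccrd c q i)"
      if "q \<in> W" "v \<in> fibre A q" for i q v
      by (rule anchor_germ[OF that(2) UNIV_I X _ smooth_fun_coord[OF c] fK(5) that(1)])
         (use KW that fK(8) in auto)
  qed
qed

text \<open>The smoothness axiom for the anchor concerns global sections and global functions, so
  frame and coordinate are replaced by their substitutes near each point.\<close>

lemma anchor_fun_smooth:
  assumes c: "c \<in> atlas A" and \<alpha>: "\<alpha> < brank A"
  shows "smooth_fun A (cdom c) (anchor_fun c i \<alpha>)"
proof (rule smooth_fun_local[OF _ open_cdom[OF c]])
  fix p assume p: "p \<in> cdom c"
  show "\<exists>W. p \<in> W \<and> smooth_fun A W (anchor_fun c i \<alpha>)"
  proof (rule local_frame[OF c p])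
    fix W f K E
    assume W: "open W" "p \<in> W" "W \<subseteq> cdom c"
      and E: "\<And>\<alpha>. \<alpha> < brank A \<Longrightarrow> E \<alpha> \<in> sections A" "\<And>\<alpha> q. q \<in> W \<Longrightarrow> E \<alpha> q = cfrm c \<alpha> q"
      and X: "\<And>i. smooth_fun A UNIV (\<lambda>q. f q * ccrd c q i)"
        "\<And>i q v. q \<in> W \<Longrightarrow> v \<in> fibre A q \<Longrightarrow>
          anchor A q v (\<lambda>q. f q * ccrd c q i) = anchor A q v (\<lambda>q. ccrd c q i)"
    have "smooth_fun A W (\<lambda>q. anchor A q (E \<alpha> q) (\<lambda>q. f q * ccrd c q i))"
      by (rule smooth_fun_subset[OF anchor_smooth[OF E(1)[OF \<alpha>] X(1)] W(1) subset_UNIV])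
    then have "smooth_fun A W (anchor_fun c i \<alpha>)"
    proof (rule smooth_fun_cong[rotated])
      fix q assume q: "q \<in> W"
      have "cfrm c \<alpha> q \<in> fibre A q" by (rule frame_in_fibre[OF c _ \<alpha>]) (use q W in auto)
      then show "anchor A q (E \<alpha> q) (\<lambda>q. f q * ccrd c q i) = anchor_fun c i \<alpha> q"
        unfolding anchor_fun_def E(2)[OF q] by (rule X(2)[OF q])
    qed
    then show ?thesis using W(2) by blast
  qed
qed

lemma struct_fun_smooth:
  assumes c: "c \<in> atlas A" and \<alpha>: "\<alpha> < brank A" "\<beta> < brank A" "\<gamma> < brank A"
  shows "smooth_fun A (cdom c) (struct_fun c \<gamma> \<alpha> \<beta>)"
proof (rule smooth_fun_local[OF _ open_cdom[OF c]])
  fix p assume p: "p \<in> cdom c"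
  show "\<exists>W. p \<in> W \<and> smooth_fun A W (struct_fun c \<gamma> \<alpha> \<beta>)"
  proof (rule local_frame[OF c p])
    fix W f K E
    assume W: "open W" "p \<in> W" "W \<subseteq> cdom c"
      and E: "\<And>\<alpha>. \<alpha> < brank A \<Longrightarrow> E \<alpha> \<in> sections A"
      and B: "\<And>\<alpha> \<beta> q. \<alpha> < brank A \<Longrightarrow> \<beta> < brank A \<Longrightarrow> q \<in> W \<Longrightarrow>
        local_bracket A (cfrm c \<alpha>) (cfrm c \<beta>) q = bracket A (E \<alpha>) (E \<beta>) q"
    have "smooth_fun A W (\<lambda>q. coframe A c \<gamma> q (bracket A (E \<alpha>) (E \<beta>) q))"
      by (rule smooth_fun_subset[OF section_smooth[OF bracket_section[OF E[OF \<alpha>(1)] E[OF \<alpha>(2)]] c \<alpha>(3)] W(1,3)])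
    then have "smooth_fun A W (struct_fun c \<gamma> \<alpha> \<beta>)"
      by (rule smooth_fun_cong[rotated]) (simp add: struct_fun_def B[OF \<alpha>(1,2)])
    then show ?thesis using W(2) by blast
  qed
qed

lemma struct_fun_skew:
  assumes c: "c \<in> atlas A" and p: "p \<in> cdom c" and \<alpha>: "\<alpha> < brank A" "\<beta> < brank A"
  shows "struct_fun c \<gamma> \<alpha> \<beta> p = - struct_fun c \<gamma> \<beta> \<alpha> p"
proof (rule local_frame[OF c p])
  fix W f K E
  assume W: "open W" "p \<in> W" "W \<subseteq> cdom c"
    and E: "\<And>\<alpha>. \<alpha> < brank A \<Longrightarrow> E \<alpha> \<in> sections A"
    and B: "\<And>\<alpha> \<beta> q. \<alpha> < brank A \<Longrightarrow> \<beta> < brank A \<Longrightarrow> q \<in> W \<Longrightarrow>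
      local_bracket A (cfrm c \<alpha>) (cfrm c \<beta>) q = bracket A (E \<alpha>) (E \<beta>) q"
  have "bracket A (E \<alpha>) (E \<beta>) p = (- 1) *\<^sub>R bracket A (E \<beta>) (E \<alpha>) p"
    using fun_cong[OF bracket_skew[OF E[OF \<alpha>(1)] E[OF \<alpha>(2)]], of p] by simp
  then show ?thesis
    unfolding struct_fun_def B[OF \<alpha> W(2)] B[OF \<alpha>(2,1) W(2)]
    using coframe_scale[OF c p section_fibre[OF bracket_section[OF E[OF \<alpha>(2)] E[OF \<alpha>(1)]]], of \<gamma> "- 1"] by simp
qed

text \<open>The axiom on the anchor of a bracket, applied to two extended frame elements and an
  extended coordinate. Locality lets the local anchor functions be differentiated in place of their
  global counterparts.\<close>

lemma anchor_structure:
  assumes c: "c \<in> atlas A" and p: "p \<in> cdom c" and \<alpha>: "\<alpha> < brank A" "\<beta> < brank A"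
  shows "(\<Sum>j<bdim A. anchor_fun c j \<alpha> p * cpd c j (anchor_fun c i \<beta>) p) - (\<Sum>j<bdim A. anchor_fun c j \<beta> p * cpd c j (anchor_fun c i \<alpha>) p)
    = (\<Sum>\<gamma><brank A. struct_fun c \<gamma> \<alpha> \<beta> p * anchor_fun c i \<gamma> p)"
proof (rule local_frame[OF c p])
  fix W f K E
  assume W: "open W" "p \<in> W" "W \<subseteq> cdom c"
    and E: "\<And>\<alpha>. \<alpha> < brank A \<Longrightarrow> E \<alpha> \<in> sections A" "\<And>\<alpha> q. q \<in> W \<Longrightarrow> E \<alpha> q = cfrm c \<alpha> q"
    and B: "\<And>\<alpha> \<beta> q. \<alpha> < brank A \<Longrightarrow> \<beta> < brank A \<Longrightarrow> q \<in> W \<Longrightarrow>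
      local_bracket A (cfrm c \<alpha>) (cfrm c \<beta>) q = bracket A (E \<alpha>) (E \<beta>) q"
    and X: "\<And>i. smooth_fun A UNIV (\<lambda>q. f q * ccrd c q i)"
      "\<And>i q v. q \<in> W \<Longrightarrow> v \<in> fibre A q \<Longrightarrow>
        anchor A q v (\<lambda>q. f q * ccrd c q i) = anchor A q v (\<lambda>q. ccrd c q i)"
  let ?X = "\<lambda>q. f q * ccrd c q i"
  have rhoX: "anchor A q (E \<beta> q) ?X = anchor_fun c i \<beta> q" if "q \<in> W" "\<beta> < brank A" for q \<beta>
  proof -
    have "cfrm c \<beta> q \<in> fibre A q" by (rule frame_in_fibre[OF c _ that(2)]) (use that W in auto)
    then show ?thesis unfolding anchor_fun_def E(2)[OF that(1)] by (rule X(2)[OF that(1)])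
  qed
  have D: "(\<Sum>j<bdim A. anchor_fun c j \<alpha> p * cpd c j (anchor_fun c i \<beta>) p) = anchor A p (E \<alpha> p) (\<lambda>q. anchor A q (E \<beta> q) ?X)"
    if "\<alpha> < brank A" "\<beta> < brank A" for \<alpha> \<beta>
  proof -
    have e: "cfrm c \<alpha> p \<in> fibre A p" by (rule frame_in_fibre[OF c p that(1)])
    have "(\<Sum>j<bdim A. anchor_fun c j \<alpha> p * cpd c j (anchor_fun c i \<beta>) p) = anchor A p (cfrm c \<alpha> p) (anchor_fun c i \<beta>)"
      unfolding anchor_fun_def[of c _ \<alpha>] by (rule anchor_expansion[OF c p e p anchor_fun_smooth[OF c that(2)], symmetric])
    also have "\<dots> = anchor A p (cfrm c \<alpha> p) (\<lambda>q. anchor A q (E \<beta> q) ?X)"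
      by (rule anchor_germ[OF e p anchor_fun_smooth[OF c that(2)] UNIV_I anchor_smooth[OF E(1)[OF that(2)] X(1)] W(1,2)])
         (simp add: rhoX that(2))
    finally show ?thesis unfolding E(2)[OF W(2)] .
  qed
  have bf: "bracket A (E \<alpha>) (E \<beta>) p \<in> fibre A p"
    by (rule section_fibre[OF bracket_section[OF E(1)[OF \<alpha>(1)] E(1)[OF \<alpha>(2)]]])
  have "(\<Sum>j<bdim A. anchor_fun c j \<alpha> p * cpd c j (anchor_fun c i \<beta>) p) - (\<Sum>j<bdim A. anchor_fun c j \<beta> p * cpd c j (anchor_fun c i \<alpha>) p)
    = anchor A p (bracket A (E \<alpha>) (E \<beta>) p) ?X"
    unfolding D[OF \<alpha>] D[OF \<alpha>(2,1)] by (rule anchor_bracket[OF E(1)[OF \<alpha>(1)] E(1)[OF \<alpha>(2)] X(1), symmetric])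
  also have "bracket A (E \<alpha>) (E \<beta>) p = (\<Sum>\<gamma><brank A. struct_fun c \<gamma> \<alpha> \<beta> p *\<^sub>R cfrm c \<gamma> p)"
    unfolding struct_fun_def B[OF \<alpha> W(2)] by (rule frame_expansion[OF c p bf])
  also have "anchor A p \<dots> ?X = (\<Sum>\<gamma><brank A. struct_fun c \<gamma> \<alpha> \<beta> p * anchor A p (cfrm c \<gamma> p) ?X)"
    by (rule anchor_sum[OF UNIV_I X(1)]) (use frame_in_fibre[OF c p] in simp)
  also have "\<dots> = (\<Sum>\<gamma><brank A. struct_fun c \<gamma> \<alpha> \<beta> p * anchor_fun c i \<gamma> p)"
    by (intro sum.cong refl) (use rhoX[OF W(2)] E(2)[OF W(2)] in simp)
  finally show ?thesis .
qed

text \<open>The \<gamma>-component of the Jacobi identity for the extended frame. The inner bracket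
  is expanded in the frame, and the Leibniz rule yields a quadratic term in the structure functions
  and a derivative of one of them.\<close>

lemma jacobi_structure:
  assumes c: "c \<in> atlas A" and p: "p \<in> cdom c"
    and \<gamma>: "\<gamma> < brank A" and \<alpha>: "\<alpha> < brank A" "\<beta> < brank A" "\<delta> < brank A"
  shows "((\<Sum>j<bdim A. anchor_fun c j \<alpha> p * cpd c j (struct_fun c \<gamma> \<beta> \<delta>) p) + (\<Sum>\<epsilon><brank A. struct_fun c \<gamma> \<alpha> \<epsilon> p * struct_fun c \<epsilon> \<beta> \<delta> p)) +
      ((\<Sum>j<bdim A. anchor_fun c j \<beta> p * cpd c j (struct_fun c \<gamma> \<delta> \<alpha>) p) + (\<Sum>\<epsilon><brank A. struct_fun c \<gamma> \<beta> \<epsilon> p * struct_fun c \<epsilon> \<delta> \<alpha> p)) +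
      ((\<Sum>j<bdim A. anchor_fun c j \<delta> p * cpd c j (struct_fun c \<gamma> \<alpha> \<beta>) p) + (\<Sum>\<epsilon><brank A. struct_fun c \<gamma> \<delta> \<epsilon> p * struct_fun c \<epsilon> \<alpha> \<beta> p)) = 0"
proof (rule local_frame[OF c p])
  fix W f K E
  assume W: "open W" "p \<in> W" "W \<subseteq> cdom c"
    and f: "smooth_fun A UNIV f" "closed K" "K \<subseteq> cdom c"
      "\<And>q. q \<notin> K \<Longrightarrow> f q = 0" "\<And>q. q \<in> W \<Longrightarrow> f q = 1"
    and E: "\<And>\<alpha>. \<alpha> < brank A \<Longrightarrow> E \<alpha> \<in> sections A" "\<And>\<alpha> q. q \<in> W \<Longrightarrow> E \<alpha> q = cfrm c \<alpha> q"
    and B: "\<And>\<alpha> \<beta> q. \<alpha> < brank A \<Longrightarrow> \<beta> < brank A \<Longrightarrow> q \<in> W \<Longrightarrow>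
      local_bracket A (cfrm c \<alpha>) (cfrm c \<beta>) q = bracket A (E \<alpha>) (E \<beta>) q"
  let ?r = "brank A"
  have EE: "bracket A (E \<alpha>) (E \<beta>) \<in> sections A" if "\<alpha> < ?r" "\<beta> < ?r" for \<alpha> \<beta>
    by (rule bracket_section[OF E(1)[OF that(1)] E(1)[OF that(2)]])
  have J: "coframe A c \<gamma> p (bracket A (E \<alpha>) (bracket A (E \<beta>) (E \<delta>)) p)
    = (\<Sum>j<bdim A. anchor_fun c j \<alpha> p * cpd c j (struct_fun c \<gamma> \<beta> \<delta>) p) + (\<Sum>\<epsilon><?r. struct_fun c \<gamma> \<alpha> \<epsilon> p * struct_fun c \<epsilon> \<beta> \<delta> p)"
    if \<alpha>: "\<alpha> < ?r" "\<beta> < ?r" "\<delta> < ?r" for \<alpha> \<beta> \<delta>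
  proof -
    let ?s = "bracket A (E \<beta>) (E \<delta>)"
    \<comment> \<open>The Leibniz axiom asks for globally smooth coefficients, so the components of
      the inner bracket are multiplied by f and thereby extended by zero.\<close>
    define h where "h \<epsilon> = (\<lambda>q. f q * coframe A c \<epsilon> q (?s q))" for \<epsilon>
    have h: "smooth_fun A UNIV (h \<epsilon>)" if "\<epsilon> < ?r" for \<epsilon>
      unfolding h_def by (rule smooth_fun_extend[OF f(1,2,4,3) section_smooth[OF EE[OF \<alpha>(2,3)] c that]])
    have hW: "h \<epsilon> q = struct_fun c \<epsilon> \<beta> \<delta> q" if "q \<in> W" for \<epsilon> q
      unfolding h_def struct_fun_def B[OF \<alpha>(2,3) that] by (simp add: f(5)[OF that])
    have hE: "(\<lambda>q. h \<epsilon> q *\<^sub>R E \<epsilon> q) \<in> sections A" if "\<epsilon> < ?r" for \<epsilon>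
      by (rule section_scale[OF h[OF that] E(1)[OF that]])
    have e: "cfrm c \<alpha> p \<in> fibre A p" by (rule frame_in_fibre[OF c p \<alpha>(1)])
    have "bracket A (E \<alpha>) ?s p = bracket A (E \<alpha>) (\<lambda>q. \<Sum>\<epsilon><?r. h \<epsilon> q *\<^sub>R E \<epsilon> q) p"
    proof (rule bracket_germ_right[OF E(1)[OF \<alpha>(1)] EE[OF \<alpha>(2,3)] _ W(1,2)])
      show "(\<lambda>q. \<Sum>\<epsilon><?r. h \<epsilon> q *\<^sub>R E \<epsilon> q) \<in> sections A"
        by (rule section_sum) (use hE in simp)
      fix q assume q: "q \<in> W"
      then have "?s q = (\<Sum>\<epsilon><?r. coframe A c \<epsilon> q (?s q) *\<^sub>R cfrm c \<epsilon> q)"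
        using W(3) by (intro frame_expansion[OF c] section_fibre[OF EE[OF \<alpha>(2,3)]]) auto
      also have "\<dots> = (\<Sum>\<epsilon><?r. h \<epsilon> q *\<^sub>R E \<epsilon> q)"
        by (simp add: h_def f(5)[OF q] E(2)[OF q])
      finally show "?s q = (\<Sum>\<epsilon><?r. h \<epsilon> q *\<^sub>R E \<epsilon> q)" .
    qed
    also have "\<dots> = (\<Sum>\<epsilon><?r. bracket A (E \<alpha>) (\<lambda>q. h \<epsilon> q *\<^sub>R E \<epsilon> q) p)"
      using hE by (subst bracket_sum_right[OF E(1)[OF \<alpha>(1)]]) simp_all
    also have "\<dots> = (\<Sum>\<epsilon><?r. h \<epsilon> p *\<^sub>R bracket A (E \<alpha>) (E \<epsilon>) p + anchor A p (E \<alpha> p) (h \<epsilon>) *\<^sub>R E \<epsilon> p)"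
      by (intro sum.cong refl) (simp add: bracket_leibniz[OF E(1)[OF \<alpha>(1)] E(1) h])
    finally have "coframe A c \<gamma> p (bracket A (E \<alpha>) ?s p) = (\<Sum>\<epsilon><?r. coframe A c \<gamma> p
        (h \<epsilon> p *\<^sub>R bracket A (E \<alpha>) (E \<epsilon>) p + anchor A p (E \<alpha> p) (h \<epsilon>) *\<^sub>R E \<epsilon> p))"
      by (simp only:)
         (rule coframe_sum[OF c p], intro subspace_add subspace_scale subspace_fibre section_fibre EE E(1) \<alpha>(1), simp_all)
    \<comment> \<open>At p the sections E coincide with the frame, so in the \<gamma>-component the
      derivative term survives for \<epsilon> = \<gamma> only.\<close>
    also have "\<dots> = (\<Sum>\<epsilon><?r. struct_fun c \<gamma> \<alpha> \<epsilon> p * struct_fun c \<epsilon> \<beta> \<delta> p + (if \<epsilon> = \<gamma> then anchor A p (E \<alpha> p) (h \<epsilon>) else 0))"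
    proof (intro sum.cong refl)
      fix \<epsilon> assume "\<epsilon> \<in> {..<?r}"
      then have \<epsilon>: "\<epsilon> < ?r" by simp
      have "coframe A c \<gamma> p (h \<epsilon> p *\<^sub>R bracket A (E \<alpha>) (E \<epsilon>) p + anchor A p (E \<alpha> p) (h \<epsilon>) *\<^sub>R E \<epsilon> p)
        = h \<epsilon> p * coframe A c \<gamma> p (bracket A (E \<alpha>) (E \<epsilon>) p) + anchor A p (E \<alpha> p) (h \<epsilon>) * coframe A c \<gamma> p (E \<epsilon> p)"
        using section_fibre[OF EE[OF \<alpha>(1) \<epsilon>]] section_fibre[OF E(1)[OF \<epsilon>]]
        by (simp add: coframe_add[OF c p] coframe_scale[OF c p] subspace_scale[OF subspace_fibre])
      then show "coframe A c \<gamma> p (h \<epsilon> p *\<^sub>R bracket A (E \<alpha>) (E \<epsilon>) p + anchor A p (E \<alpha> p) (h \<epsilon>) *\<^sub>R E \<epsilon> p)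
        = struct_fun c \<gamma> \<alpha> \<epsilon> p * struct_fun c \<epsilon> \<beta> \<delta> p + (if \<epsilon> = \<gamma> then anchor A p (E \<alpha> p) (h \<epsilon>) else 0)"
        by (simp add: hW[OF W(2)] E(2)[OF W(2)] coframe_frame[OF c p \<gamma> \<epsilon>] struct_fun_def[of c \<gamma> \<alpha>] B[OF \<alpha>(1) \<epsilon> W(2)])
    qed
    also have "\<dots> = (\<Sum>\<epsilon><?r. struct_fun c \<gamma> \<alpha> \<epsilon> p * struct_fun c \<epsilon> \<beta> \<delta> p) + anchor A p (E \<alpha> p) (h \<gamma>)"
      using \<gamma> by (simp add: sum.distrib)
    also have "anchor A p (E \<alpha> p) (h \<gamma>) = anchor A p (cfrm c \<alpha> p) (struct_fun c \<gamma> \<beta> \<delta>)"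
      unfolding E(2)[OF W(2)]
      by (rule anchor_germ[OF e UNIV_I h[OF \<gamma>] p struct_fun_smooth[OF c \<alpha>(2,3) \<gamma>] W(1,2) hW])
    also have "\<dots> = (\<Sum>j<bdim A. anchor_fun c j \<alpha> p * cpd c j (struct_fun c \<gamma> \<beta> \<delta>) p)"
      unfolding anchor_fun_def by (rule anchor_expansion[OF c p e p struct_fun_smooth[OF c \<alpha>(2,3) \<gamma>]])
    finally show ?thesis by simp
  qed
  let ?b = "\<lambda>\<alpha> \<beta> \<delta>. bracket A (E \<alpha>) (bracket A (E \<beta>) (E \<delta>)) p"
  have bf: "?b \<alpha> \<beta> \<delta> \<in> fibre A p" if "\<alpha> < ?r" "\<beta> < ?r" "\<delta> < ?r" for \<alpha> \<beta> \<delta>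
    by (rule section_fibre[OF bracket_section[OF E(1)[OF that(1)] EE[OF that(2,3)]]])
  have "coframe A c \<gamma> p (?b \<alpha> \<beta> \<delta>) + coframe A c \<gamma> p (?b \<beta> \<delta> \<alpha>) + coframe A c \<gamma> p (?b \<delta> \<alpha> \<beta>)
    = coframe A c \<gamma> p (?b \<alpha> \<beta> \<delta> + ?b \<beta> \<delta> \<alpha> + ?b \<delta> \<alpha> \<beta>)"
    using bf[OF \<alpha>] bf[OF \<alpha>(2,3,1)] bf[OF \<alpha>(3,1,2)]
    by (simp add: coframe_add[OF c p] subspace_add[OF subspace_fibre])
  also have "?b \<alpha> \<beta> \<delta> + ?b \<beta> \<delta> \<alpha> + ?b \<delta> \<alpha> \<beta> = 0"
    by (rule bracket_jacobi[OF E(1)[OF \<alpha>(1)] E(1)[OF \<alpha>(2)] E(1)[OF \<alpha>(3)]])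
  finally show ?thesis
    unfolding J[OF \<alpha>] J[OF \<alpha>(2,3,1)] J[OF \<alpha>(3,1,2)] coframe_zero .
qed

lemma lie_structure_chart:
  assumes c: "c \<in> atlas A"
  shows "lie_structure (bdim A) (brank A) (cdom c) (chart_smooth A c (cdom c)) (cpd c) (anchor_fun c) (struct_fun c)"
proof
  note U = open_cdom[OF c]
  fix f g :: "'m \<Rightarrow> real" and a i p
  show "chart_smooth A c (cdom c) (\<lambda>_. a)" by (rule chart_smooth_const[OF c])
  show "chart_smooth A c (cdom c) (\<lambda>p. f p + g p)" "chart_smooth A c (cdom c) (\<lambda>p. f p * g p)"
    if "chart_smooth A c (cdom c) f" "chart_smooth A c (cdom c) g"
    using that by (rule chart_smooth_add[OF c U], rule chart_smooth_mult[OF c U])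
  show "chart_smooth A c (cdom c) (cpd c i f)" if "i < bdim A" "chart_smooth A c (cdom c) f"
    by (rule chart_smooth_cpd[OF c U that(2,1)])
  show "chart_smooth A c (cdom c) g" if "\<And>p. p \<in> cdom c \<Longrightarrow> f p = g p" "chart_smooth A c (cdom c) f"
    by (rule chart_smooth_cong[OF c U that(1) that(2)])
  show "cpd c i (\<lambda>_. a) p = 0" by (rule cpd_const[OF c])
  show "cpd c i (\<lambda>q. f q + g q) p = cpd c i f p + cpd c i g p"
    "cpd c i (\<lambda>q. f q * g q) p = cpd c i f p * g p + f p * cpd c i g p"
    if "i < bdim A" "chart_smooth A c (cdom c) f" "chart_smooth A c (cdom c) g" "p \<in> cdom c"
    using cpd_add[OF c that(2,3,4,4,1)] cpd_mult[OF c that(2,3,4,4,1)] .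
  show "cpd c i f p = cpd c i g p" if "i < bdim A" "\<And>q. q \<in> cdom c \<Longrightarrow> f q = g q" "p \<in> cdom c"
    by (rule cpd_cong[OF c U that(3,3,1) that(2)])
  show "chart_smooth A c (cdom c) (anchor_fun c i \<alpha>)" if "\<alpha> < brank A" for \<alpha>
    by (rule smooth_fun_chart[OF anchor_fun_smooth[OF c that] c])
  show "chart_smooth A c (cdom c) (struct_fun c \<gamma> \<alpha> \<beta>)" if "\<gamma> < brank A" "\<alpha> < brank A" "\<beta> < brank A" for \<gamma> \<alpha> \<beta>
    by (rule smooth_fun_chart[OF struct_fun_smooth[OF c that(2,3,1)] c])
  show "struct_fun c \<gamma> \<alpha> \<beta> p = - struct_fun c \<gamma> \<beta> \<alpha> p" if "\<alpha> < brank A" "\<beta> < brank A" "p \<in> cdom c" for \<gamma> \<alpha> \<beta>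
    by (rule struct_fun_skew[OF c that(3,1,2)])
  show "(\<Sum>j<bdim A. anchor_fun c j \<alpha> p * cpd c j (anchor_fun c i \<beta>) p) - (\<Sum>j<bdim A. anchor_fun c j \<beta> p * cpd c j (anchor_fun c i \<alpha>) p)
    = (\<Sum>\<gamma><brank A. struct_fun c \<gamma> \<alpha> \<beta> p * anchor_fun c i \<gamma> p)" if "\<alpha> < brank A" "\<beta> < brank A" "p \<in> cdom c" for \<alpha> \<beta>
    by (rule anchor_structure[OF c that(3,1,2)])
qed (rule jacobi_structure[OF c])

end

section \<open>The operators in a chart\<close>

definition mono_coeff :: "nat set \<Rightarrow> nat multiset \<Rightarrow> spoly" where
  "mono_coeff T k = (\<lambda>S m. if S = T \<and> m = k then 1 else 0)"

lemma finite_submultisets: "finite {k. k \<subseteq># m}"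
proof (rule finite_subset)
  show "{k. k \<subseteq># m} \<subseteq> mset ` {xs. set xs \<subseteq> set_mset m \<and> length xs \<le> size m}"
  proof
    fix k assume k: "k \<in> {k. k \<subseteq># m}"
    obtain xs where "k = mset xs" by (metis ex_mset)
    then show "k \<in> mset ` {xs. set xs \<subseteq> set_mset m \<and> length xs \<le> size m}"
      using k set_mset_mono[of k m] size_mset_mono[of k m] by auto
  qed
qed (simp add: finite_lists_length_le)

text \<open>With a monomial as left factor a single summand of the double sum survives. At infinite
  S the sum over \<open>Pow S\<close> has the default value 0.\<close>

lemma smul_mono_coeff:
  "smul (mono_coeff T k) H S m = (if finite S \<and> T \<subseteq> S \<and> k \<subseteq># m
    then (-1) ^ card {(a, b). a \<in> T \<and> b \<in> S - T \<and> b < a} * H (S - T) (m - k) else 0)"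
proof (cases "finite S")
  case True
  let ?s = "\<lambda>T'. (-1) ^ card {(a, b). a \<in> T' \<and> b \<in> S - T' \<and> b < a} :: real"
  have "smul (mono_coeff T k) H S m = (\<Sum>T'\<in>Pow S. \<Sum>k'\<in>{k'. k' \<subseteq># m}.
      if k' = k then (if T' = T then ?s T * H (S - T) (m - k) else 0) else 0)"
    unfolding smul_def by (intro sum.cong refl) (simp add: mono_coeff_def)
  also have "\<dots> = (\<Sum>T'\<in>Pow S. if T' = T then (if k \<subseteq># m then ?s T * H (S - T) (m - k) else 0) else 0)"
    by (intro sum.cong refl) (simp add: sum.delta[OF finite_submultisets])
  also have "\<dots> = (if T \<subseteq> S \<and> k \<subseteq># m then ?s T * H (S - T) (m - k) else 0)"
    using True by (simp add: sum.delta)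
  finally show ?thesis using True by simp
qed (simp add: smul_def)

lemma smul_linear_left:
  "smul (\<lambda>S m. \<Sum>i\<in>I. a i * X i S m) H S m = (\<Sum>i\<in>I. a i * smul (X i) H S m)"
proof -
  have "smul (\<lambda>S m. \<Sum>i\<in>I. a i * X i S m) H S m = (\<Sum>T\<in>Pow S. \<Sum>k\<in>{k. k \<subseteq># m}. \<Sum>i\<in>I.
      a i * ((-1) ^ card {(a, b). a \<in> T \<and> b \<in> S - T \<and> b < a} * X i T k * H (S - T) (m - k)))"
    unfolding smul_def by (simp add: sum_distrib_left sum_distrib_right mult_ac)
  also have "\<dots> = (\<Sum>i\<in>I. \<Sum>T\<in>Pow S. \<Sum>k\<in>{k. k \<subseteq># m}.
      a i * ((-1) ^ card {(a, b). a \<in> T \<and> b \<in> S - T \<and> b < a} * X i T k * H (S - T) (m - k)))"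
    by (rule sum_rotate3)
  finally show ?thesis unfolding smul_def by (simp add: sum_distrib_left)
qed

text \<open>\<open>smul\<close> yields 0 at every infinite index set, whatever the factors are,
  while \<open>odd_mul\<close> and \<open>even_mul\<close> have no such default. On families with
  this property they agree.\<close>

definition finite_odd_support :: "('m \<Rightarrow> spoly) \<Rightarrow> bool" where
  "finite_odd_support G \<longleftrightarrow> (\<forall>p S m. G p S m \<noteq> 0 \<longrightarrow> finite S)"

lemma finite_odd_supportD: "finite_odd_support G \<Longrightarrow> infinite S \<Longrightarrow> G p S m = 0"
  unfolding finite_odd_support_def by blast

lemma smul_mono_coeff_single:
  assumes "finite_odd_support G" shows "smul (mono_coeff {k} {#}) (G p) S m = odd_mul k G p S m"
proof -
  have "card {(a, b). a \<in> {k} \<and> b \<in> S - {k} \<and> b < a} = card (Pair k ` {j \<in> S. j < k})"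
    by (rule arg_cong[where f = card]) auto
  also have "\<dots> = card {j \<in> S. j < k}" by (rule card_image) (simp add: inj_on_def)
  finally show ?thesis
    using finite_odd_supportD[OF assms, of "S - {k}"] by (simp add: smul_mono_coeff odd_mul_def osgn_def)
qed

lemma smul_odd_gen:
  assumes "finite_odd_support G" shows "smul (odd_gen k) (G p) = odd_mul k G p"
proof -
  have "odd_gen k = mono_coeff {k} {#}" by (simp add: odd_gen_def mono_coeff_def)
  then show ?thesis by (simp only:) (intro ext smul_mono_coeff_single[OF assms])
qed

lemma smul_even_gen:
  assumes "finite_odd_support G" shows "smul (even_gen k) (G p) = even_mul k G p"
proof -
  have eq: "even_gen k = mono_coeff {} {#k#}" by (simp add: even_gen_def mono_coeff_def)
  show ?thesis
    unfolding eq
  proof (intro ext)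
    fix S m
    show "smul (mono_coeff {} {#k#}) (G p) S m = even_mul k G p S m"
      using finite_odd_supportD[OF assms] by (simp add: smul_mono_coeff even_mul_def)
  qed
qed

lemma smul_mono_coeff_pair:
  assumes G: "finite_odd_support G" and kl: "k < l"
  shows "smul (mono_coeff {k, l} {#}) (G p) S m = odd_mul k (odd_mul l G) p S m"
proof (cases "finite S \<and> k \<in> S \<and> l \<in> S")
  case True
  let ?B = "\<lambda>a. {b \<in> S - {k, l}. b < a}"
  have fin: "finite (?B a)" for a using True by simp
  \<comment> \<open>The inversions are sorted by their first entry. Those at l do not count k,
    although k lies below l, which gives the sign of l relative to S without k.\<close>
  have "card {(a, b). a \<in> {k, l} \<and> b \<in> S - {k, l} \<and> b < a} = card (Pair k ` ?B k \<union> Pair l ` ?B l)"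
    by (rule arg_cong[where f = card]) auto
  also have "\<dots> = card (Pair k ` ?B k) + card (Pair l ` ?B l)"
    using kl fin by (intro card_Un_disjoint) auto
  also have "card (Pair k ` ?B k) = card (?B k)" by (rule card_image) (simp add: inj_on_def)
  also have "card (Pair l ` ?B l) = card (?B l)" by (rule card_image) (simp add: inj_on_def)
  also have "?B k = {j \<in> S. j < k}" using kl by auto
  also have "?B l = {j \<in> S - {k}. j < l}" using kl by auto
  finally have "(-1) ^ card {(a, b). a \<in> {k, l} \<and> b \<in> S - {k, l} \<and> b < a} = osgn k S * osgn l (S - {k})"
    by (simp only: osgn_def power_add)
  moreover have "S - {k} - {l} = S - {k, l}" by auto
  ultimately show ?thesis using True kl by (simp add: smul_mono_coeff odd_mul_def)
next
  case False
  have "S - {k} - {l} = S - {k, l}" by auto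
  then show ?thesis
    using False kl finite_odd_supportD[OF G, of "S - {k, l}"] by (auto simp: smul_mono_coeff odd_mul_def)
qed

section \<open>Coordinate form of the global operators\<close>

context algebroid_ctx
begin

context
  fixes c assumes c: "c \<in> atlas A"
begin

interpretation lie_structure "bdim A" "brank A" "cdom c" "chart_smooth A c (cdom c)" "cpd c" "anchor_fun c" "struct_fun c"
  by (rule lie_structure_chart[OF c])

lemma sfuns_finite_odd_support: "G \<in> sfuns \<Longrightarrow> finite_odd_support G"
  unfolding finite_odd_support_def
  by (elim sfuns_bounded) (meson finite_lessThan finite_subset)

lemma de_rham_chart:
  assumes F: "F c \<in> sfuns" shows "de_rham A F c = dform (F c)"
proof (rule ext)
  fix p
  show "de_rham A F c p = dform (F c) p"
  proof (cases "p \<in> cdom c")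
    case True
    have "smul (gen_xdot A i) (\<lambda>S m. cpd c i (\<lambda>q. F c q S m) p) = odd_mul (brank A + i) (coeff_D i (F c)) p"
      if "i < bdim A" for i
    proof -
      have "(\<lambda>S m. cpd c i (\<lambda>q. F c q S m) p) = coeff_D i (F c) p" using True by (simp add: coeff_D_def)
      then show ?thesis
        using smul_odd_gen[OF sfuns_finite_odd_support[OF sfuns_coeff_D[OF F that]]] by simp
    qed
    moreover have "smul (gen_lamdot \<alpha>) (odd_pd \<alpha> (F c p)) = even_mul \<alpha> (odd_der \<alpha> (F c)) p" for \<alpha>
      using smul_even_gen[OF sfuns_finite_odd_support[OF sfuns_odd_der[OF F]]] by (simp add: odd_der_def)
    ultimately show ?thesis
      using True c by (simp add: de_rham_def on_charts_def local_d_def dform_def fun_ops sum_fun_app)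
  next
    case False
    then show ?thesis using sfuns_outside[OF sfuns_dform[OF F]]
      by (simp add: de_rham_def on_charts_def fun_eq_iff fun_ops)
  qed
qed

text \<open>On a 0-form the Koszul formula consists of the anchor term alone, so the coefficient of
  \<lambda>^\<alpha> is the anchor of the frame element applied to x^i.\<close>

lemma x_comp_chart:
  assumes p: "p \<in> cdom c"
  shows "x_comp (algebroid_vfield A) i c p = (\<lambda>S m. \<Sum>\<alpha><brank A. anchor_fun c i \<alpha> p * mono_coeff {\<alpha>} {#} S m)"
proof (intro ext)
  fix S m
  let ?X = "x_comp (algebroid_vfield A) i c p S m"
  have X: "?X = (if m = {#} \<and> S \<subseteq> {..<brank A} \<and> card S = 1
      then algebroid_diff A (\<lambda>_ p. ccrd c p i) (map (cfrm c) (sorted_list_of_set S)) p else 0)"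
    using c p by (simp add: algebroid_vfield_def form_sfun_def on_charts_def)
  show "?X = (\<Sum>\<alpha><brank A. anchor_fun c i \<alpha> p * mono_coeff {\<alpha>} {#} S m)"
  proof (cases "m = {#} \<and> S \<subseteq> {..<brank A} \<and> card S = 1")
    case True
    then obtain \<alpha> where \<alpha>: "S = {\<alpha>}" "\<alpha> < brank A" by (auto simp: card_1_singleton_iff)
    have "(\<Sum>\<beta><brank A. anchor_fun c i \<beta> p * mono_coeff {\<beta>} {#} S m) = (\<Sum>\<beta><brank A. if \<beta> = \<alpha> then anchor_fun c i \<alpha> p else 0)"
      using True \<alpha> by (intro sum.cong refl) (auto simp: mono_coeff_def)
    then show ?thesis using X True \<alpha> by (simp add: algebroid_diff_def remove_nth_def anchor_fun_def)
  next
    case False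
    then have "(\<Sum>\<beta><brank A. anchor_fun c i \<beta> p * mono_coeff {\<beta>} {#} S m) = 0"
      by (intro sum.neutral) (auto simp: mono_coeff_def)
    moreover have "?X = 0" unfolding X using False by (rule if_not_P)
    ultimately show ?thesis by (simp only:)
  qed
qed

text \<open>The dual coframe is constant on the frame, so both anchor terms of the Koszul formula
  vanish. The bracket term remains, with sign (-1)^(0+1): the Maurer-Cartan equation, with each pair
  counted once.\<close>

lemma lam_comp_chart:
  assumes p: "p \<in> cdom c" and \<gamma>: "\<gamma> < brank A"
  shows "lam_comp (algebroid_vfield A) \<gamma> c p = (\<lambda>S m. \<Sum>x\<in>{(\<alpha>, \<beta>). \<alpha> < \<beta> \<and> \<beta> < brank A}.
    - struct_fun c \<gamma> (fst x) (snd x) p * mono_coeff {fst x, snd x} {#} S m)" (is "_ = (\<lambda>S m. \<Sum>x\<in>?I. _ x S m)")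
proof (intro ext)
  fix S m
  let ?\<omega> = "\<lambda>ss p. coframe A c \<gamma> p (hd ss p)"
  let ?X = "lam_comp (algebroid_vfield A) \<gamma> c p S m"
  have X: "?X = (if m = {#} \<and> S \<subseteq> {..<brank A} \<and> card S = 2
      then algebroid_diff A ?\<omega> (map (cfrm c) (sorted_list_of_set S)) p else 0)"
    using c p by (simp add: algebroid_vfield_def form_sfun_def on_charts_def)
  have finI: "finite ?I"
    by (rule finite_subset[of _ "{..<brank A} \<times> {..<brank A}"]) auto
  show "?X = (\<Sum>x\<in>?I. - struct_fun c \<gamma> (fst x) (snd x) p * mono_coeff {fst x, snd x} {#} S m)"
  proof (cases "m = {#} \<and> S \<subseteq> {..<brank A} \<and> card S = 2")
    case True
    then obtain a b where "S = {a, b}" "a \<noteq> b" by (auto simp: card_2_iff)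
    then obtain \<alpha> \<beta> where \<alpha>: "S = {\<alpha>, \<beta>}" "\<alpha> < \<beta>" by (metis insert_commute nat_neq_iff)
    with True have \<beta>: "\<alpha> < brank A" "\<beta> < brank A" by auto
    have iff: "S = {fst x, snd x} \<longleftrightarrow> x = (\<alpha>, \<beta>)" if "x \<in> ?I" for x
      using that \<alpha> by (auto simp: doubleton_eq_iff)
    have "(\<Sum>x\<in>?I. - struct_fun c \<gamma> (fst x) (snd x) p * mono_coeff {fst x, snd x} {#} S m)
      = (\<Sum>x\<in>?I. if x = (\<alpha>, \<beta>) then - struct_fun c \<gamma> \<alpha> \<beta> p else 0)"
      by (intro sum.cong refl) (auto simp: mono_coeff_def iff True)
    also have "\<dots> = - struct_fun c \<gamma> \<alpha> \<beta> p"
      using finI \<alpha>(2) \<beta> by (simp add: sum.delta)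
    also have "\<dots> = algebroid_diff A ?\<omega> [cfrm c \<alpha>, cfrm c \<beta>] p"
    proof -
      have z: "anchor A p (cfrm c \<delta> p) (\<lambda>p. coframe A c \<gamma> p (cfrm c \<epsilon> p)) = 0"
        if "\<delta> < brank A" "\<epsilon> < brank A" for \<delta> \<epsilon>
        by (rule anchor_const[OF frame_in_fibre[OF c p that(1)] p open_cdom[OF c]])
           (rule coframe_frame[OF c _ \<gamma> that(2)])
      show ?thesis
        using z \<beta> by (simp add: algebroid_diff_def remove_nth_def numeral_2_eq_2 struct_fun_def)
    qed
    also have "\<dots> = ?X"
    proof -
      have "sorted_list_of_set S = [\<alpha>, \<beta>]" using \<alpha> by (simp add: insort_key.simps)
      then show ?thesis using X True by simp
    qed
    finally show ?thesis by simp
  next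
    case False
    have "mono_coeff {fst x, snd x} {#} S m = 0" if "x \<in> ?I" for x
      using that False by (auto simp: mono_coeff_def)
    then have "(\<Sum>x\<in>?I. - struct_fun c \<gamma> (fst x) (snd x) p * mono_coeff {fst x, snd x} {#} S m) = 0"
      by (intro sum.neutral) simp
    moreover have "?X = 0" unfolding X using False by (rule if_not_P)
    ultimately show ?thesis by (simp only:)
  qed
qed

text \<open>Skew coefficients and anticommuting generators make the two orders of a pair contribute
  equally, and the diagonal vanishes. This absorbs the factor 1/2 in \<open>q_fibre\<close>, which
  sums over all pairs, and meets the form of \<open>lam_comp_chart\<close>.\<close>

lemma q_fibre_ordered:
  assumes "G \<in> sfuns" "\<gamma> < brank A"
  shows "q_fibre \<gamma> G p S m = (\<Sum>x\<in>{(\<alpha>, \<beta>). \<alpha> < \<beta> \<and> \<beta> < brank A}.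
    - struct_fun c \<gamma> (fst x) (snd x) p * odd_mul (fst x) (odd_mul (snd x) G) p S m)"
proof (cases "p \<in> cdom c")
  case True
  let ?r = "brank A"
  let ?t = "\<lambda>x. - (1 / 2) * struct_fun c \<gamma> (fst x) (snd x) p * odd_mul (fst x) (odd_mul (snd x) G) p S m"
  let ?I = "{(\<alpha>, \<beta>). \<alpha> < \<beta> \<and> \<beta> < ?r}" and ?J = "{(\<alpha>, \<beta>). \<beta> < \<alpha> \<and> \<alpha> < ?r}" and ?D = "{(\<alpha>, \<beta>). \<alpha> = \<beta> \<and> \<alpha> < ?r}"
  have fin: "finite ?I" "finite ?J" "finite ?D"
    by (rule finite_subset[of _ "{..<?r} \<times> {..<?r}"]; auto)+
  have sym: "?t (\<beta>, \<alpha>) = ?t (\<alpha>, \<beta>)" if "\<alpha> < ?r" "\<beta> < ?r" for \<alpha> \<beta>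
    using struct_fun_skew[OF assms(2) that True] by (simp add: odd_mul_anticommute[of \<beta> \<alpha>] fun_ops)
  have "q_fibre \<gamma> G p S m = (\<Sum>\<alpha><?r. \<Sum>\<beta><?r. ?t (\<alpha>, \<beta>))"
    by (simp add: q_fibre_def sum_fun_app scale_def)
  also have "\<dots> = (\<Sum>x\<in>{..<?r} \<times> {..<?r}. ?t x)"
    unfolding sum.cartesian_product by (intro sum.cong refl) auto
  also have "{..<?r} \<times> {..<?r} = ?I \<union> (?J \<union> ?D)" by auto
  also have "sum ?t (?I \<union> (?J \<union> ?D)) = sum ?t ?I + (sum ?t ?J + sum ?t ?D)"
    using fin by (subst sum.union_disjoint; (subst sum.union_disjoint)?) auto
  also have "sum ?t ?D = 0"
  proof (rule sum.neutral, rule ballI)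
    fix x assume "x \<in> ?D"
    then obtain \<alpha> where x: "x = (\<alpha>, \<alpha>)" "\<alpha> < ?r" by auto
    from struct_fun_skew[OF assms(2) x(2) x(2) True] have "struct_fun c \<gamma> \<alpha> \<alpha> p = 0" by linarith
    then show "?t x = 0" by (simp add: x(1))
  qed
  also have "sum ?t ?J = sum ?t ?I"
    by (rule sum.reindex_bij_witness[of _ prod.swap prod.swap]) (use sym in \<open>auto\<close>)
  also have "sum ?t ?I + (sum ?t ?I + 0) = (\<Sum>x\<in>?I. - struct_fun c \<gamma> (fst x) (snd x) p * odd_mul (fst x) (odd_mul (snd x) G) p S m)"
    by (simp flip: sum.distrib)
  finally show ?thesis .
next
  case False
  have "odd_mul (fst x) (odd_mul (snd x) G) p S m = 0" for x
    using sfuns_outside[OF assms(1) False] by (simp add: odd_mul_def)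
  then show ?thesis using sfuns_outside[OF sfuns_q_fibre[OF assms] False] by simp
qed

lemma contraction_chart:
  assumes F: "F c \<in> sfuns" shows "contraction A (algebroid_vfield A) F c = iota (F c)"
proof (intro ext)
  fix p S m
  show "contraction A (algebroid_vfield A) F c p S m = iota (F c) p S m"
  proof (cases "p \<in> cdom c")
    case True
    have "smul (x_comp (algebroid_vfield A) i c p) (odd_pd (brank A + i) (F c p)) S m
        = q_base i (odd_der (brank A + i) (F c)) p S m" for i
      using smul_mono_coeff_single[OF sfuns_finite_odd_support[OF sfuns_odd_der[OF F]]]
      by (simp add: x_comp_chart[OF True] smul_linear_left q_base_def sum_fun_app scale_def odd_der_def)
    moreover have "smul (lam_comp (algebroid_vfield A) \<gamma> c p) (even_pd \<gamma> (F c p)) S m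
        = q_fibre \<gamma> (even_der \<gamma> (F c)) p S m" if "\<gamma> < brank A" for \<gamma>
    proof -
      have "smul (lam_comp (algebroid_vfield A) \<gamma> c p) (even_pd \<gamma> (F c p)) S m
        = (\<Sum>x\<in>{(\<alpha>, \<beta>). \<alpha> < \<beta> \<and> \<beta> < brank A}.
            - struct_fun c \<gamma> (fst x) (snd x) p * smul (mono_coeff {fst x, snd x} {#}) (even_der \<gamma> (F c) p) S m)"
        unfolding lam_comp_chart[OF True that] smul_linear_left even_der_def ..
      also have "\<dots> = q_fibre \<gamma> (even_der \<gamma> (F c)) p S m"
        unfolding q_fibre_ordered[OF sfuns_even_der[OF F] that]
        by (intro sum.cong refl)
           (auto simp: smul_mono_coeff_pair[OF sfuns_finite_odd_support[OF sfuns_even_der[OF F]]])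
      finally show ?thesis .
    qed
    ultimately show ?thesis
      using True c by (simp add: contraction_def on_charts_def iota_def fun_ops sum_fun_app)
  next
    case False
    then show ?thesis using sfuns_outside[OF sfuns_iota[OF F]]
      by (simp add: contraction_def on_charts_def fun_ops)
  qed
qed

text \<open>\<open>contraction_chart\<close> applies to members of \<open>sfuns\<close>, so the
  powers are compared by induction while staying in that space.\<close>

lemma mqk_chart:
  assumes F: "F c \<in> sfuns" shows "mqk A F c = exp_iota (F c)"
proof -
  have "(contraction A (algebroid_vfield A) ^^ k) F c = (iota ^^ k) (F c)" for k
  proof (induction k)
    case (Suc k)
    have "(contraction A (algebroid_vfield A) ^^ k) F c \<in> sfuns"
      unfolding Suc.IH by (rule sfuns_funpow[OF F])
    from contraction_chart[of "(contraction A (algebroid_vfield A) ^^ k) F", OF this]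
    show ?case unfolding funpow.simps o_apply Suc.IH .
  qed simp
  then show ?thesis unfolding mqk_def operator_exp_def exp_iota_def by (simp only:)
qed

lemma super_function_chart: "F \<in> super_functions A \<Longrightarrow> F c \<in> sfuns"
proof -
  assume F: "F \<in> super_functions A"
  note F' = F[unfolded super_functions_def mem_Collect_eq]
  note F1 = conjunct1[OF F'] and F2 = conjunct1[OF conjunct2[OF F']]
    and F3 = conjunct1[OF conjunct2[OF conjunct2[OF F']]]
  from F3 obtain N where "\<forall>c p S m. F c p S m \<noteq> 0 \<longrightarrow> size m \<le> N" ..
  note N = this[rule_format]
  have supp: "p \<in> cdom c \<and> S \<subseteq> {..<brank A + bdim A} \<and> set_mset m \<subseteq> {..<brank A}" if "F c p S m \<noteq> 0" for p S m
    using F1[rule_format, OF that] by simp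
  show ?thesis
  proof (rule sfunsI[where N = N])
    show "F c p S m = 0" if "p \<notin> cdom c" for p S m using supp that by blast
    show "chart_smooth A c (cdom c) (\<lambda>p. F c p S m)" for S m
      using F2[rule_format, OF c] by (simp add: chart_smooth_def)
    show "S \<subseteq> {..<brank A + bdim A} \<and> set_mset m \<subseteq> {..<brank A} \<and> size m \<le> N" if "F c p S m \<noteq> 0" for p S m
      using supp[OF that] N[OF that] by blast
  qed
qed

lemma mqk_intertwines_chart:
  assumes F: "F \<in> super_functions A"
  shows "mqk A (de_rham A F) c
    = (de_rham A (mqk A F) + lie_derivative A 1 (algebroid_vfield A) (mqk A F)) c"
proof -
  note Fc = super_function_chart[OF F]
  have G: "mqk A F c = exp_iota (F c)" by (rule mqk_chart[of F, OF Fc])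
  then have Gc: "mqk A F c \<in> sfuns" by (simp add: sfuns_exp_iota Fc)
  have d: "de_rham A (mqk A F) c = dform (exp_iota (F c))" by (simp add: de_rham_chart[of "mqk A F", OF Gc] G)
  have i: "contraction A (algebroid_vfield A) (mqk A F) c = iota (exp_iota (F c))"
    by (simp add: contraction_chart[of "mqk A F", OF Gc] G)
  have "contraction A (algebroid_vfield A) (de_rham A (mqk A F)) c = iota (dform (exp_iota (F c)))"
    using contraction_chart[of "de_rham A (mqk A F)"] by (simp add: d sfuns_dform sfuns_exp_iota Fc)
  moreover have "de_rham A (contraction A (algebroid_vfield A) (mqk A F)) c = dform (iota (exp_iota (F c)))"
    using de_rham_chart[of "contraction A (algebroid_vfield A) (mqk A F)"]
    by (simp add: i sfuns_iota sfuns_exp_iota Fc)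
  \<comment> \<open>For a vector field of degree 1 the contraction has degree 0, so the sign of the
    graded commutator is 1 and it becomes the plain commutator in \<open>lie\<close>.\<close>
  ultimately have "lie_derivative A 1 (algebroid_vfield A) (mqk A F) c = lie (exp_iota (F c))"
    by (simp add: lie_derivative_def graded_commutator_def lie_def fun_eq_iff fun_ops)
  moreover have "mqk A (de_rham A F) c = exp_iota (dform (F c))"
    using mqk_chart[of "de_rham A F"] by (simp add: de_rham_chart[where F = F, OF Fc] sfuns_dform Fc)
  ultimately show ?thesis by (simp add: exp_iota_dform[OF Fc] d fun_ops)
qed

end

text \<open>Equality of families also concerns indices that are not charts. There
  \<open>on_charts\<close> gives 0, and even the zeroth term of the exponential on the left is a
  value of \<open>de_rham\<close>.\<close>

lemma mqk_outside:
  assumes "c \<notin> atlas A"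
  shows "mqk A (de_rham A F) c
    = (de_rham A (mqk A F) + lie_derivative A 1 (algebroid_vfield A) (mqk A F)) c"
proof -
  have d: "de_rham A G c = 0" and i: "contraction A X G c = 0" for G X
    using assms by (simp_all add: de_rham_def contraction_def on_charts_def fun_eq_iff fun_ops)
  have "(contraction A (algebroid_vfield A) ^^ k) (de_rham A F) c = 0" for k
    by (cases k) (simp_all add: d i)
  then have "mqk A (de_rham A F) c = 0"
    by (simp add: mqk_def operator_exp_def fun_eq_iff fun_ops)
  then show ?thesis
    by (simp add: d i lie_derivative_def graded_commutator_def fun_eq_iff fun_ops)
qed

end

theorem lemma4p2p14:
  fixes A :: "('m::{t2_space, second_countable_topology}, 'v::real_vector) algebroid"
  assumes "lie_algebroid A"
  shows "\<forall>F\<in>super_functions A.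
    (mqk A \<circ> de_rham A) F =
    ((\<lambda>G. de_rham A G + lie_derivative A 1 (algebroid_vfield A) G) \<circ> mqk A) F"
proof
  fix F assume F: "F \<in> super_functions A"
  interpret algebroid_ctx A by unfold_locales (rule assms)
  show "(mqk A \<circ> de_rham A) F =
    ((\<lambda>G. de_rham A G + lie_derivative A 1 (algebroid_vfield A) G) \<circ> mqk A) F"
    unfolding o_apply
    by (rule ext) (use mqk_intertwines_chart[OF _ F] mqk_outside in blast)
qed

end
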